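(* Let $K_n$ ($n\in\mathbb N$), $K$ be closed and convex subsets of $V$, let $u_{0,n}\in K_n$, $u_0\in K$, $f_n,f\in L^2((0,T),V')$, and let $u_n$ (resp. $u$) be the weak solution of the parabolic variational inequality on $K_n$ with data $f_n,u_{0,n}$ (resp. on $K$ with data $f,u_0$). Suppose $f_n\to f$ in $L^2((0,T),V')$, $u_{0,n}\rightharpoonup u_0$ weakly in $V$ and $u_{0,n}\to u_0$ in $H$. If $K_n$ converges to $K$ in the sense of Mosco, then the sequence of weak solutions $u_n$ converges strongly to $u$ in $L^2((0,T),V)$.
   Context: Fix $0<T<\infty$. $V$ is a real separable reflexive Banach space and $H$ a separable Hilbert space forming an evolution triple $V\hookrightarrow H\hookrightarrow V'$ (continuous dense embeddings, $H$ identified with $H'$); $\langle\cdot,\cdot\rangle$ is the duality between $V'$ and $V$. $W((0,T),V,V')=\{u\in L^2((0,T),V):u'\in L^2((0,T),V')\}$ (distributional derivative), which embeds in $C([0,T],H)$. For closed convex $C\subset V$, $L^2((0,T),C)=\{u\in L^2((0,T),V):u(t)\in C\text{ a.e.}\}$. For each $t\in(0,T)$, $a(t;\cdot,\cdot)$ is a bilinear form on $V$ such that $t\mapsto a(t;u,v)$ is measurable for all $u,v\in V$; there is $M>0$ independent of $t$ with $|a(t;u,v)|\le M\|u\|_V\|v\|_V$; and there is $\alpha>0$ independent of $t$ with $a(t;u,u)\ge\alpha\|u\|_V^2$ for all $u\in V$. $A(t)\in\mathscr L(V,V')$ is defined by $\langle A(t)u,v\rangle=a(t;u,v)$. Parabolic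 variational inequality on a closed convex set $C\subset V$ with data $g\in L^2((0,T),V')$, $z_0\in C$: formally, $z(t)\in C$ for a.e. $t\in (0,T)$, $\langle z'(t),v-z(t)\rangle+\langle A(t)z(t),v-z(t)\rangle-\langle g(t),v-z(t)\rangle\ge0$ for all $v\in C$, $z(0)=z_0$. A weak solution is a function $z\in L^2((0,T),C)$ such that $$\int_0^T\langle v'(t),v(t)-z(t)\rangle+\langle A(t)z(t),v(t)-z(t)\rangle-\langle g(t),v(t)-z(t)\rangle\,dt+\tfrac12\|v(0)-z_0\|_H^2\ge0$$ for all $v\in W((0,T),V,V')\cap L^2((0,T),C)$. The weak solution is known to exist and be unique. "$K_n$ converges to $K$ in the sense of Mosco" means: (M1) for every $w\in K$ there exists a sequence $w_n\in K_n$ with $w_n\to w$ strongly in $V$; (M2) if $(n_k)$ is a sequence of indices converging to $\infty$, $w_k\in K_{n_k}$ for every $k$ and $w_k\rightharpoonup w$ weakly in $V$, then $w\in K$. *)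

theory Defs
  imports "HOL-Analysis.Analysis"
begin

section \<open>Evolution triples\<close>

definition reflexive_space :: "'v::real_normed_vector itself \<Rightarrow> bool" where
  "reflexive_space _ \<longleftrightarrow>
     (\<forall>\<Phi> :: ('v \<Rightarrow>\<^sub>L real) \<Rightarrow>\<^sub>L real. \<exists>x. \<forall>\<phi> :: 'v \<Rightarrow>\<^sub>L real. blinfun_apply \<Phi> \<phi> = blinfun_apply \<phi> x)"

text \<open>
  The embedding of \<open>V\<close> into \<open>H\<close> is the bounded linear map \<open>j\<close>; the dual \<open>V'\<close> is the type
  \<open>'v \<Rightarrow>\<^sub>L real\<close>, and the duality \<open>\<langle>f, v\<rangle>\<close> is application \<open>f v\<close>. Completeness and
  separability of the two spaces are expressed by the sorts \<open>banach\<close> and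
  \<open>second_countable_topology\<close>.
\<close>

definition evolution_triple ::
  "('v::{banach, second_countable_topology} \<Rightarrow>\<^sub>L 'h::{real_inner, banach, second_countable_topology}) \<Rightarrow> bool"
  where
  "evolution_triple j \<longleftrightarrow>
     reflexive_space TYPE('v) \<and> inj (blinfun_apply j) \<and> closure (range (blinfun_apply j)) = UNIV"

text \<open>The embedding of \<open>H\<close>, identified with its dual, into \<open>V'\<close>: \<open>h\<close> acts on \<open>V\<close> by \<open>v \<mapsto> (h, j v)\<close>.\<close>

definition pivot_to_dual ::
  "('v::real_normed_vector \<Rightarrow>\<^sub>L 'h::real_inner) \<Rightarrow> 'h \<Rightarrow> ('v \<Rightarrow>\<^sub>L real)" where
  "pivot_to_dual j h = blinfun_inner_left h o\<^sub>L j"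

lemma pivot_to_dual_apply: "blinfun_apply (pivot_to_dual j h) v = h \<bullet> j v"
  by (simp add: pivot_to_dual_def inner_commute)


section \<open>Bochner spaces on the time interval\<close>

text \<open>
  The Bochner integral of the library requires a second countable range type, which is not
  available for \<open>'v \<Rightarrow>\<^sub>L real\<close>. The two definitions below follow the library's definition
  for arbitrary normed ranges, with Borel measurability replaced by strong measurability.
\<close>

definition strongly_measurable :: "'a measure \<Rightarrow> ('a \<Rightarrow> 'b::real_normed_vector) \<Rightarrow> bool" where
  "strongly_measurable M f \<longleftrightarrow>
     (\<exists>s. (\<forall>i::nat. simple_function M (s i)) \<and> (AE x in M. (\<lambda>i. s i x) \<longlonglongrightarrow> f x))"

definition has_vector_bochner_integral ::
  "'a measure \<Rightarrow> ('a \<Rightarrow> 'b::real_normed_vector) \<Rightarrow> 'b \<Rightarrow> bool" where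
  "has_vector_bochner_integral M f I \<longleftrightarrow>
     strongly_measurable M f \<and>
     (\<exists>s. (\<forall>i::nat. Bochner_Integration.simple_bochner_integrable M (s i)) \<and>
          (\<lambda>i. \<integral>\<^sup>+x. ennreal (norm (f x - s i x)) \<partial>M) \<longlonglongrightarrow> 0 \<and>
          (\<lambda>i. Bochner_Integration.simple_bochner_integral M (s i)) \<longlonglongrightarrow> I)"

abbreviation time_measure :: "real \<Rightarrow> real measure" where
  "time_measure T \<equiv> lebesgue_on {0<..<T}"

text \<open>Elements of \<open>L2\<close> are functions, not classes modulo equality almost everywhere.\<close>

definition L2 :: "real \<Rightarrow> (real \<Rightarrow> 'b::real_normed_vector) set" where
  "L2 T = {f. strongly_measurable (time_measure T) f \<and>
              integrable (time_measure T) (\<lambda>t. (norm (f t))\<^sup>2)}"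

definition L2_norm :: "real \<Rightarrow> (real \<Rightarrow> 'b::real_normed_vector) \<Rightarrow> real" where
  "L2_norm T f = sqrt (\<integral>t. (norm (f t))\<^sup>2 \<partial>time_measure T)"

definition L2_tendsto ::
  "real \<Rightarrow> (nat \<Rightarrow> real \<Rightarrow> 'b::real_normed_vector) \<Rightarrow> (real \<Rightarrow> 'b) \<Rightarrow> bool" where
  "L2_tendsto T fs f \<longleftrightarrow> (\<lambda>n. L2_norm T (\<lambda>t. fs n t - f t)) \<longlonglongrightarrow> 0"

definition L2_in :: "real \<Rightarrow> 'b::real_normed_vector set \<Rightarrow> (real \<Rightarrow> 'b) set" where
  "L2_in T C = {u \<in> L2 T. AE t in time_measure T. u t \<in> C}"


section \<open>The space \<open>W((0,T),V,V')\<close>\<close>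

definition test_function :: "real \<Rightarrow> (real \<Rightarrow> real) \<Rightarrow> bool" where
  "test_function T \<phi> \<longleftrightarrow>
     (\<forall>k t. (deriv ^^ k) \<phi> differentiable (at t)) \<and>
     (\<exists>a b. 0 < a \<and> b < T \<and> (\<forall>t. t \<notin> {a..b} \<longrightarrow> \<phi> t = 0))"

text \<open>
  \<open>w\<close> is the distributional derivative of \<open>u\<close>: for all test functions \<open>\<phi>\<close>,
  \<open>\<integral> \<phi>' u = - \<integral> \<phi> w\<close> as an identity of Bochner integrals in \<open>V'\<close>, where \<open>u\<close> is regarded as
  \<open>V'\<close>-valued by means of the two embeddings.
\<close>

definition distributional_derivative ::
  "real \<Rightarrow> ('v::real_normed_vector \<Rightarrow>\<^sub>L 'h::real_inner) \<Rightarrow> (real \<Rightarrow> 'v) \<Rightarrow> (real \<Rightarrow> 'v \<Rightarrow>\<^sub>L real) \<Rightarrow> bool"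
  where
  "distributional_derivative T j u w \<longleftrightarrow>
     (\<forall>\<phi>. test_function T \<phi> \<longrightarrow>
       (\<exists>I. has_vector_bochner_integral (time_measure T)
              (\<lambda>t. deriv \<phi> t *\<^sub>R pivot_to_dual j (j (u t))) I \<and>
            has_vector_bochner_integral (time_measure T) (\<lambda>t. \<phi> t *\<^sub>R w t) (- I)))"

text \<open>\<open>(u, w) \<in> W_graph T j\<close> means that \<open>u\<close> belongs to \<open>W((0,T),V,V')\<close> with \<open>u' = w\<close>.\<close>

definition W_graph ::
  "real \<Rightarrow> ('v::real_normed_vector \<Rightarrow>\<^sub>L 'h::real_inner) \<Rightarrow> ((real \<Rightarrow> 'v) \<times> (real \<Rightarrow> 'v \<Rightarrow>\<^sub>L real)) set"
  where
  "W_graph T j = {(u, w). u \<in> L2 T \<and> w \<in> L2 T \<and> distributional_derivative T j u w}"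

text \<open>
  The representative in \<open>C([0,T],H)\<close>, which exists for members of \<open>W((0,T),V,V')\<close> by the
  classical embedding theorem and whose values on \<open>[0,T]\<close> are unique.
\<close>

definition continuous_representative ::
  "real \<Rightarrow> ('v::real_normed_vector \<Rightarrow>\<^sub>L 'h::real_inner) \<Rightarrow> (real \<Rightarrow> 'v) \<Rightarrow> real \<Rightarrow> 'h" where
  "continuous_representative T j u =
     (SOME c. continuous_on {0..T} c \<and> (AE t in time_measure T. c t = j (u t)))"


section \<open>Forms and parabolic variational inequalities\<close>

definition coercive_forms ::
  "real \<Rightarrow> real \<Rightarrow> real \<Rightarrow> (real \<Rightarrow> 'v::real_normed_vector \<Rightarrow> 'v \<Rightarrow> real) \<Rightarrow> bool" where
  "coercive_forms T M \<alpha> a \<longleftrightarrow>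
     (\<forall>t\<in>{0<..<T}. bilinear (a t)) \<and>
     (\<forall>u v. (\<lambda>t. a t u v) \<in> borel_measurable (time_measure T)) \<and>
     (\<forall>t\<in>{0<..<T}. \<forall>u v. \<bar>a t u v\<bar> \<le> M * norm u * norm v) \<and>
     (\<forall>t\<in>{0<..<T}. \<forall>u. a t u u \<ge> \<alpha> * (norm u)\<^sup>2)"

definition form_operator ::
  "('v::real_normed_vector \<Rightarrow> 'v \<Rightarrow> real) \<Rightarrow> 'v \<Rightarrow>\<^sub>L 'v \<Rightarrow>\<^sub>L real" where
  "form_operator b = Blinfun (\<lambda>u. Blinfun (\<lambda>v. b u v))"

lemma form_operator_apply:
  fixes b :: "'v::real_normed_vector \<Rightarrow> 'v \<Rightarrow> real"
  assumes b: "bilinear b" and bd: "\<And>u v. \<bar>b u v\<bar> \<le> M * norm u * norm v"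
  shows "form_operator b u v = b u v"
proof -
  have bb: "bounded_bilinear b"
  proof (rule bounded_bilinear.intro)
    show "\<exists>K. \<forall>a c. norm (b a c) \<le> norm a * norm c * K"
      using bd by (intro exI[of _ M]) (simp add: ac_simps)
  qed (use b in \<open>auto simp: bilinear_ladd bilinear_radd bilinear_lmul bilinear_rmul\<close>)
  have 1: "blinfun_apply (Blinfun (b u)) = b u" for u
    using bounded_bilinear.bounded_linear_right[OF bb] by (simp add: bounded_linear_Blinfun_apply)
  have "bounded_linear (\<lambda>u. Blinfun (b u))"
  proof (rule bounded_linear_intro)
    show "norm (Blinfun (b u)) \<le> norm u * \<bar>M\<bar>" for u
    proof (rule norm_blinfun_bound)
      fix v :: 'v
      have "M * (norm u * norm v) \<le> \<bar>M\<bar> * (norm u * norm v)"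
        by (intro mult_right_mono) auto
      then show "norm (Blinfun (b u) v) \<le> norm u * \<bar>M\<bar> * norm v"
        using bd[of u v] by (simp add: 1 ac_simps)
    qed simp
  qed (use b in \<open>auto intro!: blinfun_eqI
        simp: 1 bilinear_ladd bilinear_lmul blinfun.add_left blinfun.scaleR_left\<close>)
  then show ?thesis
    by (simp add: form_operator_def bounded_linear_Blinfun_apply 1)
qed

definition weak_solution ::
  "real \<Rightarrow> ('v::{banach, second_countable_topology} \<Rightarrow>\<^sub>L 'h::{real_inner, banach, second_countable_topology}) \<Rightarrow>
   (real \<Rightarrow> 'v \<Rightarrow> 'v \<Rightarrow> real) \<Rightarrow> 'v set \<Rightarrow> (real \<Rightarrow> 'v \<Rightarrow>\<^sub>L real) \<Rightarrow> 'v \<Rightarrow> (real \<Rightarrow> 'v) \<Rightarrow> bool"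
  where
  "weak_solution T j a C g z\<^sub>0 z \<longleftrightarrow>
     z \<in> L2_in T C \<and>
     (\<forall>v v'. (v, v') \<in> W_graph T j \<and> v \<in> L2_in T C \<longrightarrow>
        (\<integral>t. v' t (v t - z t) + form_operator (a t) (z t) (v t - z t) - g t (v t - z t)
           \<partial>time_measure T)
        + 1/2 * (norm (continuous_representative T j v 0 - j z\<^sub>0))\<^sup>2 \<ge> 0)"


section \<open>Weak and Mosco convergence\<close>

definition weakly_tendsto :: "(nat \<Rightarrow> 'v::real_normed_vector) \<Rightarrow> 'v \<Rightarrow> bool" where
  "weakly_tendsto w x \<longleftrightarrow> (\<forall>\<phi> :: 'v \<Rightarrow>\<^sub>L real. (\<lambda>n. \<phi> (w n)) \<longlonglongrightarrow> \<phi> x)"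

definition mosco_converges :: "(nat \<Rightarrow> 'v::real_normed_vector set) \<Rightarrow> 'v set \<Rightarrow> bool" where
  "mosco_converges Ks K \<longleftrightarrow>
     (\<forall>w\<in>K. \<exists>ws. (\<forall>n. ws n \<in> Ks n) \<and> ws \<longlonglongrightarrow> w) \<and>
     (\<forall>ns ws w. filterlim ns at_top sequentially \<and> (\<forall>k. ws k \<in> Ks (ns k)) \<and> weakly_tendsto ws w
        \<longrightarrow> w \<in> K)"

end

theory Submission
  imports Defs "HOL-Complex_Analysis.Great_Picard"
begin

text \<open>
  Solutions are tested with the regularization \<open>v\<close> of some \<open>h\<close> with values in the convex set, the
  solution of \<open>e v' + v = h\<close>, \<open>v 0 = x0\<close>. It stays in the convex set, as its values are averages of
  \<open>x0\<close> and values of \<open>h\<close>, and \<open>\<langle>v', v - h\<rangle> = - e |v'|^2 \<le> 0\<close>. A bounded coercive form makes \<open>L2\<close> a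
  Hilbert space up to equivalence of norms, so the bounded sequence \<open>un\<close> has a weakly convergent
  subsequence, and its limit \<open>w\<close> has values in \<open>K\<close> by Mosco convergence. Let \<open>h = (u + w) / 2\<close>. The
  inequality for \<open>u\<close> and the limit of the inequalities for \<open>un\<close>, both tested with the regularization
  of \<open>h\<close>, add up as \<open>e\<close> tends to \<open>0\<close> to
  \<open>limsup a(un - w, un - w) + 1/2 a(u - w, u - w) \<le> 0\<close>; hence \<open>w = u\<close> and the convergence is strong.
\<close>

text \<open>Weak solutions come without a time derivative, so \<open>u\<close> and \<open>un\<close>
  cannot be inserted into each other's inequality; only regularizations can. The midpoint is forced
  by the derivative terms: those of the two inequalities add up to
  \<open>(v', v - u) + (v', v - w) = 2 (v', v - h)\<close>, which is the expression with a sign. The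
  regularization also carries Mosco convergence from \<open>V\<close> to \<open>L2\<close>: weak
  convergence in \<open>L2\<close> says nothing about single times, but the value of a
  regularization at a fixed time depends on the function in a bounded affine way, so at each time
  the regularized \<open>un\<close> converge weakly in \<open>V\<close>. Test functions for the
  inequality on \<open>Kn n\<close> have to converge strongly in \<open>L2\<close> with values in
  \<open>V\<close>. The data \<open>u0n\<close> converge only weakly in \<open>V\<close> and do not
  give this as starting values, so the regularizations start from points \<open>x n\<close> of
  \<open>Kn n\<close> that converge strongly to \<open>u0\<close>. The price is the initial term
  \<open>1/2 * (norm (j (x n) - j (u0n n)))^2\<close>, which vanishes in the limit because
  \<open>u0n\<close> converges to \<open>u0\<close> in \<open>H\<close>.\<close>

section \<open>Measurability for the completed measure on the time interval\<close>

lemma complete_measure_lebesgue_on: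
  assumes "S \<in> sets lebesgue" shows "complete_measure (lebesgue_on S)"
proof
  fix A B assume "B \<subseteq> A" "A \<in> null_sets (lebesgue_on S)"
  then have "B \<subseteq> S" "A \<in> null_sets lebesgue"
    using assms by (auto simp: null_sets_restrict_space)
  then have "B \<in> null_sets lebesgue"
    using \<open>B \<subseteq> A\<close> by (metis completion.complete2)
  then show "B \<in> sets (lebesgue_on S)"
    using assms \<open>B \<subseteq> S\<close> by (metis null_sets_restrict_space null_setsD2 IntI PowI)
qed

interpretation time: complete_measure "time_measure T" for T
  by (rule complete_measure_lebesgue_on) simp

interpretation time: finite_measure "time_measure T" for T
  by (rule finite_measure_lebesgue_on) simp

lemma borel_measurable_time:
  "f \<in> borel_measurable borel \<Longrightarrow> f \<in> borel_measurable (time_measure T)"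
  by (intro measurable_restrict_space1 measurable_completion) simp

text \<open>The preimages of a set under \<open>f\<close> and \<open>g\<close> differ by a null set,
  and completeness makes every such modification measurable.\<close>

lemma (in complete_measure) borel_measurable_AE_eq:
  assumes f: "f \<in> borel_measurable M" and eq: "AE x in M. f x = g x"
  shows "g \<in> borel_measurable M"
proof (rule measurableI)
  fix A :: "'b set" assume A: "A \<in> sets borel"
  have "AE x in M. x \<in> f -` A \<inter> space M \<longleftrightarrow> x \<in> g -` A \<inter> space M"
    using eq by eventually_elim auto
  then show "g -` A \<inter> space M \<in> sets M"
    by (rule in_sets_AE) (use f A in \<open>auto intro: measurable_sets\<close>)
qed auto

lemma (in complete_measure) borel_measurable_AE_LIMSEQ:
  fixes F :: "nat \<Rightarrow> 'a \<Rightarrow> 'b::metric_space"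
  assumes F: "\<And>i. F i \<in> borel_measurable M" and lim: "AE x in M. (\<lambda>i. F i x) \<longlonglongrightarrow> f x"
  shows "f \<in> borel_measurable M"
proof -
  obtain N where N: "N \<in> null_sets M" "\<And>x. x \<in> space M - N \<Longrightarrow> (\<lambda>i. F i x) \<longlonglongrightarrow> f x"
    using AE_E3[OF lim] by metis
  \<comment> \<open>On the exceptional set all functions are replaced by the constant
    \<open>undefined\<close>, so that convergence holds at every point.\<close>
  have "(\<lambda>x. if x \<in> N then undefined else f x) \<in> borel_measurable M"
  proof (rule borel_measurable_LIMSEQ_metric)
    show "(\<lambda>x. if x \<in> N then undefined else F i x) \<in> borel_measurable M" for i
      using F N by (intro measurable_If_set) auto
    show "(\<lambda>i. if x \<in> N then undefined else F i x) \<longlonglongrightarrow> (if x \<in> N then undefined else f x)"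
      if "x \<in> space M" for x
      using N(2)[of x] that by auto
  qed
  moreover have "AE x in M. (if x \<in> N then undefined else f x) = f x"
    using AE_not_in[OF N(1)] by eventually_elim auto
  ultimately show ?thesis
    by (rule borel_measurable_AE_eq)
qed

lemma strongly_measurableE:
  assumes "strongly_measurable M f"
  obtains s :: "nat \<Rightarrow> 'a \<Rightarrow> 'b::real_normed_vector"
  where "\<And>i. simple_function M (s i)" "AE t in M. (\<lambda>i. s i t) \<longlonglongrightarrow> f t"
  using assms unfolding strongly_measurable_def by metis

lemma strongly_measurableI:
  assumes "\<And>i::nat. simple_function M (s i)" "AE t in M. (\<lambda>i. s i t) \<longlonglongrightarrow> f t"
  shows "strongly_measurable M f"
  unfolding strongly_measurable_def using assms by (intro exI[of _ s] conjI allI)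

text \<open>Separability of the range provides simple functions that converge pointwise to a Borel
  function; completeness of the time measure covers the converse, where convergence holds only
  almost everywhere.\<close>

lemma strongly_measurable_iff_borel:
  fixes f :: "real \<Rightarrow> 'b::{real_normed_vector, second_countable_topology}"
  shows "strongly_measurable (time_measure T) f \<longleftrightarrow> f \<in> borel_measurable (time_measure T)"
proof
  assume "strongly_measurable (time_measure T) f"
  then obtain s where s: "\<And>i::nat. simple_function (time_measure T) (s i)"
    "AE t in time_measure T. (\<lambda>i. s i t) \<longlonglongrightarrow> f t"
    by (rule strongly_measurableE) (rule that)
  show "f \<in> borel_measurable (time_measure T)"
    by (rule time.borel_measurable_AE_LIMSEQ[OF borel_measurable_simple_function[OF s(1)] s(2)])
next
  assume "f \<in> borel_measurable (time_measure T)"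
  from borel_measurable_implies_sequence_metric[OF this, of 0]
  obtain s where s: "\<And>i::nat. simple_function (time_measure T) (s i)"
    "\<And>t. t \<in> space (time_measure T) \<Longrightarrow> (\<lambda>i. s i t) \<longlonglongrightarrow> f t"
    by metis
  show "strongly_measurable (time_measure T) f"
    using s(1) AE_I2[OF s(2)] by (rule strongly_measurableI)
qed

text \<open>Simple functions are stable under any binary operation and continuity of
  \<open>h\<close> passes to the limit, so sums, multiples and duality pairings are strongly
  measurable also for functions with values in the dual.\<close>

lemma strongly_measurable_compose2:
  assumes f: "strongly_measurable M f" and g: "strongly_measurable M g"
    and h: "\<And>x y. isCont (\<lambda>p. h (fst p) (snd p)) (x, y)"
  shows "strongly_measurable M (\<lambda>t. h (f t) (g t))"
proof -
  obtain s where s: "\<And>i. simple_function M (s i)" "AE x in M. (\<lambda>i. s i x) \<longlonglongrightarrow> f x"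
    using f by (rule strongly_measurableE) (rule that)
  obtain r where r: "\<And>i. simple_function M (r i)" "AE x in M. (\<lambda>i. r i x) \<longlonglongrightarrow> g x"
    using g by (rule strongly_measurableE) (rule that)
  show ?thesis
  proof (rule strongly_measurableI)
    show "simple_function M (\<lambda>x. h (s i x) (r i x))" for i
      using s(1) r(1) by (rule simple_function_compose2)
    show "AE x in M. (\<lambda>i. h (s i x) (r i x)) \<longlonglongrightarrow> h (f x) (g x)"
      using s(2) r(2)
    proof eventually_elim
      case (elim x)
      show ?case using isCont_tendsto_compose[OF h tendsto_Pair[OF elim]] by simp
    qed
  qed
qed

lemma strongly_measurable_add:
  assumes "strongly_measurable M f" "strongly_measurable M g"
  shows "strongly_measurable M (\<lambda>t. f t + g t)"
  by (rule strongly_measurable_compose2[OF assms]) (intro continuous_intros)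

lemma strongly_measurable_scaleR:
  assumes "strongly_measurable M c" "strongly_measurable M f"
  shows "strongly_measurable M (\<lambda>t. c t *\<^sub>R f t)"
  by (rule strongly_measurable_compose2[OF assms]) (intro continuous_intros)

lemma strongly_measurable_blinfun_apply:
  assumes "strongly_measurable M f" "strongly_measurable M g"
  shows "strongly_measurable M (\<lambda>t. blinfun_apply (f t) (g t))"
  by (rule strongly_measurable_compose2[OF assms]) (intro continuous_intros)

lemma strongly_measurable_const: "strongly_measurable M (\<lambda>t. c)"
  by (rule strongly_measurableI[of _ "\<lambda>_ _. c"]) auto

lemma strongly_measurable_norm:
  assumes "strongly_measurable M f" shows "strongly_measurable M (\<lambda>t. norm (f t))"
  by (rule strongly_measurable_compose2[OF assms assms, of "\<lambda>x y. norm x"]) (intro continuous_intros)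

section \<open>The space L2 and its norm\<close>

lemma L2_strongly_measurable: "f \<in> L2 T \<Longrightarrow> strongly_measurable (time_measure T) f"
  by (simp add: L2_def)

lemma L2_integrable_norm2: "f \<in> L2 T \<Longrightarrow> integrable (time_measure T) (\<lambda>t. (norm (f t))\<^sup>2)"
  by (simp add: L2_def)

lemma L2_bounded_by:
  assumes f: "strongly_measurable (time_measure T) f" and g: "g \<in> L2 T"
    and le: "AE t in time_measure T. norm (f t) \<le> C * norm (g t)"
  shows "f \<in> L2 T"
proof -
  have [measurable]: "(\<lambda>t. norm (f t)) \<in> borel_measurable (time_measure T)"
    using strongly_measurable_norm[OF f] by (simp add: strongly_measurable_iff_borel)
  have "integrable (time_measure T) (\<lambda>t. (norm (f t))\<^sup>2)"
  proof (rule Bochner_Integration.integrable_bound)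
    show "integrable (time_measure T) (\<lambda>t. C\<^sup>2 * (norm (g t))\<^sup>2)"
      using L2_integrable_norm2[OF g] by simp
    show "AE t in time_measure T. norm ((norm (f t))\<^sup>2) \<le> norm (C\<^sup>2 * (norm (g t))\<^sup>2)"
      using le
    proof eventually_elim
      case (elim t)
      have "(norm (f t))\<^sup>2 \<le> (C * norm (g t))\<^sup>2"
        using elim by (intro power_mono) auto
      then show ?case by (simp add: power_mult_distrib)
    qed
  qed simp
  with f show ?thesis by (simp add: L2_def)
qed

lemma L2_scaleR:
  assumes "f \<in> L2 T" shows "(\<lambda>t. c *\<^sub>R f t) \<in> L2 T"
  by (rule L2_bounded_by[OF _ assms, of _ "\<bar>c\<bar>"])
     (use assms in \<open>auto simp: L2_def intro!: strongly_measurable_scaleR strongly_measurable_const\<close>)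

lemma L2_const: "(\<lambda>t. c) \<in> L2 T"
  by (simp add: L2_def strongly_measurable_const)

lemma L2_realI: "(\<lambda>t. norm (f t)) \<in> L2 T" if "f \<in> L2 T"
  using that by (simp add: L2_def strongly_measurable_norm)

lemma L2_norm_norm: "L2_norm T (\<lambda>t. norm (f t)) = L2_norm T f"
  by (simp add: L2_norm_def)

lemma L2_mult_integrable:
  fixes f g :: "real \<Rightarrow> real"
  assumes f: "f \<in> L2 T" and g: "g \<in> L2 T"
  shows "integrable (time_measure T) (\<lambda>t. f t * g t)"
proof (rule Bochner_Integration.integrable_bound)
  show "integrable (time_measure T) (\<lambda>t. (f t)\<^sup>2 + (g t)\<^sup>2)"
    using f g by (simp add: L2_def)
  show "(\<lambda>t. f t * g t) \<in> borel_measurable (time_measure T)"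
    using f g by (auto simp: L2_def strongly_measurable_iff_borel)
  show "AE t in time_measure T. norm (f t * g t) \<le> norm ((f t)\<^sup>2 + (g t)\<^sup>2)"
  proof (rule AE_I2)
    fix t
    have "2 * \<bar>f t * g t\<bar> \<le> (f t)\<^sup>2 + (g t)\<^sup>2"
      using sum_squares_bound[of "\<bar>f t\<bar>" "\<bar>g t\<bar>"] by (simp add: abs_mult)
    then show "norm (f t * g t) \<le> norm ((f t)\<^sup>2 + (g t)\<^sup>2)" by simp
  qed
qed

text \<open>The integral of \<open>(f - r g)^2\<close> is a nonnegative polynomial of degree at most
  two in \<open>r\<close>; its value at the minimizer \<open>?b / ?c\<close> gives the
  claim.\<close>

lemma L2_Cauchy_Schwarz:
  fixes f g :: "real \<Rightarrow> real"
  assumes f: "f \<in> L2 T" and g: "g \<in> L2 T"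
  shows "\<bar>\<integral>t. f t * g t \<partial>time_measure T\<bar> \<le> L2_norm T f * L2_norm T g"
proof -
  let ?M = "time_measure T"
  let ?a = "\<integral>t. (f t)\<^sup>2 \<partial>?M" and ?b = "\<integral>t. f t * g t \<partial>?M" and ?c = "\<integral>t. (g t)\<^sup>2 \<partial>?M"
  have i: "integrable ?M (\<lambda>t. (f t)\<^sup>2)" "integrable ?M (\<lambda>t. (g t)\<^sup>2)" "integrable ?M (\<lambda>t. f t * g t)"
    using f g L2_mult_integrable by (auto simp: L2_def)
  have *: "0 \<le> ?a - 2 * r * ?b + r\<^sup>2 * ?c" for r
  proof -
    have "0 \<le> (\<integral>t. (f t - r * g t)\<^sup>2 \<partial>?M)" by simp
    also have "(\<lambda>t. (f t - r * g t)\<^sup>2) = (\<lambda>t. (f t)\<^sup>2 - 2 * r * (f t * g t) + r\<^sup>2 * (g t)\<^sup>2)"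
      by (simp add: power2_eq_square algebra_simps)
    finally show ?thesis using i by simp
  qed
  have ac: "0 \<le> ?a" "0 \<le> ?c" by simp_all
  have "?b\<^sup>2 \<le> ?a * ?c"
  proof (cases "?c = 0")
    case True
    have "?b = 0"
    proof (rule ccontr)
      assume "?b \<noteq> 0"
      \<comment> \<open>With \<open>?c = 0\<close> the polynomial is affine in \<open>r\<close>; at
        this \<open>r\<close> it equals \<open>-1\<close>.\<close>
      then show False
        using *[of "(?a + 1) / (2 * ?b)"] True by (simp add: field_simps)
    qed
    then show ?thesis using True by simp
  next
    case False
    then have "0 < ?c" using ac by linarith
    then show ?thesis
      using *[of "?b / ?c"] by (simp add: field_simps power2_eq_square)
  qed
  then have "sqrt (?b\<^sup>2) \<le> sqrt (?a * ?c)" by (rule real_sqrt_le_mono)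
  then show ?thesis by (simp add: L2_norm_def real_sqrt_mult)
qed

lemma L2_norm_nonneg: "0 \<le> L2_norm T f"
  by (simp add: L2_norm_def)

lemma L2_tendstoI:
  assumes "\<And>n. L2_norm T (\<lambda>t. xs n t - x t) \<le> b n" "b \<longlonglongrightarrow> 0"
  shows "L2_tendsto T xs x"
  unfolding L2_tendsto_def
  by (rule tendsto_sandwich[OF always_eventually always_eventually tendsto_const assms(2)])
    (use assms(1) in \<open>simp_all add: L2_norm_nonneg\<close>)

lemma L2_norm_power2: "(L2_norm T f)\<^sup>2 = (\<integral>t. (norm (f t))\<^sup>2 \<partial>time_measure T)"
  by (simp add: L2_norm_def)

lemma L2_add:
  assumes f: "f \<in> L2 T" and g: "g \<in> L2 T" shows "(\<lambda>t. f t + g t) \<in> L2 T"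
proof -
  have m: "strongly_measurable (time_measure T) (\<lambda>t. norm (f t) + norm (g t))"
    using f g by (auto simp: L2_def intro!: strongly_measurable_add strongly_measurable_norm)
  have "(\<lambda>t. (norm (f t) + norm (g t))\<^sup>2)
      = (\<lambda>t. (norm (f t))\<^sup>2 + 2 * (norm (f t) * norm (g t)) + (norm (g t))\<^sup>2)"
    by (simp add: power2_eq_square algebra_simps)
  then have "integrable (time_measure T) (\<lambda>t. (norm (f t) + norm (g t))\<^sup>2)"
    using f g L2_mult_integrable[OF L2_realI[OF f] L2_realI[OF g]] by (simp add: L2_def)
  then have "(\<lambda>t. norm (f t) + norm (g t)) \<in> L2 T"
    using m by (simp add: L2_def)
  then show ?thesis
    by (rule L2_bounded_by[rotated, of _ _ _ 1])
       (use f g in \<open>auto simp: L2_def intro!: strongly_measurable_add norm_triangle_ineq\<close>)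
qed

lemma L2_diff:
  assumes f: "f \<in> L2 T" and g: "g \<in> L2 T" shows "(\<lambda>t. f t - g t) \<in> L2 T"
  using L2_add[OF f L2_scaleR[OF g, of "-1"]] by simp

lemma L2_norm_triangle:
  assumes f: "f \<in> L2 T" and g: "g \<in> L2 T"
  shows "L2_norm T (\<lambda>t. f t + g t) \<le> L2_norm T f + L2_norm T g"
proof -
  let ?M = "time_measure T"
  have i: "integrable ?M (\<lambda>t. (norm (f t))\<^sup>2)" "integrable ?M (\<lambda>t. (norm (g t))\<^sup>2)"
    "integrable ?M (\<lambda>t. norm (f t) * norm (g t))"
    using f g L2_mult_integrable[OF L2_realI[OF f] L2_realI[OF g]] by (auto simp: L2_def)
  have "(L2_norm T (\<lambda>t. f t + g t))\<^sup>2 = (\<integral>t. (norm (f t + g t))\<^sup>2 \<partial>?M)"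
    by (rule L2_norm_power2)
  also have "\<dots> \<le> (\<integral>t. (norm (f t))\<^sup>2 + 2 * (norm (f t) * norm (g t)) + (norm (g t))\<^sup>2 \<partial>?M)"
  proof (rule integral_mono)
    show "integrable ?M (\<lambda>t. (norm (f t + g t))\<^sup>2)"
      using L2_add[OF f g] by (rule L2_integrable_norm2)
    show "(norm (f t + g t))\<^sup>2 \<le> (norm (f t))\<^sup>2 + 2 * (norm (f t) * norm (g t)) + (norm (g t))\<^sup>2" for t
    proof -
      have "(norm (f t + g t))\<^sup>2 \<le> (norm (f t) + norm (g t))\<^sup>2"
        by (intro power_mono norm_triangle_ineq) auto
      then show ?thesis by (simp add: power2_eq_square algebra_simps)
    qed
  qed (use i in simp)
  also have "\<dots> = (L2_norm T f)\<^sup>2 + 2 * (\<integral>t. norm (f t) * norm (g t) \<partial>?M) + (L2_norm T g)\<^sup>2"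
    using i by (simp add: L2_norm_power2)
  also have "\<dots> \<le> (L2_norm T f)\<^sup>2 + 2 * (L2_norm T f * L2_norm T g) + (L2_norm T g)\<^sup>2"
    using L2_Cauchy_Schwarz[OF L2_realI[OF f] L2_realI[OF g]] by (simp add: L2_norm_norm)
  also have "\<dots> = (L2_norm T f + L2_norm T g)\<^sup>2"
    by (simp add: power2_eq_square algebra_simps)
  finally show ?thesis
    by (rule power2_le_imp_le) (simp add: L2_norm_nonneg)
qed

lemma L2_norm_scaleR: "L2_norm T (\<lambda>t. c *\<^sub>R f t) = \<bar>c\<bar> * L2_norm T f"
  by (simp add: L2_norm_def power_mult_distrib real_sqrt_mult)

lemma L2_norm_minus_commute: "L2_norm T (\<lambda>t. f t - g t) = L2_norm T (\<lambda>t. g t - f t)"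
  by (simp add: L2_norm_def norm_minus_commute)

lemma L2_norm_triangle_diff:
  assumes "f \<in> L2 T" "g \<in> L2 T" "h \<in> L2 T"
  shows "L2_norm T (\<lambda>t. f t - h t) \<le> L2_norm T (\<lambda>t. f t - g t) + L2_norm T (\<lambda>t. g t - h t)"
  using L2_norm_triangle[OF L2_diff[OF assms(1,2)] L2_diff[OF assms(2,3)]] by simp

lemma L2_norm_mono:
  assumes "f \<in> L2 T" "g \<in> L2 T" "AE t in time_measure T. norm (f t) \<le> norm (g t)"
  shows "L2_norm T f \<le> L2_norm T g"
  unfolding L2_norm_def
proof (intro real_sqrt_le_mono integral_mono_AE)
  show "AE t in time_measure T. (norm (f t))\<^sup>2 \<le> (norm (g t))\<^sup>2"
    using assms(3) by eventually_elim (auto intro: power_mono)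
qed (use assms L2_integrable_norm2 in auto)

lemma L2_cong_AE:
  assumes f: "f \<in> L2 T" and eq: "AE t in time_measure T. f t = g t"
  shows "g \<in> L2 T"
proof (rule L2_bounded_by[OF _ f, of _ 1])
  obtain s where s: "\<And>i. simple_function (time_measure T) (s i)"
    "AE x in time_measure T. (\<lambda>i. s i x) \<longlonglongrightarrow> f x"
    using f by (rule L2_strongly_measurable[THEN strongly_measurableE]) (rule that)
  from s(2) eq have "AE x in time_measure T. (\<lambda>i. s i x) \<longlonglongrightarrow> g x"
    by eventually_elim simp
  with s(1) show "strongly_measurable (time_measure T) g"
    by (rule strongly_measurableI)
  show "AE t in time_measure T. norm (g t) \<le> 1 * norm (f t)"
    using eq by eventually_elim simp
qed

lemma L2_borel_measurable:
  fixes f :: "real \<Rightarrow> 'b::{real_normed_vector, second_countable_topology}"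
  shows "f \<in> L2 T \<Longrightarrow> f \<in> borel_measurable (time_measure T)"
  by (simp add: L2_def strongly_measurable_iff_borel)

lemma L2_integrable:
  fixes f :: "real \<Rightarrow> 'b::{banach, second_countable_topology}"
  assumes "f \<in> L2 T" shows "integrable (time_measure T) f"
proof (rule Bochner_Integration.integrable_bound)
  show "integrable (time_measure T) (\<lambda>t. 1 * norm (f t))"
    by (rule L2_mult_integrable[OF L2_const L2_realI[OF assms]])
qed (use assms L2_borel_measurable in auto)

subsection \<open>Bounded functionals and weak convergence in L2\<close>

text \<open>Elements of the dual of L2. Since \<open>L2\<close> consists of functions, equality
  almost everywhere is respected through the bound: functions at distance 0 get the same
  value.\<close>

definition L2_functional :: "real \<Rightarrow> ((real \<Rightarrow> 'v::real_normed_vector) \<Rightarrow> real) \<Rightarrow> bool" where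
  "L2_functional T G \<longleftrightarrow>
     (\<forall>x\<in>L2 T. \<forall>y\<in>L2 T. G (\<lambda>t. x t + y t) = G x + G y) \<and>
     (\<forall>c. \<forall>x\<in>L2 T. G (\<lambda>t. c *\<^sub>R x t) = c * G x) \<and>
     (\<exists>C. \<forall>x\<in>L2 T. \<bar>G x\<bar> \<le> C * L2_norm T x)"

lemma L2_functional_add:
  "L2_functional T G \<Longrightarrow> x \<in> L2 T \<Longrightarrow> y \<in> L2 T \<Longrightarrow> G (\<lambda>t. x t + y t) = G x + G y"
  by (simp add: L2_functional_def)

lemma L2_functional_scaleR:
  "L2_functional T G \<Longrightarrow> x \<in> L2 T \<Longrightarrow> G (\<lambda>t. c *\<^sub>R x t) = c * G x"
  by (simp add: L2_functional_def)

lemma L2_functional_diff: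
  assumes "L2_functional T G" "x \<in> L2 T" "y \<in> L2 T"
  shows "G (\<lambda>t. x t - y t) = G x - G y"
proof -
  have "G (\<lambda>t. x t + (-1) *\<^sub>R y t) = G x + G (\<lambda>t. (-1) *\<^sub>R y t)"
    by (rule L2_functional_add[OF assms(1,2) L2_scaleR[OF assms(3)]])
  also have "G (\<lambda>t. (-1) *\<^sub>R y t) = - 1 * G y"
    by (rule L2_functional_scaleR[OF assms(1,3)])
  finally show ?thesis by simp
qed

lemma L2_functional_tendsto:
  assumes G: "L2_functional T G" and xs: "\<And>n. xs n \<in> L2 T" "x \<in> L2 T" "L2_tendsto T xs x"
  shows "(\<lambda>n. G (xs n)) \<longlonglongrightarrow> G x"
proof -
  obtain C where C: "\<And>y. y \<in> L2 T \<Longrightarrow> \<bar>G y\<bar> \<le> C * L2_norm T y"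
    using G unfolding L2_functional_def by blast
  have "(\<lambda>n. G (xs n) - G x) \<longlonglongrightarrow> 0"
  proof (rule Lim_null_comparison)
    show "\<forall>\<^sub>F n in sequentially. norm (G (xs n) - G x) \<le> C * L2_norm T (\<lambda>t. xs n t - x t)"
      using C[OF L2_diff[OF xs(1,2)]] L2_functional_diff[OF G xs(1,2)] by simp
    show "(\<lambda>n. C * L2_norm T (\<lambda>t. xs n t - x t)) \<longlonglongrightarrow> 0"
      using xs(3) unfolding L2_tendsto_def by (rule tendsto_mult_right_zero)
  qed
  then show ?thesis by (simp add: LIM_zero_iff)
qed

definition L2_weakly_tendsto ::
  "real \<Rightarrow> (nat \<Rightarrow> real \<Rightarrow> 'v::real_normed_vector) \<Rightarrow> (real \<Rightarrow> 'v) \<Rightarrow> bool" where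
  "L2_weakly_tendsto T xs x \<longleftrightarrow> (\<forall>G. L2_functional T G \<longrightarrow> (\<lambda>n. G (xs n)) \<longlonglongrightarrow> G x)"

text \<open>Shared by the duality pairing, with \<open>C = 1\<close>, and by the bounded forms; the
  pointwise bound is integrated with the Cauchy-Schwarz inequality.\<close>

lemma L2_bilinear_bound:
  assumes q: "q \<in> borel_measurable (time_measure T)"
    and x: "x \<in> L2 T" and y: "y \<in> L2 T" and C: "0 \<le> C"
    and le: "\<And>t. t \<in> {0<..<T} \<Longrightarrow> \<bar>q t\<bar> \<le> C * norm (x t) * norm (y t)"
  shows "integrable (time_measure T) q"
    and "\<bar>\<integral>t. q t \<partial>time_measure T\<bar> \<le> C * L2_norm T x * L2_norm T y"
proof -
  have i: "integrable (time_measure T) (\<lambda>t. C * (norm (x t) * norm (y t)))"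
    using L2_mult_integrable[OF L2_realI[OF x] L2_realI[OF y]] by simp
  have le': "AE t in time_measure T. \<bar>q t\<bar> \<le> C * (norm (x t) * norm (y t))"
    using le by (intro AE_I2) (auto simp: mult.assoc)
  show int: "integrable (time_measure T) q"
    by (rule Bochner_Integration.integrable_bound[OF i q]) (use le' C in \<open>auto simp: abs_mult\<close>)
  have "\<bar>\<integral>t. q t \<partial>time_measure T\<bar> \<le> (\<integral>t. C * (norm (x t) * norm (y t)) \<partial>time_measure T)"
    using int i le' by (intro order_trans[OF integral_abs_bound] integral_mono_AE) auto
  also have "\<dots> \<le> C * (L2_norm T x * L2_norm T y)"
    using L2_Cauchy_Schwarz[OF L2_realI[OF x] L2_realI[OF y]] C
    by (auto simp: L2_norm_norm intro!: mult_left_mono)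
  finally show "\<bar>\<integral>t. q t \<partial>time_measure T\<bar> \<le> C * L2_norm T x * L2_norm T y"
    by (simp add: mult.assoc)
qed

subsection \<open>Integrated duality and integrated forms\<close>

definition dual_integral :: "real \<Rightarrow> (real \<Rightarrow> 'v::real_normed_vector \<Rightarrow>\<^sub>L real) \<Rightarrow> (real \<Rightarrow> 'v) \<Rightarrow> real" where
  "dual_integral T g x = (\<integral>t. g t (x t) \<partial>time_measure T)"

lemma dual_integrable_and_bound:
  assumes g: "g \<in> L2 T" and x: "x \<in> L2 T"
  shows "integrable (time_measure T) (\<lambda>t. blinfun_apply (g t) (x t))"
    and "\<bar>dual_integral T g x\<bar> \<le> L2_norm T g * L2_norm T x"
proof -
  have m: "(\<lambda>t. g t (x t)) \<in> borel_measurable (time_measure T)"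
    using strongly_measurable_blinfun_apply[OF L2_strongly_measurable[OF g] L2_strongly_measurable[OF x]]
    by (simp add: strongly_measurable_iff_borel)
  have le: "\<bar>g t (x t)\<bar> \<le> 1 * norm (g t) * norm (x t)" for t
    using norm_blinfun[of "g t" "x t"] by simp
  show "integrable (time_measure T) (\<lambda>t. g t (x t))"
    by (rule L2_bilinear_bound(1)[OF m g x _ le]) simp
  show "\<bar>dual_integral T g x\<bar> \<le> L2_norm T g * L2_norm T x"
    using L2_bilinear_bound(2)[OF m g x _ le] by (simp add: dual_integral_def)
qed

lemma dual_integral_functional:
  assumes g: "g \<in> L2 T" shows "L2_functional T (dual_integral T g)"
  unfolding L2_functional_def
proof (intro conjI ballI allI exI)
  fix x y :: "real \<Rightarrow> 'a" and c assume x: "x \<in> L2 T" and y: "y \<in> L2 T"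
  show "dual_integral T g (\<lambda>t. x t + y t) = dual_integral T g x + dual_integral T g y"
    using dual_integrable_and_bound[OF g x] dual_integrable_and_bound[OF g y]
    by (simp add: dual_integral_def blinfun.add_right)
qed (use dual_integrable_and_bound[OF g] in \<open>auto simp: dual_integral_def blinfun.scaleR_right\<close>)

lemma dual_integral_diff_left:
  assumes "g \<in> L2 T" "h \<in> L2 T" "x \<in> L2 T"
  shows "dual_integral T (\<lambda>t. g t - h t) x = dual_integral T g x - dual_integral T h x"
  using dual_integrable_and_bound[OF assms(1,3)] dual_integrable_and_bound[OF assms(2,3)]
  by (simp add: dual_integral_def blinfun.diff_left)

text \<open>Replacing \<open>gs n\<close> by \<open>g\<close> costs at most
  \<open>L2_norm T (\<lambda>t. gs n t - g t) * C\<close>. What is left is convergence against the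
  single functional given by \<open>g\<close>, so the lemma serves strongly and weakly convergent
  \<open>xs\<close> alike.\<close>

lemma dual_integral_tendsto:
  assumes g: "\<And>n. gs n \<in> L2 T" "g \<in> L2 T" "L2_tendsto T gs g"
    and x: "\<And>n. xs n \<in> L2 T" "\<And>n. L2_norm T (xs n) \<le> C"
    and lim: "(\<lambda>n. dual_integral T g (xs n)) \<longlonglongrightarrow> l"
  shows "(\<lambda>n. dual_integral T (gs n) (xs n)) \<longlonglongrightarrow> l"
proof -
  have "(\<lambda>n. dual_integral T (gs n) (xs n) - dual_integral T g (xs n)) \<longlonglongrightarrow> 0"
  proof (rule Lim_null_comparison)
    have "norm (dual_integral T (gs n) (xs n) - dual_integral T g (xs n))
        \<le> L2_norm T (\<lambda>t. gs n t - g t) * C" for n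
    proof -
      have "norm (dual_integral T (gs n) (xs n) - dual_integral T g (xs n))
          \<le> L2_norm T (\<lambda>t. gs n t - g t) * L2_norm T (xs n)"
        using dual_integrable_and_bound(2)[OF L2_diff[OF g(1,2)] x(1)]
          dual_integral_diff_left[OF g(1,2) x(1)] by simp
      also have "\<dots> \<le> L2_norm T (\<lambda>t. gs n t - g t) * C"
        by (rule mult_left_mono[OF x(2) L2_norm_nonneg])
      finally show ?thesis .
    qed
    then show "\<forall>\<^sub>F n in sequentially. norm (dual_integral T (gs n) (xs n) - dual_integral T g (xs n))
        \<le> L2_norm T (\<lambda>t. gs n t - g t) * C" by simp
    show "(\<lambda>n. L2_norm T (\<lambda>t. gs n t - g t) * C) \<longlonglongrightarrow> 0"
      using g(3) unfolding L2_tendsto_def by (rule tendsto_mult_left_zero)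
  qed
  from tendsto_add[OF this lim] show ?thesis by simp
qed

text \<open>The part of \<open>coercive_forms\<close> that does not involve coercivity, split off so
  that it also covers the inner product of \<open>H\<close> pulled back to \<open>V\<close>.\<close>

definition bounded_forms :: "real \<Rightarrow> real \<Rightarrow> (real \<Rightarrow> 'v::real_normed_vector \<Rightarrow> 'v \<Rightarrow> real) \<Rightarrow> bool" where
  "bounded_forms T M a \<longleftrightarrow>
     (\<forall>t\<in>{0<..<T}. bilinear (a t)) \<and>
     (\<forall>u v. (\<lambda>t. a t u v) \<in> borel_measurable (time_measure T)) \<and>
     (\<forall>t\<in>{0<..<T}. \<forall>u v. \<bar>a t u v\<bar> \<le> M * norm u * norm v)"

definition form_integral ::
  "real \<Rightarrow> (real \<Rightarrow> 'v::real_normed_vector \<Rightarrow> 'v \<Rightarrow> real) \<Rightarrow> (real \<Rightarrow> 'v) \<Rightarrow> (real \<Rightarrow> 'v) \<Rightarrow> real" where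
  "form_integral T a x y = (\<integral>t. a t (x t) (y t) \<partial>time_measure T)"

lemma bounded_forms_bounded_bilinear:
  assumes "bounded_forms T M a" "t \<in> {0<..<T}" shows "bounded_bilinear (a t)"
proof (rule bounded_bilinear.intro)
  show "\<exists>K. \<forall>x y. norm (a t x y) \<le> norm x * norm y * K"
    using assms by (intro exI[of _ M]) (simp add: bounded_forms_def ac_simps)
qed (use assms in \<open>auto simp: bounded_forms_def bilinear_ladd bilinear_radd bilinear_lmul bilinear_rmul\<close>)

text \<open>The form is of Caratheodory type: measurable in \<open>t\<close>, continuous in its
  vector arguments. Simple functions take finitely many values, so with them only forms at fixed
  vectors occur; continuity then passes to limits.\<close>

lemma bounded_forms_measurable:
  fixes a :: "real \<Rightarrow> 'v::{real_normed_vector, second_countable_topology} \<Rightarrow> 'v \<Rightarrow> real"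
  assumes a: "bounded_forms T M a"
    and x: "x \<in> borel_measurable (time_measure T)" and y: "y \<in> borel_measurable (time_measure T)"
  shows "(\<lambda>t. a t (x t) (y t)) \<in> borel_measurable (time_measure T)"
proof -
  let ?M = "time_measure T"
  obtain s where s: "\<And>i. simple_function ?M (s i)" "\<And>t. t \<in> space ?M \<Longrightarrow> (\<lambda>i. s i t) \<longlonglongrightarrow> x t"
    using borel_measurable_implies_sequence_metric[OF x, of 0] by blast
  obtain r where r: "\<And>i. simple_function ?M (r i)" "\<And>t. t \<in> space ?M \<Longrightarrow> (\<lambda>i. r i t) \<longlonglongrightarrow> y t"
    using borel_measurable_implies_sequence_metric[OF y, of 0] by blast
  have "(\<lambda>t. a t (s i t) (r i t)) \<in> borel_measurable ?M" for i
  proof (rule measurable_compose_countable'[where g="s i" and I="s i ` space ?M" and f="\<lambda>v t. a t v (r i t)"])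
    show "s i \<in> measurable ?M (count_space (s i ` space ?M))"
      using s(1) by (rule measurable_simple_function[THEN measurable_count_space_extend[rotated 2]]) auto
    show "countable (s i ` space ?M)"
      using simple_functionD(1)[OF s(1)] by (rule countable_finite)
    fix v
    show "(\<lambda>t. a t v (r i t)) \<in> borel_measurable ?M"
    proof (rule measurable_compose_countable'[where g="r i" and I="r i ` space ?M" and f="\<lambda>w t. a t v w"])
      show "r i \<in> measurable ?M (count_space (r i ` space ?M))"
        using r(1) by (rule measurable_simple_function[THEN measurable_count_space_extend[rotated 2]]) auto
      show "countable (r i ` space ?M)"
        using simple_functionD(1)[OF r(1)] by (rule countable_finite)
    qed (use a in \<open>auto simp: bounded_forms_def\<close>)
  qed
  then show ?thesis
  proof (rule borel_measurable_LIMSEQ_metric)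
    fix t assume t: "t \<in> space ?M"
    show "(\<lambda>i. a t (s i t) (r i t)) \<longlonglongrightarrow> a t (x t) (y t)"
      using t by (intro bounded_bilinear.tendsto[OF bounded_forms_bounded_bilinear[OF a]] s(2) r(2)) auto
  qed
qed

lemma form_integrable_and_bound:
  fixes a :: "real \<Rightarrow> 'v::{real_normed_vector, second_countable_topology} \<Rightarrow> 'v \<Rightarrow> real"
  assumes a: "bounded_forms T M a" and M: "0 \<le> M" and x: "x \<in> L2 T" and y: "y \<in> L2 T"
  shows "integrable (time_measure T) (\<lambda>t. a t (x t) (y t))"
    and "\<bar>form_integral T a x y\<bar> \<le> M * L2_norm T x * L2_norm T y"
proof -
  have m: "(\<lambda>t. a t (x t) (y t)) \<in> borel_measurable (time_measure T)"
    by (rule bounded_forms_measurable[OF a]) (use x y L2_borel_measurable in auto)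
  have le: "\<bar>a t (x t) (y t)\<bar> \<le> M * norm (x t) * norm (y t)" if "t \<in> {0<..<T}" for t
    using a that by (auto simp: bounded_forms_def)
  show "integrable (time_measure T) (\<lambda>t. a t (x t) (y t))"
    by (rule L2_bilinear_bound(1)[OF m x y M le])
  show "\<bar>form_integral T a x y\<bar> \<le> M * L2_norm T x * L2_norm T y"
    using L2_bilinear_bound(2)[OF m x y M le] by (simp add: form_integral_def)
qed

lemma bounded_forms_flip: "bounded_forms T M a \<Longrightarrow> bounded_forms T M (\<lambda>t u v. a t v u)"
  unfolding bounded_forms_def bilinear_def by (metis mult.assoc mult.commute)

lemma form_integral_functional_right:
  fixes a :: "real \<Rightarrow> 'v::{real_normed_vector, second_countable_topology} \<Rightarrow> 'v \<Rightarrow> real"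
  assumes a: "bounded_forms T M a" and M: "0 \<le> M" and x: "x \<in> L2 T"
  shows "L2_functional T (form_integral T a x)"
  unfolding L2_functional_def
proof (intro conjI ballI allI exI)
  fix y z :: "real \<Rightarrow> 'v" and c assume y: "y \<in> L2 T" and z: "z \<in> L2 T"
  have "form_integral T a x (\<lambda>t. y t + z t) = (\<integral>t. a t (x t) (y t) + a t (x t) (z t) \<partial>time_measure T)"
    unfolding form_integral_def using a
    by (intro Bochner_Integration.integral_cong) (auto simp: bounded_forms_def bilinear_radd)
  then show "form_integral T a x (\<lambda>t. y t + z t) = form_integral T a x y + form_integral T a x z"
    using form_integrable_and_bound(1)[OF a M x y] form_integrable_and_bound(1)[OF a M x z]
    by (simp add: form_integral_def)
next
  fix c and y :: "real \<Rightarrow> 'v" assume y: "y \<in> L2 T"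
  have "form_integral T a x (\<lambda>t. c *\<^sub>R y t) = (\<integral>t. c * a t (x t) (y t) \<partial>time_measure T)"
    unfolding form_integral_def using a
    by (intro Bochner_Integration.integral_cong) (auto simp: bounded_forms_def bilinear_rmul)
  then show "form_integral T a x (\<lambda>t. c *\<^sub>R y t) = c * form_integral T a x y"
    by (simp add: form_integral_def)
qed (use form_integrable_and_bound(2)[OF a M x] in auto)

lemma form_integral_functional_left:
  fixes a :: "real \<Rightarrow> 'v::{real_normed_vector, second_countable_topology} \<Rightarrow> 'v \<Rightarrow> real"
  assumes "bounded_forms T M a" "0 \<le> M" "y \<in> L2 T"
  shows "L2_functional T (\<lambda>x. form_integral T a x y)"
  using form_integral_functional_right[OF bounded_forms_flip[OF assms(1)] assms(2,3)]
  unfolding form_integral_def .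

text \<open>A strongly convergent first argument against a bounded second one, as in
  \<open>dual_integral_tendsto\<close>. When the roles are exchanged,
  \<open>bounded_forms_flip\<close> brings them into this order.\<close>

lemma form_integral_tendsto:
  fixes a :: "real \<Rightarrow> 'v::{real_normed_vector, second_countable_topology} \<Rightarrow> 'v \<Rightarrow> real"
  assumes a: "bounded_forms T M a" "0 \<le> M"
    and x: "\<And>n. xs n \<in> L2 T" "x \<in> L2 T" "L2_tendsto T xs x"
    and y: "\<And>n. ys n \<in> L2 T" "\<And>n. L2_norm T (ys n) \<le> C"
    and lim: "(\<lambda>n. form_integral T a x (ys n)) \<longlonglongrightarrow> l"
  shows "(\<lambda>n. form_integral T a (xs n) (ys n)) \<longlonglongrightarrow> l"
proof -
  have "(\<lambda>n. form_integral T a (xs n) (ys n) - form_integral T a x (ys n)) \<longlonglongrightarrow> 0"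
  proof (rule Lim_null_comparison)
    have "norm (form_integral T a (xs n) (ys n) - form_integral T a x (ys n))
        \<le> M * L2_norm T (\<lambda>t. xs n t - x t) * C" for n
    proof -
      have "norm (form_integral T a (xs n) (ys n) - form_integral T a x (ys n))
          \<le> M * L2_norm T (\<lambda>t. xs n t - x t) * L2_norm T (ys n)"
        using form_integrable_and_bound(2)[OF a L2_diff[OF x(1,2)] y(1)]
          L2_functional_diff[OF form_integral_functional_left[OF a y(1)] x(1,2)] by simp
      also have "\<dots> \<le> M * L2_norm T (\<lambda>t. xs n t - x t) * C"
        using a(2) by (intro mult_left_mono[OF y(2)] mult_nonneg_nonneg L2_norm_nonneg)
      finally show ?thesis .
    qed
    then show "\<forall>\<^sub>F n in sequentially. norm (form_integral T a (xs n) (ys n) - form_integral T a x (ys n))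
        \<le> M * L2_norm T (\<lambda>t. xs n t - x t) * C" by simp
    show "(\<lambda>n. M * L2_norm T (\<lambda>t. xs n t - x t) * C) \<longlonglongrightarrow> 0"
      using x(3) unfolding L2_tendsto_def by (intro tendsto_mult_left_zero tendsto_mult_right_zero)
  qed
  from tendsto_add[OF this lim] show ?thesis by simp
qed

lemma L2_tendsto_norm_bounded:
  assumes "\<And>n. xs n \<in> L2 T" "x \<in> L2 T" "L2_tendsto T xs x"
  obtains C where "\<And>n. L2_norm T (xs n) \<le> C"
proof -
  obtain B where B: "\<And>n. L2_norm T (\<lambda>t. xs n t - x t) \<le> B"
    using BseqE[OF convergent_imp_Bseq[OF convergentI[OF assms(3)[unfolded L2_tendsto_def]]]]
    by (metis abs_le_D1 real_norm_def)
  have "L2_norm T (xs n) \<le> B + L2_norm T x" for n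
    using L2_norm_triangle[OF L2_diff[OF assms(1,2)] assms(2), of n] B[of n] by simp
  then show ?thesis by (rule that)
qed

subsection \<open>Completeness and weak sequential compactness\<close>

text \<open>Fatou's lemma for the squared norms: the \<open>L2\<close> norm is lower semicontinuous
  along sequences that converge almost everywhere.\<close>

lemma L2_Fatou:
  fixes y :: "nat \<Rightarrow> real \<Rightarrow> 'b::{real_normed_vector, second_countable_topology}"
  assumes y: "\<And>k. y k \<in> L2 T" and lim: "AE t in time_measure T. (\<lambda>k. y k t) \<longlonglongrightarrow> z t"
    and le: "\<And>k. L2_norm T (y k) \<le> e"
  shows "z \<in> L2 T" "L2_norm T z \<le> e"
proof -
  let ?M = "time_measure T"
  have e: "0 \<le> e" using le[of 0] L2_norm_nonneg order_trans by blast
  have z[measurable]: "z \<in> borel_measurable ?M"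
    by (rule time.borel_measurable_AE_LIMSEQ[OF L2_borel_measurable[OF y] lim])
  have ym[measurable]: "y k \<in> borel_measurable ?M" for k
    by (rule L2_borel_measurable[OF y])
  have "(\<integral>\<^sup>+t. ennreal ((norm (z t))\<^sup>2) \<partial>?M) = (\<integral>\<^sup>+t. liminf (\<lambda>k. ennreal ((norm (y k t))\<^sup>2)) \<partial>?M)"
  proof (rule nn_integral_cong_AE)
    show "AE t in ?M. ennreal ((norm (z t))\<^sup>2) = liminf (\<lambda>k. ennreal ((norm (y k t))\<^sup>2))"
      using lim
    proof eventually_elim
      case (elim t)
      then have "(\<lambda>k. ennreal ((norm (y k t))\<^sup>2)) \<longlonglongrightarrow> ennreal ((norm (z t))\<^sup>2)"
        by (intro tendsto_intros)
      then show ?case using lim_imp_Liminf[of sequentially] by (metis sequentially_bot)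
    qed
  qed
  also have "\<dots> \<le> liminf (\<lambda>k. \<integral>\<^sup>+t. ennreal ((norm (y k t))\<^sup>2) \<partial>?M)"
    by (rule nn_integral_liminf) measurable
  also have "\<dots> \<le> ennreal (e\<^sup>2)"
  proof (rule Liminf_le)
    have "(\<integral>\<^sup>+t. ennreal ((norm (y k t))\<^sup>2) \<partial>?M) \<le> ennreal (e\<^sup>2)" for k
    proof -
      have "(\<integral>\<^sup>+t. ennreal ((norm (y k t))\<^sup>2) \<partial>?M) = ennreal ((L2_norm T (y k))\<^sup>2)"
        unfolding L2_norm_power2 by (rule nn_integral_eq_integral[OF L2_integrable_norm2[OF y]]) simp
      then show ?thesis
        using power_mono[OF le[of k] L2_norm_nonneg, of 2] by (simp add: ennreal_leI)
    qed
    then show "\<forall>\<^sub>F k in sequentially. (\<integral>\<^sup>+t. ennreal ((norm (y k t))\<^sup>2) \<partial>?M) \<le> ennreal (e\<^sup>2)"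
      by simp
  qed simp
  finally have *: "(\<integral>\<^sup>+t. ennreal ((norm (z t))\<^sup>2) \<partial>?M) \<le> ennreal (e\<^sup>2)" .
  then have int: "integrable ?M (\<lambda>t. (norm (z t))\<^sup>2)"
    by (intro integrableI_bounded) (auto intro: le_less_trans)
  with z show zL: "z \<in> L2 T"
    by (simp add: L2_def strongly_measurable_iff_borel)
  have "ennreal ((L2_norm T z)\<^sup>2) \<le> ennreal (e\<^sup>2)"
    unfolding L2_norm_power2 using * nn_integral_eq_integral[OF int] by simp
  then have "(L2_norm T z)\<^sup>2 \<le> e\<^sup>2" by simp
  then show "L2_norm T z \<le> e" using e by (rule power2_le_imp_le)
qed

text \<open>The Riesz-Fischer argument: a rapidly Cauchy subsequence converges absolutely almost
  everywhere, and Fatou's lemma returns from pointwise to \<open>L2\<close> convergence.\<close>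

lemma L2_complete:
  fixes x :: "nat \<Rightarrow> real \<Rightarrow> 'b::{banach, second_countable_topology}"
  assumes x: "\<And>k. x k \<in> L2 T"
    and Cauchy: "\<And>e. 0 < e \<Longrightarrow> \<exists>N. \<forall>m\<ge>N. \<forall>n\<ge>N. L2_norm T (\<lambda>t. x m t - x n t) < e"
  obtains z where "z \<in> L2 T" "L2_tendsto T x z"
proof -
  let ?M = "time_measure T"
  have "\<exists>N. \<forall>k. (\<forall>m\<ge>N k. \<forall>n\<ge>N k. L2_norm T (\<lambda>t. x m t - x n t) < (1/2) ^ k) \<and> N k < N (Suc k)"
  proof (rule dependent_nat_choice)
    show "\<exists>N. \<forall>m\<ge>N. \<forall>n\<ge>N. L2_norm T (\<lambda>t. x m t - x n t) < (1/2) ^ 0"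
      by (rule Cauchy) simp
    fix N k
    obtain N' where N': "\<forall>m\<ge>N'. \<forall>n\<ge>N'. L2_norm T (\<lambda>t. x m t - x n t) < (1/2) ^ Suc k"
      using Cauchy[of "(1/2) ^ Suc k"] by auto
    show "\<exists>N'. (\<forall>m\<ge>N'. \<forall>n\<ge>N'. L2_norm T (\<lambda>t. x m t - x n t) < (1/2) ^ Suc k) \<and> N < N'"
      by (rule exI[of _ "max N' (Suc N)"]) (use N' in auto)
  qed
  then obtain r where r: "\<And>k m n. m \<ge> r k \<Longrightarrow> n \<ge> r k \<Longrightarrow> L2_norm T (\<lambda>t. x m t - x n t) < (1/2) ^ k"
    and mono: "\<And>k. r k < r (Suc k)" by metis
  define d where "d k t = x (r (Suc k)) t - x (r k) t" for k t
  have d: "d k \<in> L2 T" for k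
    unfolding d_def by (intro L2_diff x)
  have dn: "L2_norm T (d k) \<le> (1/2) ^ k" for k
    unfolding d_def using r[of k "r (Suc k)" "r k"] mono[of k] by simp
  have [measurable]: "d k \<in> borel_measurable ?M" for k
    by (rule L2_borel_measurable[OF d])
  have int: "integrable ?M (\<lambda>t. norm (d k t))" for k
    using L2_integrable[OF d] by simp
  have "(\<integral>\<^sup>+t. (\<Sum>k. ennreal (norm (d k t))) \<partial>?M) = (\<Sum>k. \<integral>\<^sup>+t. ennreal (norm (d k t)) \<partial>?M)"
    by (rule nn_integral_suminf) measurable
  \<comment> \<open>On an interval of finite length the \<open>L1\<close> norm is at most the
    \<open>L2\<close> norm times \<open>L2_norm T (\<lambda>t. 1)\<close>, so the geometric bounds
    sum up.\<close>
  also have "\<dots> \<le> (\<Sum>k. ennreal (L2_norm T (\<lambda>t. 1::real) * (1/2) ^ k))"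
  proof (intro suminf_le)
    fix k
    have "(\<integral>t. 1 * norm (d k t) \<partial>?M) \<le> L2_norm T (\<lambda>t. 1::real) * L2_norm T (d k)"
      using L2_Cauchy_Schwarz[OF L2_const[of "1::real"] L2_realI[OF d]] by (simp add: L2_norm_norm)
    also have "\<dots> \<le> L2_norm T (\<lambda>t. 1::real) * (1/2) ^ k"
      by (intro mult_left_mono dn L2_norm_nonneg)
    finally show "(\<integral>\<^sup>+t. ennreal (norm (d k t)) \<partial>?M) \<le> ennreal (L2_norm T (\<lambda>t. 1::real) * (1/2) ^ k)"
      using nn_integral_eq_integral[OF int[of k]] by (simp add: ennreal_leI)
  qed auto
  also have "\<dots> < \<infinity>"
  proof -
    have "summable (\<lambda>k. L2_norm T (\<lambda>t. 1::real) * (1/2) ^ k)"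
      by (intro summable_mult summable_geometric) simp
    then show ?thesis
      by (subst suminf_ennreal2) (auto intro!: mult_nonneg_nonneg L2_norm_nonneg)
  qed
  finally have "AE t in ?M. (\<Sum>k. ennreal (norm (d k t))) \<noteq> \<infinity>"
    by (intro nn_integral_PInf_AE) auto
  then have lim: "AE t in ?M. (\<lambda>k. x (r k) t) \<longlonglongrightarrow> lim (\<lambda>k. x (r k) t)"
  proof eventually_elim
    case (elim t)
    then have "summable (\<lambda>k. norm (d k t))"
      by (intro summable_suminf_not_top) auto
    then have "summable (\<lambda>k. d k t)" by (rule summable_norm_cancel)
    then obtain s where "(\<lambda>k. (\<Sum>i<k. d i t)) \<longlonglongrightarrow> s"
      unfolding summable_def sums_def by auto
    moreover have "(\<Sum>i<k. d i t) = x (r k) t - x (r 0) t" for k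
      unfolding d_def by (rule sum_lessThan_telescope)
    ultimately have "(\<lambda>k. x (r k) t - x (r 0) t + x (r 0) t) \<longlonglongrightarrow> s + x (r 0) t"
      by (intro tendsto_add tendsto_const) simp
    then show ?case by (simp add: convergentI convergent_LIMSEQ_iff[symmetric])
  qed
  \<comment> \<open>On the null set without convergence \<open>lim\<close> is an arbitrary
    value.\<close>
  define z where "z t = lim (\<lambda>k. x (r k) t)" for t
  have "strict_mono r"
    unfolding strict_mono_Suc_iff using mono by blast
  \<comment> \<open>Fatou's lemma is applied to \<open>x n - x (r (m + k))\<close> as
    \<open>k\<close> grows. This also gives membership of \<open>z\<close> in \<open>L2\<close>,
    through the difference \<open>x (r 0) - z\<close>.\<close>
  have F: "(\<lambda>t. x n t - z t) \<in> L2 T \<and> L2_norm T (\<lambda>t. x n t - z t) \<le> (1/2) ^ m" if n: "n \<ge> r m" for n m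
  proof -
    have y: "(\<lambda>t. x n t - x (r (m + k)) t) \<in> L2 T" for k by (intro L2_diff x)
    have A: "AE t in ?M. (\<lambda>k. x n t - x (r (m + k)) t) \<longlonglongrightarrow> x n t - z t"
      using lim
    proof eventually_elim
      case (elim t)
      have "(\<lambda>k. x (r (k + m)) t) \<longlonglongrightarrow> z t"
        unfolding z_def by (rule LIMSEQ_ignore_initial_segment[OF elim])
      then show ?case by (intro tendsto_diff tendsto_const) (simp add: add.commute)
    qed
    have B: "L2_norm T (\<lambda>t. x n t - x (r (m + k)) t) \<le> (1/2) ^ m" for k
    proof -
      have "r m \<le> r (m + k)"
        using \<open>strict_mono r\<close> by (simp add: strict_mono_less_eq)
      then show ?thesis using r[of m n "r (m + k)"] n by simp
    qed
    show ?thesis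
      using L2_Fatou[OF y A B] by simp
  qed
  have "(\<lambda>t. x (r 0) t - (x (r 0) t - z t)) \<in> L2 T"
    by (rule L2_diff[OF x]) (use F[of 0 "r 0"] in simp)
  then have "z \<in> L2 T" by simp
  moreover have "L2_tendsto T x z"
    unfolding L2_tendsto_def
  proof (rule LIMSEQ_I)
    fix e :: real assume "0 < e"
    then obtain m where "(1/2) ^ m < e"
      using real_arch_pow_inv[of e "1/2"] by auto
    then have "norm (L2_norm T (\<lambda>t. x n t - z t) - 0) < e" if "n \<ge> r m" for n
      using F[OF that] L2_norm_nonneg[of T "\<lambda>t. x n t - z t"] by simp
    then show "\<exists>N. \<forall>n\<ge>N. norm (L2_norm T (\<lambda>t. x n t - z t) - 0) < e" by blast
  qed
  ultimately show ?thesis by (rule that)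
qed

section \<open>Energy minimization over tail hulls\<close>

lemma coercive_forms_bounded: "coercive_forms T M \<alpha> a \<Longrightarrow> bounded_forms T M a"
  by (simp add: coercive_forms_def bounded_forms_def)

lemma coercive_forms_norm_le:
  fixes a :: "real \<Rightarrow> 'v::{real_normed_vector, second_countable_topology} \<Rightarrow> 'v \<Rightarrow> real"
  assumes a: "coercive_forms T M \<alpha> a" "0 \<le> M" and x: "x \<in> L2 T"
  shows "\<alpha> * (L2_norm T x)\<^sup>2 \<le> form_integral T a x x"
proof -
  have "(\<integral>t. \<alpha> * (norm (x t))\<^sup>2 \<partial>time_measure T) \<le> (\<integral>t. a t (x t) (x t) \<partial>time_measure T)"
  proof (rule integral_mono)
    show "integrable (time_measure T) (\<lambda>t. \<alpha> * (norm (x t))\<^sup>2)"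
      using L2_integrable_norm2[OF x] by simp
    show "integrable (time_measure T) (\<lambda>t. a t (x t) (x t))"
      by (rule form_integrable_and_bound(1)[OF coercive_forms_bounded[OF a(1)] a(2) x x])
    show "\<alpha> * (norm (x t))\<^sup>2 \<le> a t (x t) (x t)" if "t \<in> space (time_measure T)" for t
      using a(1) that by (simp add: coercive_forms_def)
  qed
  then show ?thesis by (simp add: L2_norm_power2 form_integral_def)
qed

text \<open>Dyadic convex combinations. Generating them by midpoints gives induction in place of
  bookkeeping of weights and matches the parallelogram identity, which compares two points with
  their midpoint.\<close>

inductive_set midpoint_hull :: "(real \<Rightarrow> 'v::real_vector) set \<Rightarrow> (real \<Rightarrow> 'v) set"
  for X :: "(real \<Rightarrow> 'v) set" where
  base: "x \<in> X \<Longrightarrow> x \<in> midpoint_hull X"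
| mid: "x \<in> midpoint_hull X \<Longrightarrow> y \<in> midpoint_hull X \<Longrightarrow>
    (\<lambda>t. (1/2) *\<^sub>R (x t + y t)) \<in> midpoint_hull X"

lemma midpoint_hull_mono: "X \<subseteq> Y \<Longrightarrow> midpoint_hull X \<subseteq> midpoint_hull Y"
proof
  fix x assume "X \<subseteq> Y" and "x \<in> midpoint_hull X"
  from this(2,1) show "x \<in> midpoint_hull Y"
    by (induction rule: midpoint_hull.induct) (auto intro: midpoint_hull.intros)
qed

lemma midpoint_hull_L2: "x \<in> midpoint_hull X \<Longrightarrow> X \<subseteq> L2 T \<Longrightarrow> x \<in> L2 T"
  by (induction rule: midpoint_hull.induct) (auto intro: L2_scaleR L2_add)

lemma midpoint_hull_functional:
  assumes G: "L2_functional T G" and x: "x \<in> midpoint_hull X" and X: "X \<subseteq> L2 T"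
    and le: "\<And>y. y \<in> X \<Longrightarrow> \<bar>G y - c\<bar> \<le> e"
  shows "\<bar>G x - c\<bar> \<le> e"
  using x
proof (induction rule: midpoint_hull.induct)
  case (mid x y)
  have "G (\<lambda>t. (1/2) *\<^sub>R (x t + y t)) = 1/2 * G (\<lambda>t. x t + y t)"
    by (rule L2_functional_scaleR[OF G]) (intro L2_add midpoint_hull_L2[OF _ X] mid)
  also have "G (\<lambda>t. x t + y t) = G x + G y"
    by (rule L2_functional_add[OF G]) (intro midpoint_hull_L2[OF _ X] mid)+
  finally have eq: "G (\<lambda>t. (1/2) *\<^sub>R (x t + y t)) = 1/2 * (G x + G y)" .
  show ?case unfolding eq using mid.IH by (auto simp: abs_le_iff field_simps)
qed (use le in auto)

text \<open>If \<open>G\<close> stays within \<open>e / 2\<close> of \<open>c\<close> on a tail of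
  \<open>z\<close>, it does so on the midpoint hull of that tail, as intervals contain their
  midpoints. Strong limits of points from ever later hulls therefore see the limit of
  \<open>G\<close> along the sequence.\<close>

lemma midpoint_hull_limit:
  assumes G: "L2_functional T G" and z: "\<And>i. z i \<in> L2 T" and lim: "(\<lambda>i. G (z i)) \<longlonglongrightarrow> c"
    and y: "\<And>k. y k \<in> midpoint_hull (z ` {k..})" and w: "w \<in> L2 T" "L2_tendsto T y w"
  shows "G w = c"
proof (rule LIMSEQ_unique)
  have yL: "y k \<in> L2 T" for k
    by (rule midpoint_hull_L2[OF y]) (use z in auto)
  show "(\<lambda>k. G (y k)) \<longlonglongrightarrow> G w"
    by (rule L2_functional_tendsto[OF G yL w])
  show "(\<lambda>k. G (y k)) \<longlonglongrightarrow> c"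
  proof (rule LIMSEQ_I)
    fix e :: real assume "0 < e"
    then obtain N where N: "\<And>i. i \<ge> N \<Longrightarrow> \<bar>G (z i) - c\<bar> < e / 2"
      using LIMSEQ_D[OF lim, of "e / 2"] by auto
    have "\<bar>G (y k) - c\<bar> \<le> e / 2" if "k \<ge> N" for k
      by (rule midpoint_hull_functional[OF G y]) (use z N that in \<open>auto intro: less_imp_le\<close>)
    then show "\<exists>N. \<forall>k\<ge>N. norm (G (y k) - c) < e"
      using \<open>0 < e\<close> by (intro exI[of _ N]) fastforce
  qed
qed

text \<open>The mixed terms for \<open>x + y\<close> and \<open>x - y\<close> cancel, also for a
  nonsymmetric form; the factor 4 undoes the scaling by \<open>1/2\<close> in a quadratic
  expression.\<close>

lemma form_integral_parallelogram:
  fixes a :: "real \<Rightarrow> 'v::{real_normed_vector, second_countable_topology} \<Rightarrow> 'v \<Rightarrow> real"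
  assumes a: "bounded_forms T M a" "0 \<le> M" and x: "x \<in> L2 T" and y: "y \<in> L2 T"
  defines "Q \<equiv> \<lambda>z. form_integral T a z z"
  shows "Q (\<lambda>t. x t - y t) = 2 * Q x + 2 * Q y - 4 * Q (\<lambda>t. (1/2) *\<^sub>R (x t + y t))"
proof -
  note R = form_integral_functional_right[OF a] and L = form_integral_functional_left[OF a]
  note xy = L2_add[OF x y]
  have s: "Q (\<lambda>t. (1/2) *\<^sub>R (x t + y t)) = 1/4 * Q (\<lambda>t. x t + y t)"
    unfolding Q_def L2_functional_scaleR[OF R[OF L2_scaleR[OF xy]] xy] L2_functional_scaleR[OF L[OF xy] xy]
    by simp
  show ?thesis
    unfolding s unfolding Q_def
      L2_functional_diff[OF R[OF L2_diff[OF x y]] x y]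
      L2_functional_diff[OF L[OF x] x y] L2_functional_diff[OF L[OF y] x y]
      L2_functional_add[OF R[OF xy] x y]
      L2_functional_add[OF L[OF x] x y] L2_functional_add[OF L[OF y] x y]
    by (simp add: field_simps)
qed

text \<open>
  The integrated form makes \<open>L2\<close> a Hilbert space up to equivalence of norms, so elements of
  almost minimal energy in the tail hulls form a Cauchy sequence.
\<close>

lemma midpoint_hull_convergent:
  fixes a :: "real \<Rightarrow> 'v::{banach, second_countable_topology} \<Rightarrow> 'v \<Rightarrow> real" and x :: "nat \<Rightarrow> real \<Rightarrow> 'v"
  assumes a: "coercive_forms T M \<alpha> a" "0 \<le> M" "0 < \<alpha>"
    and x: "\<And>n. x n \<in> L2 T" "\<And>n. L2_norm T (x n) \<le> C"
  obtains y w where "\<And>k. y k \<in> midpoint_hull (x ` {k..})" "w \<in> L2 T" "L2_tendsto T y w"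
proof -
  define Q where "Q z = form_integral T a z z" for z
  define h where "h k = midpoint_hull (x ` {k..})" for k :: nat
  define I where "I k = Inf (Q ` h k)" for k
  note ab = coercive_forms_bounded[OF a(1)] a(2)
  have hL: "z \<in> L2 T" if "z \<in> h k" for z k
    using that x(1) midpoint_hull_L2 unfolding h_def by blast
  have low: "\<alpha> * (L2_norm T z)\<^sup>2 \<le> Q z" if "z \<in> L2 T" for z
    unfolding Q_def by (rule coercive_forms_norm_le[OF a(1,2) that])
  have Q0: "0 \<le> Q z" if "z \<in> L2 T" for z
    using low[OF that] a(3) by (meson order_trans mult_nonneg_nonneg less_imp_le zero_le_power2)
  have xh: "x n \<in> h k" if "k \<le> n" for k n
    unfolding h_def using that by (intro midpoint_hull.base) auto
  have bdd: "bdd_below (Q ` h k)" for k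
    using Q0 hL by (intro bdd_belowI2[of _ 0]) auto
  have I_le: "I k \<le> Q z" if "z \<in> h k" for k z
    unfolding I_def by (rule cInf_lower[OF _ bdd]) (use that in auto)
  have Qx: "Q (x n) \<le> M * C * C" for n
  proof -
    have "Q (x n) \<le> M * L2_norm T (x n) * L2_norm T (x n)"
      unfolding Q_def using form_integrable_and_bound(2)[OF ab x(1) x(1)] by (rule order_trans[OF abs_ge_self])
    also have "\<dots> \<le> M * C * C"
    proof (intro mult_mono x(2) L2_norm_nonneg)
      show "0 \<le> M * C" using a(2) order_trans[OF L2_norm_nonneg x(2)] by simp
    qed (use a(2) in auto)
    finally show ?thesis .
  qed
  have h_anti: "h l \<subseteq> h k" if "k \<le> l" for k l
    unfolding h_def using that by (intro midpoint_hull_mono) auto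
  \<comment> \<open>The tail hulls shrink, so the minimal energies increase; the energy bound on the
    sequence keeps them bounded and thus convergent.\<close>
  have "incseq I"
  proof (rule incseq_SucI)
    fix n
    have "Q ` h (Suc n) \<noteq> {}" "Q ` h (Suc n) \<subseteq> Q ` h n"
      using xh[of "Suc n" "Suc n"] h_anti[of n "Suc n"] by auto
    then show "I n \<le> I (Suc n)"
      unfolding I_def by (intro cInf_superset_mono bdd)
  qed
  moreover have "I k \<le> M * C * C" for k
    using I_le[OF xh[OF order_refl]] Qx by (rule order_trans)
  ultimately obtain L where L: "I \<longlonglongrightarrow> L" "\<And>k. I k \<le> L"
    using incseq_convergent[of I "M * C * C"] by blast
  have "\<exists>y\<in>h k. Q y < I k + 1 / Suc k" for k
  proof -
    have "Q ` h k \<noteq> {}" using xh[of k k] by auto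
    moreover have "Inf (Q ` h k) < I k + 1 / Suc k" by (simp add: I_def)
    ultimately have "\<exists>q\<in>Q ` h k. q < I k + 1 / Suc k" by (rule cInf_lessD)
    then show ?thesis by blast
  qed
  then obtain y where y: "\<And>k. y k \<in> h k" "\<And>k. Q (y k) < I k + 1 / Suc k" by metis
  have yL: "y k \<in> L2 T" for k using hL y(1) by blast
  \<comment> \<open>The midpoint stays in the hull \<open>h k\<close>, so its energy is at least
    \<open>I k\<close>. The parallelogram identity then bounds the left side by
    \<open>2 (I k + 1 / Suc k) + 2 (I l + 1 / Suc l) - 4 I k\<close>, where
    \<open>I l \<le> L\<close>.\<close>
  have est: "\<alpha> * (L2_norm T (\<lambda>t. y k t - y l t))\<^sup>2 \<le> 2 * (L - I k) + 4 / Suc k" if "k \<le> l" for k l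
  proof -
    have "y l \<in> h k" using h_anti[OF that] y(1) by blast
    then have "(\<lambda>t. (1/2) *\<^sub>R (y k t + y l t)) \<in> h k"
      unfolding h_def using y(1)[of k, unfolded h_def] by (intro midpoint_hull.mid)
    then have "I k \<le> Q (\<lambda>t. (1/2) *\<^sub>R (y k t + y l t))" by (rule I_le)
    moreover have "\<alpha> * (L2_norm T (\<lambda>t. y k t - y l t))\<^sup>2
        \<le> 2 * Q (y k) + 2 * Q (y l) - 4 * Q (\<lambda>t. (1/2) *\<^sub>R (y k t + y l t))"
      using low[OF L2_diff[OF yL yL]] form_integral_parallelogram[OF ab yL yL] unfolding Q_def by metis
    moreover have "1 / Suc l \<le> 1 / Suc k" using that by (simp add: field_simps)
    moreover have "4 / real (Suc k) = 4 * (1 / real (Suc k))" by simp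
    ultimately show ?thesis using y(2)[of k] y(2)[of l] L(2)[of l] by argo
  qed
  have lim: "(\<lambda>k. 2 * (L - I k) + 4 / Suc k) \<longlonglongrightarrow> 2 * (L - L) + 0"
    by (intro tendsto_intros L lim_const_over_n[THEN LIMSEQ_Suc])
  have Cau: "\<exists>N. \<forall>m\<ge>N. \<forall>n\<ge>N. L2_norm T (\<lambda>t. y m t - y n t) < e" if e: "0 < e" for e
  proof -
    have "0 < \<alpha> * e\<^sup>2" using e a(3) by simp
    then obtain N where N: "\<And>k. k \<ge> N \<Longrightarrow> 2 * (L - I k) + 4 / Suc k < \<alpha> * e\<^sup>2"
      using order_tendstoD(2)[OF lim] by (auto simp: eventually_sequentially)
    have *: "L2_norm T (\<lambda>t. y m t - y n t) < e" if "N \<le> m" "m \<le> n" for m n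
    proof -
      have "\<alpha> * (L2_norm T (\<lambda>t. y m t - y n t))\<^sup>2 < \<alpha> * e\<^sup>2"
        using est[OF that(2)] N[OF that(1)] by linarith
      then have "(L2_norm T (\<lambda>t. y m t - y n t))\<^sup>2 < e\<^sup>2" using a(3) by simp
      then show ?thesis using e by (meson less_imp_le power_less_imp_less_base)
    qed
    have "L2_norm T (\<lambda>t. y m t - y n t) < e" if "N \<le> m" "N \<le> n" for m n
      using *[of m n] *[of n m] that L2_norm_minus_commute[of T "y m" "y n"] by (cases "m \<le> n") auto
    then show ?thesis by blast
  qed
  obtain w where "w \<in> L2 T" "L2_tendsto T y w"
    using L2_complete[OF yL Cau] by blast
  with y(1) show ?thesis using that unfolding h_def by blast
qed

lemma not_LIMSEQ_subseq:
  fixes X :: "nat \<Rightarrow> real"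
  assumes "\<not> X \<longlonglongrightarrow> L"
  obtains e r where "0 < e" "strict_mono (r :: nat \<Rightarrow> nat)" "\<And>n. e \<le> \<bar>X (r n) - L\<bar>"
proof -
  obtain e where e: "0 < e" "\<And>N. \<exists>n\<ge>N. e \<le> \<bar>X n - L\<bar>"
    using assms unfolding LIMSEQ_iff by (auto simp: not_less)
  then have "infinite {n. e \<le> \<bar>X n - L\<bar>}"
    unfolding infinite_nat_iff_unbounded_le by auto
  from infinite_enumerate[OF this] obtain r :: "nat \<Rightarrow> nat"
    where "strict_mono r" "\<And>n. r n \<in> {n. e \<le> \<bar>X n - L\<bar>}" by blast
  with e(1) show ?thesis using that by auto
qed

text \<open>A strong limit \<open>w\<close> of points in the tail hulls is the candidate. If
  \<open>G\<close> does not converge to \<open>G w\<close>, a further subsequence has a limit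
  \<open>l\<close> different from \<open>G w\<close> and its own hull limit \<open>w'\<close> with
  \<open>G w' = l\<close>. The diagonal selection has fixed the limits of the form at each
  \<open>x m\<close>, so the form takes equal values at \<open>(x m, w)\<close> and
  \<open>(x m, w')\<close> for all \<open>m\<close>; hence it vanishes on \<open>w - w'\<close>, and
  coercivity gives \<open>G w = G w'\<close>.\<close>

lemma L2_bounded_weakly_convergent_subseq:
  fixes a :: "real \<Rightarrow> 'v::{banach, second_countable_topology} \<Rightarrow> 'v \<Rightarrow> real" and x :: "nat \<Rightarrow> real \<Rightarrow> 'v"
  assumes a: "coercive_forms T M \<alpha> a" "0 \<le> M" "0 < \<alpha>"
    and x: "\<And>n. x n \<in> L2 T" "\<And>n. L2_norm T (x n) \<le> C"
  obtains r w where "strict_mono (r :: nat \<Rightarrow> nat)" "w \<in> L2 T"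
    "L2_weakly_tendsto T (\<lambda>n. x (r n)) w"
proof -
  let ?B = "form_integral T a"
  note ab = coercive_forms_bounded[OF a(1)] a(2)
  have C: "0 \<le> C" using order_trans[OF L2_norm_nonneg x(2)] .
  have bd: "norm (?B (x m) (x n)) \<le> M * C * C" for m n
  proof -
    have "norm (?B (x m) (x n)) \<le> M * L2_norm T (x m) * L2_norm T (x n)"
      using form_integrable_and_bound(2)[OF ab x(1) x(1)] by simp
    also have "\<dots> \<le> M * C * C"
      using a(2) C by (intro mult_mono x(2) L2_norm_nonneg mult_nonneg_nonneg) auto
    finally show ?thesis .
  qed
  \<comment> \<open>Diagonal argument over the countably many first arguments
    \<open>x m\<close>.\<close>
  obtain r where r: "strict_mono (r :: nat \<Rightarrow> nat)"
    and rc: "\<And>m. m \<in> UNIV \<Longrightarrow> \<exists>c. (\<lambda>n. ?B (x m) (x (r n))) \<longlonglongrightarrow> c"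
    by (rule function_convergent_subsequence[OF countableI_type[of UNIV],
          of "\<lambda>n m. ?B (x m) (x n)" "M * C * C", OF bd]) (rule that)
  obtain c where c: "\<And>m. (\<lambda>n. ?B (x m) (x (r n))) \<longlonglongrightarrow> c m"
    using rc by (metis UNIV_I)
  define z where "z n = x (r n)" for n
  have z: "z n \<in> L2 T" "L2_norm T (z n) \<le> C" for n by (simp_all add: z_def x)
  obtain y w where y: "\<And>k. y k \<in> midpoint_hull (z ` {k..})" and w: "w \<in> L2 T" "L2_tendsto T y w"
    by (rule midpoint_hull_convergent[OF a z]) (rule that)
  have Bw: "?B (x m) w = c m" for m
    by (rule midpoint_hull_limit[OF form_integral_functional_right[OF ab x(1)] z(1) _ y w])
      (simp add: z_def c)
  have "(\<lambda>n. G (z n)) \<longlonglongrightarrow> G w" if G: "L2_functional T G" for G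
  proof (rule ccontr)
    assume "\<not> (\<lambda>n. G (z n)) \<longlonglongrightarrow> G w"
    then obtain e s where e: "0 < e" and s: "strict_mono (s :: nat \<Rightarrow> nat)"
      and far: "\<And>n. e \<le> \<bar>G (z (s n)) - G w\<bar>"
      by (rule not_LIMSEQ_subseq) (rule that)
    obtain D where D: "\<And>y. y \<in> L2 T \<Longrightarrow> \<bar>G y\<bar> \<le> D * L2_norm T y"
      using G unfolding L2_functional_def by blast
    have "\<bar>G (z (s n))\<bar> \<le> \<bar>D\<bar> * C" for n
    proof -
      have "\<bar>G (z (s n))\<bar> \<le> \<bar>D\<bar> * L2_norm T (z (s n))"
        using D[OF z(1)[of "s n"]] mult_right_mono[OF abs_ge_self L2_norm_nonneg] order_trans by blast
      also have "\<dots> \<le> \<bar>D\<bar> * C" by (intro mult_left_mono z) auto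
      finally show ?thesis .
    qed
    then have "bounded (range (\<lambda>n. G (z (s n))))"
      unfolding bounded_iff by auto
    then obtain l p where p: "strict_mono (p :: nat \<Rightarrow> nat)" "(\<lambda>n. G (z (s (p n)))) \<longlonglongrightarrow> l"
      using bounded_imp_convergent_subsequence[of "\<lambda>n. G (z (s n))"] by (auto simp: o_def)
    define q where "q n = s (p n)" for n
    have q: "strict_mono q" unfolding q_def using s p(1) by (simp add: strict_mono_def)
    have zq: "z (q n) \<in> L2 T" "L2_norm T (z (q n)) \<le> C" for n by (rule z)+
    obtain y' w' where y': "\<And>k. y' k \<in> midpoint_hull ((\<lambda>n. z (q n)) ` {k..})"
      and w': "w' \<in> L2 T" "L2_tendsto T y' w'"
      by (rule midpoint_hull_convergent[OF a zq]) (rule that)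
    have Bw': "?B (x m) w' = c m" for m
      by (rule midpoint_hull_limit[OF form_integral_functional_right[OF ab x(1)] z(1) _ y' w'])
        (use LIMSEQ_subseq_LIMSEQ[OF c q] in \<open>simp add: z_def o_def\<close>)
    have "G w' = l"
      by (rule midpoint_hull_limit[OF G z(1) _ y' w']) (use p in \<open>simp add: q_def\<close>)
    have far': "e \<le> \<bar>l - G w\<bar>"
      by (rule LIMSEQ_le_const[OF tendsto_rabs[OF tendsto_diff[OF p(2) tendsto_const]]]) (use far in auto)
    \<comment> \<open>The functional \<open>\<lambda>u. ?B u v\<close> vanishes at every
      \<open>x m\<close>, hence at the hull limits \<open>w\<close> and \<open>w'\<close>, hence at
      their difference \<open>v\<close>.\<close>
    define v where "v t = w t - w' t" for t
    have v: "v \<in> L2 T" unfolding v_def by (rule L2_diff[OF w(1) w'(1)])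
    have Bl: "L2_functional T (\<lambda>u. ?B u v)" by (rule form_integral_functional_left[OF ab v])
    have B0: "?B (x m) v = 0" for m
      unfolding v_def L2_functional_diff[OF form_integral_functional_right[OF ab x(1)] w(1) w'(1)]
      using Bw Bw' by simp
    have "?B w v = 0"
      by (rule midpoint_hull_limit[OF Bl z(1) _ y w]) (simp add: z_def B0)
    moreover have "?B w' v = 0"
      by (rule midpoint_hull_limit[OF Bl z(1) _ y' w']) (simp add: z_def B0)
    ultimately have "?B v v = 0"
      using L2_functional_diff[OF Bl w(1) w'(1)] by (simp add: v_def[abs_def])
    then have "L2_norm T v = 0"
      using coercive_forms_norm_le[OF a(1,2) v] a(3) by (simp add: mult_le_0_iff)
    then have "G v = 0" using D[OF v] by simp
    then have "G w = G w'"
      using L2_functional_diff[OF G w(1) w'(1)] by (simp add: v_def[abs_def])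
    then show False using \<open>G w' = l\<close> far' e by simp
  qed
  then have "L2_weakly_tendsto T (\<lambda>n. x (r n)) w"
    unfolding L2_weakly_tendsto_def z_def by blast
  with r w(1) show ?thesis by (rule that)
qed

subsection \<open>Approximation by simple functions\<close>

text \<open>Dominated convergence for the squared distances, with the square of the norm of
  \<open>g\<close> as dominating function.\<close>

lemma L2_tendsto_dominated:
  fixes y :: "nat \<Rightarrow> real \<Rightarrow> 'b::{real_normed_vector, second_countable_topology}"
  assumes y: "\<And>n. y n \<in> L2 T" and z: "z \<in> L2 T" and g: "g \<in> L2 T"
    and lim: "AE t in time_measure T. (\<lambda>n. y n t) \<longlonglongrightarrow> z t"
    and le: "\<And>n. AE t in time_measure T. norm (y n t - z t) \<le> norm (g t)"
  shows "L2_tendsto T y z"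
proof -
  let ?M = "time_measure T"
  have m: "(\<lambda>t. (norm (y n t - z t))\<^sup>2) \<in> borel_measurable ?M" for n
    using L2_borel_measurable[OF y] L2_borel_measurable[OF z] by measurable
  have "(\<lambda>n. \<integral>t. (norm (y n t - z t))\<^sup>2 \<partial>?M) \<longlonglongrightarrow> (\<integral>t. 0 \<partial>?M)"
  proof (rule integral_dominated_convergence)
    show "integrable ?M (\<lambda>t. (norm (g t))\<^sup>2)" by (rule L2_integrable_norm2[OF g])
    show "AE t in ?M. (\<lambda>n. (norm (y n t - z t))\<^sup>2) \<longlonglongrightarrow> 0"
      using lim
    proof eventually_elim
      case (elim t)
      have "(\<lambda>n. (norm (y n t - z t))\<^sup>2) \<longlonglongrightarrow> (norm (z t - z t))\<^sup>2"
        by (intro tendsto_intros elim)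
      then show ?case by simp
    qed
    show "AE t in ?M. norm ((norm (y n t - z t))\<^sup>2) \<le> (norm (g t))\<^sup>2" for n
      using le[of n] by eventually_elim (simp add: power_mono)
  qed (use m in auto)
  then have "(\<lambda>n. sqrt (\<integral>t. (norm (y n t - z t))\<^sup>2 \<partial>?M)) \<longlonglongrightarrow> sqrt (\<integral>t. 0 \<partial>?M)"
    by (rule tendsto_real_sqrt)
  then show ?thesis by (simp add: L2_tendsto_def L2_norm_def)
qed

lemma simple_function_L2:
  assumes s: "simple_function (time_measure T) s" shows "s \<in> L2 T"
proof -
  have sm: "strongly_measurable (time_measure T) s"
    by (rule strongly_measurableI[of _ "\<lambda>_. s"]) (use s in auto)
  have fin: "finite ((\<lambda>t. norm (s t)) ` {0<..<T})"
    using finite_imageI[OF simple_functionD(1)[OF s], of norm] by (simp add: image_image)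
  obtain B where "\<forall>t\<in>{0<..<T}. norm (s t) \<le> B"
    using finite_imp_bounded[OF fin] unfolding bounded_iff by auto
  then have B: "norm (s t) \<le> B" if "t \<in> {0<..<T}" for t using that by blast
  have B': "norm (s t) \<le> \<bar>B\<bar> * norm (1::real)" if "t \<in> {0<..<T}" for t
    using B[OF that] by simp
  show ?thesis
    by (rule L2_bounded_by[OF sm L2_const[of "1::real"], of "\<bar>B\<bar>"]) (rule AE_I2, rule B', simp)
qed

text \<open>\<open>s N t\<close> is a nearest point to \<open>h t\<close> among the first
  \<open>N + 1\<close> points of a countable dense subset of \<open>C\<close>. Its values lie in
  \<open>C\<close> at every \<open>t\<close>, even where \<open>h t\<close> does not, and its
  distance to \<open>h t\<close> never exceeds that of \<open>d 0\<close>, which dominates the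
  convergence.\<close>

lemma L2_in_simple_approx:
  fixes h :: "real \<Rightarrow> 'v::{real_normed_vector, second_countable_topology}"
  assumes h: "h \<in> L2_in T C" and C: "C \<noteq> {}"
  obtains s :: "nat \<Rightarrow> real \<Rightarrow> 'v" where "\<And>i. simple_function (time_measure T) (s i)"
    "\<And>i t. s i t \<in> C" "L2_tendsto T s h"
proof -
  let ?M = "time_measure T"
  have hL: "h \<in> L2 T" and hC: "AE t in ?M. h t \<in> C"
    using h by (auto simp: L2_in_def)
  have [measurable]: "h \<in> borel_measurable ?M" by (rule L2_borel_measurable[OF hL])
  obtain D where D: "countable D" "D \<subseteq> C" "C \<subseteq> closure D"
    by (rule separable[of C])
  have "D \<noteq> {}" using D(3) C by auto
  define d where "d = from_nat_into D"
  have dD: "d k \<in> D" for k unfolding d_def by (rule from_nat_into[OF \<open>D \<noteq> {}\<close>])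
  define s where "s = rec_nat (\<lambda>t. d 0)
    (\<lambda>N g t. if dist (d (Suc N)) (h t) < dist (g t) (h t) then d (Suc N) else g t)"
  have s0: "s 0 = (\<lambda>t. d 0)" and
    sS: "s (Suc N) = (\<lambda>t. if dist (d (Suc N)) (h t) < dist (s N t) (h t) then d (Suc N) else s N t)" for N
    unfolding s_def by simp_all
  have simp: "simple_function ?M (s N)" for N
  proof (induction N)
    case (Suc N)
    have [measurable]: "s N \<in> borel_measurable ?M"
      by (rule borel_measurable_simple_function[OF Suc])
    show ?case unfolding sS
      by (rule simple_function_If[OF _ Suc]) (rule simple_function_const, measurable)
  qed (simp add: s0)
  have sC: "s N t \<in> C" for N t
    by (induction N) (use dD D(2) in \<open>auto simp: s0 sS\<close>)
  have best: "dist (s N t) (h t) \<le> dist (d k) (h t)" if "k \<le> N" for N k t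
    using that
  proof (induction N)
    case (Suc N)
    then show ?case by (cases "k = Suc N") (auto simp: sS)
  qed (simp add: s0)
  have "L2_tendsto T s h"
  proof (rule L2_tendsto_dominated[OF simple_function_L2[OF simp] hL L2_diff[OF L2_const[of "d 0"] hL]])
    show "AE t in ?M. (\<lambda>n. s n t) \<longlonglongrightarrow> h t"
      using hC
    proof eventually_elim
      case (elim t)
      show ?case
      proof (rule metric_LIMSEQ_I)
        fix e :: real assume "0 < e"
        with elim D(3) obtain y where "y \<in> D" "dist y (h t) < e"
          by (metis closure_approachable subsetD)
        then obtain k where "dist (d k) (h t) < e"
          using from_nat_into_surj[OF D(1)] unfolding d_def by metis
        then have "dist (s n t) (h t) < e" if "n \<ge> k" for n
          using best[OF that, of t] by simp
        then show "\<exists>N. \<forall>n\<ge>N. dist (s n t) (h t) < e" by blast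
      qed
    qed
    show "AE t in ?M. norm (s n t - h t) \<le> norm (d 0 - h t)" for n
      using best[of 0 n] by (simp add: dist_norm)
  qed
  with simp sC show ?thesis by (rule that)
qed

subsection \<open>Regularization in time\<close>

text \<open>As a function of \<open>t\<close> this is the causal fundamental solution of
  \<open>e v' + v\<close>: it vanishes up to \<open>s\<close> and jumps by \<open>1 / e\<close>
  there.\<close>

definition exp_kernel :: "real \<Rightarrow> real \<Rightarrow> real \<Rightarrow> real" where
  "exp_kernel e t s = (if s < t then exp ((s - t) / e) / e else 0)"

text \<open>The variation of constants formula for \<open>e v' + v = h\<close>,
  \<open>v 0 = x0\<close>. As the kernel vanishes for \<open>s \<ge> t\<close>, the integral over
  the whole interval sees only the past.\<close>

definition regularize :: "real \<Rightarrow> real \<Rightarrow> 'v::{banach, second_countable_topology} \<Rightarrow> (real \<Rightarrow> 'v) \<Rightarrow> real \<Rightarrow> 'v" where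
  "regularize T e x0 h t = exp (- t / e) *\<^sub>R x0 + (\<integral>s. exp_kernel e t s *\<^sub>R h s \<partial>time_measure T)"

lemma exp_kernel_nonneg: "0 < e \<Longrightarrow> 0 \<le> exp_kernel e t s"
  by (simp add: exp_kernel_def)

lemma exp_kernel_le:
  assumes "0 < e" shows "exp_kernel e t s \<le> 1 / e"
proof -
  have "exp ((s - t) / e) \<le> 1" if "s < t"
    using that assms by (simp add: divide_nonpos_pos)
  then show ?thesis using assms by (auto simp: exp_kernel_def divide_right_mono)
qed

lemma exp_kernel_borel [measurable]:
  "(\<lambda>s. exp_kernel e t s) \<in> borel_measurable borel"
  "(\<lambda>t. exp_kernel e t s) \<in> borel_measurable borel"
  unfolding exp_kernel_def by measurable

lemmas exp_kernel_time [measurable] = exp_kernel_borel[THEN borel_measurable_time]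

lemma exp_kernel_measurable_pair [measurable]:
  "(\<lambda>p. exp_kernel e (fst p) (snd p)) \<in> borel_measurable (time_measure T \<Otimes>\<^sub>M time_measure T)"
proof -
  have [measurable]: "(\<lambda>t. t) \<in> borel_measurable (time_measure T)"
    by (rule borel_measurable_time) simp
  show ?thesis unfolding exp_kernel_def by measurable
qed

lemma AE_time_not_in_finite:
  assumes "finite F" shows "AE t in time_measure T. t \<notin> F"
proof -
  have "F \<in> null_sets lebesgue"
    using finite_imp_null_set_lborel[OF assms] by (rule null_sets_completionI)
  then have "AE t in lebesgue. t \<notin> F" by (rule AE_not_in)
  then show ?thesis by (subst AE_restrict_space_iff) (auto elim: eventually_mono)
qed

text \<open>Tailored to kernels with a jump: \<open>q\<close> agrees with the continuous
  \<open>g\<close> strictly between \<open>a\<close> and \<open>b\<close> and vanishes outside, and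
  the endpoints form a null set. The completed measure on the time interval is exchanged for
  Lebesgue measure on Borel sets before the fundamental theorem of calculus is applied.\<close>

lemma time_integral_FTC:
  fixes q g F :: "real \<Rightarrow> real"
  assumes q: "q \<in> borel_measurable (time_measure T)" and ab: "0 \<le> a" "a \<le> b" "b \<le> T"
    and eq: "\<And>t. a < t \<Longrightarrow> t < b \<Longrightarrow> q t = g t"
    and zero: "\<And>t. t < a \<or> b < t \<Longrightarrow> q t = 0"
    and F: "\<And>t. (F has_real_derivative g t) (at t)" and g: "continuous_on UNIV g"
  shows "(\<integral>t. q t \<partial>time_measure T) = F b - F a"
proof -
  let ?M = "time_measure T"
  have [measurable]: "g \<in> borel_measurable borel"
    using g by (rule borel_measurable_continuous_onI)
  have gm: "(\<lambda>t. indicator {a..b} t *\<^sub>R g t) \<in> borel_measurable borel"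
    by measurable
  have "AE t in ?M. t \<notin> {a, b}"
    by (rule AE_time_not_in_finite) simp
  then have "AE t in ?M. q t = indicator {a..b} t *\<^sub>R g t"
    by eventually_elim (use eq zero in \<open>auto simp: indicator_def not_le not_less less_le\<close>)
  then have "(\<integral>t. q t \<partial>?M) = (\<integral>t. indicator {a..b} t *\<^sub>R g t \<partial>?M)"
    by (intro integral_cong_AE q borel_measurable_time gm)
  also have "\<dots> = (\<integral>t. indicator {0<..<T} t *\<^sub>R (indicator {a..b} t *\<^sub>R g t) \<partial>lebesgue)"
    by (rule integral_restrict_space) simp
  also have "\<dots> = (\<integral>t. indicator {0<..<T} t *\<^sub>R (indicator {a..b} t *\<^sub>R g t) \<partial>lborel)"
    by (rule integral_completion) (use gm in measurable)
  also have "\<dots> = (\<integral>t. indicator {a..b} t *\<^sub>R g t \<partial>lborel)"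
  proof (rule integral_cong_AE)
    have "AE t in lborel. t \<notin> {a, b}"
      by (rule AE_not_in) (simp add: finite_imp_null_set_lborel)
    then show "AE t in lborel. indicator {0<..<T} t *\<^sub>R (indicator {a..b} t *\<^sub>R g t) = indicator {a..b} t *\<^sub>R g t"
      by eventually_elim (use ab in \<open>auto simp: indicator_def\<close>)
  qed (use gm in measurable)
  also have "\<dots> = F b - F a"
    by (rule integral_FTC_atLeastAtMost[OF ab(2)])
      (use F g in \<open>auto simp: has_real_derivative_iff_has_vector_derivative[symmetric]
        intro: has_field_derivative_at_within continuous_on_subset\<close>)
  finally show ?thesis .
qed

lemma exp_kernel_integrable_right:
  assumes "0 < e" shows "integrable (time_measure T) (\<lambda>s. exp_kernel e t s)"
  by (rule time.integrable_const_bound[of _ "1 / e"])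
    (use assms exp_kernel_le exp_kernel_nonneg in \<open>auto simp: abs_of_nonneg\<close>)

text \<open>Together with the weight \<open>exp (- t / e)\<close> of \<open>x0\<close> the kernel
  has total mass 1, so \<open>regularize\<close> forms averages.\<close>

lemma exp_kernel_integral_right:
  assumes e: "0 < e" and t: "0 \<le> t" "t \<le> T"
  shows "(\<integral>s. exp_kernel e t s \<partial>time_measure T) = 1 - exp (- t / e)"
proof -
  let ?g = "\<lambda>s. exp ((s - t) / e) / e"
  \<comment> \<open>\<open>time_integral_FTC\<close> asks for an integrand that vanishes for
    negative \<open>s\<close>, which the kernel does not; the cut-off is invisible inside the time
    interval.\<close>
  define q where "q s = (if s < 0 then 0 else exp_kernel e t s)" for s
  have "(\<integral>s. exp_kernel e t s \<partial>time_measure T) = (\<integral>s. q s \<partial>time_measure T)"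
    by (rule Bochner_Integration.integral_cong) (auto simp: q_def)
  also have "\<dots> = exp ((t - t) / e) - exp ((0 - t) / e)"
  proof (rule time_integral_FTC[where g="?g" and F="\<lambda>s. exp ((s - t) / e)" and a=0 and b=t])
    show "q \<in> borel_measurable (time_measure T)"
      unfolding q_def by (rule borel_measurable_time) measurable
    show "((\<lambda>s. exp ((s - t) / e)) has_real_derivative ?g s) (at s)" for s
      using e by (auto intro!: derivative_eq_intros)
    show "continuous_on UNIV ?g"
      using e by (intro continuous_intros) auto
  qed (use t in \<open>auto simp: q_def exp_kernel_def\<close>)
  finally show ?thesis by simp
qed

text \<open>The mass in the other variable. Bounds by 1 in both variables are the input of Schur's
  test, which yields contractivity in \<open>L2\<close>.\<close>

lemma exp_kernel_integral_left_le:
  assumes e: "0 < e" and s: "s \<in> {0<..<T}"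
  shows "(\<integral>\<^sup>+t. ennreal (exp_kernel e t s) \<partial>time_measure T) \<le> 1"
proof -
  let ?g = "\<lambda>t. exp ((s - t) / e) / e"
  define q where "q t = (if T < t then 0 else exp_kernel e t s)" for t
  have "(\<integral>t. exp_kernel e t s \<partial>time_measure T) = (\<integral>t. q t \<partial>time_measure T)"
    by (rule Bochner_Integration.integral_cong) (auto simp: q_def)
  also have "\<dots> = - exp ((s - T) / e) - (- exp ((s - s) / e))"
  proof (rule time_integral_FTC[where g="?g" and F="\<lambda>t. - exp ((s - t) / e)" and a=s and b=T])
    show "q \<in> borel_measurable (time_measure T)"
      unfolding q_def by (rule borel_measurable_time) measurable
    show "((\<lambda>t. - exp ((s - t) / e)) has_real_derivative ?g t) (at t)" for t
      using e by (auto intro!: derivative_eq_intros)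
    show "continuous_on UNIV ?g"
      using e by (intro continuous_intros) auto
  qed (use s in \<open>auto simp: q_def exp_kernel_def\<close>)
  finally have "(\<integral>t. exp_kernel e t s \<partial>time_measure T) \<le> 1" by simp
  moreover have "integrable (time_measure T) (\<lambda>t. exp_kernel e t s)"
    by (rule time.integrable_const_bound[of _ "1 / e"])
      (use e exp_kernel_le exp_kernel_nonneg in \<open>auto simp: abs_of_nonneg\<close>)
  ultimately show ?thesis
    using nn_integral_eq_integral[of "time_measure T" "\<lambda>t. exp_kernel e t s"] exp_kernel_nonneg[OF e]
    by (simp add: ennreal_le_1)
qed

lemma exp_kernel_scaleR_L2:
  fixes h :: "real \<Rightarrow> 'v::{banach, second_countable_topology}"
  assumes e: "0 < e" and h: "h \<in> L2 T"
  shows "(\<lambda>s. exp_kernel e t s *\<^sub>R h s) \<in> L2 T"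
proof (rule L2_bounded_by[OF _ h, of _ "1 / e"])
  show "strongly_measurable (time_measure T) (\<lambda>s. exp_kernel e t s *\<^sub>R h s)"
    using L2_borel_measurable[OF h] by (simp add: strongly_measurable_iff_borel)
  have "norm (exp_kernel e t s *\<^sub>R h s) \<le> 1 / e * norm (h s)" for s
    using exp_kernel_le[OF e, of t s] exp_kernel_nonneg[OF e, of t s]
    by (simp only: norm_scaleR) (intro mult_right_mono, auto)
  then show "AE s in time_measure T. norm (exp_kernel e t s *\<^sub>R h s) \<le> 1 / e * norm (h s)" by simp
qed

lemmas exp_kernel_scaleR_integrable = L2_integrable[OF exp_kernel_scaleR_L2]

lemma regularize_diff:
  assumes "0 < e" "h \<in> L2 T" "k \<in> L2 T"
  shows "regularize T e x0 h t - regularize T e y0 k t = regularize T e (x0 - y0) (\<lambda>t. h t - k t) t"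
  using exp_kernel_scaleR_integrable[OF assms(1,2)] exp_kernel_scaleR_integrable[OF assms(1,3)]
  by (simp add: regularize_def scaleR_diff_right)

lemma regularize_add:
  assumes "0 < e" "h \<in> L2 T" "k \<in> L2 T"
  shows "regularize T e x0 h t + regularize T e y0 k t = regularize T e (x0 + y0) (\<lambda>t. h t + k t) t"
  using exp_kernel_scaleR_integrable[OF assms(1,2)] exp_kernel_scaleR_integrable[OF assms(1,3)]
  by (simp add: regularize_def scaleR_add_right)

lemma regularize_at_0: "regularize T e x0 h 0 = x0"
proof -
  have "(\<integral>s. exp_kernel e 0 s *\<^sub>R h s \<partial>time_measure T) = (\<integral>s. 0 \<partial>time_measure T)"
    by (rule Bochner_Integration.integral_cong) (auto simp: exp_kernel_def)
  then show ?thesis by (simp add: regularize_def)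
qed

text \<open>Dominated convergence with the bound \<open>1 / e\<close> for the kernel: at a given
  time \<open>t\<close> the kernel depends continuously on time for every \<open>s\<close> except
  \<open>s = t\<close>, which is a null set.\<close>

lemma regularize_continuous:
  assumes e: "0 < e" and h: "h \<in> L2 T"
  shows "continuous_on UNIV (regularize T e x0 h)"
proof -
  have "continuous_on UNIV (\<lambda>t. \<integral>s. exp_kernel e t s *\<^sub>R h s \<partial>time_measure T)"
    unfolding continuous_on_sequentially o_def
  proof (intro allI ballI impI)
    fix t :: real and u :: "nat \<Rightarrow> real"
    assume u: "(\<forall>n. u n \<in> UNIV) \<and> u \<longlonglongrightarrow> t"
    show "(\<lambda>n. \<integral>s. exp_kernel e (u n) s *\<^sub>R h s \<partial>time_measure T) \<longlonglongrightarrow> (\<integral>s. exp_kernel e t s *\<^sub>R h s \<partial>time_measure T)"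
    proof (rule integral_dominated_convergence)
      show "integrable (time_measure T) (\<lambda>s. 1 / e * norm (h s))"
        using L2_integrable[OF h] by simp
      show "AE s in time_measure T. norm (exp_kernel e (u n) s *\<^sub>R h s) \<le> 1 / e * norm (h s)" for n
        using exp_kernel_le[OF e] exp_kernel_nonneg[OF e]
        by (intro AE_I2) (simp only: norm_scaleR real_norm_def abs_of_nonneg mult_right_mono norm_ge_zero)
      have "AE s in time_measure T. s \<notin> {t}"
        by (rule AE_time_not_in_finite) simp
      then show "AE s in time_measure T. (\<lambda>n. exp_kernel e (u n) s *\<^sub>R h s) \<longlonglongrightarrow> exp_kernel e t s *\<^sub>R h s"
      proof eventually_elim
        case (elim s)
        have "(\<lambda>n. exp_kernel e (u n) s) \<longlonglongrightarrow> exp_kernel e t s"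
        proof (cases "s < t")
          case True
          then have "\<forall>\<^sub>F n in sequentially. s < u n" using u order_tendstoD(1) by blast
          then have "\<forall>\<^sub>F n in sequentially. exp ((s - u n) / e) / e = exp_kernel e (u n) s"
            by eventually_elim (simp add: exp_kernel_def)
          moreover have "(\<lambda>n. exp ((s - u n) / e) / e) \<longlonglongrightarrow> exp ((s - t) / e) / e"
            using u e by (intro tendsto_intros) auto
          ultimately show ?thesis using True by (auto simp: exp_kernel_def dest: Lim_transform_eventually)
        next
          case False
          then have "t < s" using elim by auto
          then have "\<forall>\<^sub>F n in sequentially. u n < s" using u order_tendstoD(2) by blast
          then have "\<forall>\<^sub>F n in sequentially. 0 = exp_kernel e (u n) s"
            by eventually_elim (simp add: exp_kernel_def)
          with False show ?thesis by (auto simp: exp_kernel_def intro: Lim_transform_eventually)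
        qed
        then show ?case by (intro tendsto_intros)
      qed
    qed (use L2_borel_measurable[OF h] in measurable)
  qed
  then have "continuous_on UNIV (\<lambda>t. exp (- t / e) *\<^sub>R x0 + (\<integral>s. exp_kernel e t s *\<^sub>R h s \<partial>time_measure T))"
    using e by (intro continuous_intros) auto
  then show ?thesis by (simp add: regularize_def[abs_def])
qed

lemma regularize_measurable:
  assumes "0 < e" "h \<in> L2 T"
  shows "regularize T e x0 h \<in> borel_measurable (time_measure T)"
  by (rule borel_measurable_time[OF borel_measurable_continuous_onI[OF regularize_continuous[OF assms]]])

text \<open>The Cauchy-Schwarz inequality with the kernel split into two square roots; the factor
  without \<open>h\<close> has norm at most 1 because the kernel has mass at most 1.\<close>

lemma exp_kernel_Jensen:
  fixes h :: "real \<Rightarrow> 'v::{banach, second_countable_topology}"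
  assumes e: "0 < e" and h: "h \<in> L2 T" and t: "t \<in> {0<..<T}"
  shows "integrable (time_measure T) (\<lambda>s. exp_kernel e t s * (norm (h s))\<^sup>2)"
    and "(norm (\<integral>s. exp_kernel e t s *\<^sub>R h s \<partial>time_measure T))\<^sup>2
      \<le> (\<integral>s. exp_kernel e t s * (norm (h s))\<^sup>2 \<partial>time_measure T)"
proof -
  let ?M = "time_measure T" and ?k = "exp_kernel e t"
  have k0: "0 \<le> ?k s" for s by (rule exp_kernel_nonneg[OF e])
  have [measurable]: "h \<in> borel_measurable ?M" by (rule L2_borel_measurable[OF h])
  show int: "integrable ?M (\<lambda>s. ?k s * (norm (h s))\<^sup>2)"
  proof (rule Bochner_Integration.integrable_bound)
    show "integrable ?M (\<lambda>s. 1 / e * (norm (h s))\<^sup>2)"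
      using L2_integrable_norm2[OF h] by simp
    show "AE s in ?M. norm (?k s * (norm (h s))\<^sup>2) \<le> norm (1 / e * (norm (h s))\<^sup>2)"
      using k0 e exp_kernel_le[OF e, of t]
      by (intro AE_I2) (simp only: real_norm_def abs_mult abs_of_nonneg zero_le_power2, intro mult_right_mono, auto)
  qed measurable
  have f: "(\<lambda>s. sqrt (?k s)) \<in> L2 T"
    using exp_kernel_integrable_right[OF e] k0 by (simp add: L2_def strongly_measurable_iff_borel)
  have g: "(\<lambda>s. sqrt (?k s) * norm (h s)) \<in> L2 T"
    using int k0 by (simp add: L2_def strongly_measurable_iff_borel power_mult_distrib)
  have fn: "(L2_norm T (\<lambda>s. sqrt (?k s)))\<^sup>2 \<le> 1"
    using exp_kernel_integral_right[OF e, of t T] t k0 by (simp add: L2_norm_power2)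
  have gn: "(L2_norm T (\<lambda>s. sqrt (?k s) * norm (h s)))\<^sup>2 = (\<integral>s. ?k s * (norm (h s))\<^sup>2 \<partial>?M)"
    using k0 by (simp add: L2_norm_power2 power_mult_distrib)
  have "norm (\<integral>s. ?k s *\<^sub>R h s \<partial>?M) \<le> (\<integral>s. norm (?k s *\<^sub>R h s) \<partial>?M)"
    by (rule integral_norm_bound)
  also have "\<dots> = (\<integral>s. sqrt (?k s) * (sqrt (?k s) * norm (h s)) \<partial>?M)"
    using k0 by (simp add: mult.assoc[symmetric])
  also have "\<dots> \<le> L2_norm T (\<lambda>s. sqrt (?k s)) * L2_norm T (\<lambda>s. sqrt (?k s) * norm (h s))"
    using L2_Cauchy_Schwarz[OF f g] by (rule order_trans[OF abs_ge_self])
  finally have "(norm (\<integral>s. ?k s *\<^sub>R h s \<partial>?M))\<^sup>2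
      \<le> (L2_norm T (\<lambda>s. sqrt (?k s)) * L2_norm T (\<lambda>s. sqrt (?k s) * norm (h s)))\<^sup>2"
    by (rule power_mono) simp
  also have "\<dots> \<le> 1 * (\<integral>s. ?k s * (norm (h s))\<^sup>2 \<partial>?M)"
    unfolding power_mult_distrib gn by (rule mult_right_mono[OF fn]) (use k0 in auto)
  finally show "(norm (\<integral>s. ?k s *\<^sub>R h s \<partial>?M))\<^sup>2 \<le> (\<integral>s. ?k s * (norm (h s))\<^sup>2 \<partial>?M)" by simp
qed

text \<open>Schur's test: Jensen's inequality in \<open>s\<close>, Tonelli's theorem, then mass at
  most 1 in \<open>t\<close>. The bound does not depend on \<open>e\<close>, on which the density
  argument for \<open>e\<close> tending to 0 relies.\<close>

lemma regularize_zero_L2: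
  fixes h :: "real \<Rightarrow> 'v::{banach, second_countable_topology}"
  assumes e: "0 < e" and h: "h \<in> L2 T"
  shows "regularize T e 0 h \<in> L2 T" and "L2_norm T (regularize T e 0 h) \<le> L2_norm T h"
proof -
  let ?M = "time_measure T" and ?r = "regularize T e 0 h"
  interpret P: pair_sigma_finite ?M ?M by unfold_locales
  have k0: "0 \<le> exp_kernel e t s" for s t by (rule exp_kernel_nonneg[OF e])
  have [measurable]: "h \<in> borel_measurable ?M" by (rule L2_borel_measurable[OF h])
  have rm[measurable]: "?r \<in> borel_measurable ?M" by (rule regularize_measurable[OF e h])
  have "(\<integral>\<^sup>+t. ennreal ((norm (?r t))\<^sup>2) \<partial>?M)
      \<le> (\<integral>\<^sup>+t. (\<integral>\<^sup>+s. ennreal (exp_kernel e t s * (norm (h s))\<^sup>2) \<partial>?M) \<partial>?M)"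
  proof (rule nn_integral_mono)
    fix t assume t: "t \<in> space ?M"
    then have t: "t \<in> {0<..<T}" by simp
    show "ennreal ((norm (?r t))\<^sup>2) \<le> (\<integral>\<^sup>+s. ennreal (exp_kernel e t s * (norm (h s))\<^sup>2) \<partial>?M)"
      using exp_kernel_Jensen(2)[OF e h t] nn_integral_eq_integral[OF exp_kernel_Jensen(1)[OF e h t]] k0
      by (simp add: regularize_def ennreal_leI)
  qed
  also have "\<dots> = (\<integral>\<^sup>+s. (\<integral>\<^sup>+t. ennreal (exp_kernel e t s * (norm (h s))\<^sup>2) \<partial>?M) \<partial>?M)"
    by (rule P.Fubini'[symmetric]) (simp add: split_beta')
  also have "\<dots> \<le> (\<integral>\<^sup>+s. ennreal ((norm (h s))\<^sup>2) \<partial>?M)"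
  proof (rule nn_integral_mono)
    fix s assume "s \<in> space ?M"
    then have s: "s \<in> {0<..<T}" by simp
    have "(\<integral>\<^sup>+t. ennreal (exp_kernel e t s * (norm (h s))\<^sup>2) \<partial>?M)
        = (\<integral>\<^sup>+t. ennreal (exp_kernel e t s) \<partial>?M) * ennreal ((norm (h s))\<^sup>2)"
      using k0 by (simp add: ennreal_mult nn_integral_multc)
    also have "\<dots> \<le> 1 * ennreal ((norm (h s))\<^sup>2)"
      by (rule mult_right_mono[OF exp_kernel_integral_left_le[OF e s]]) simp
    finally show "(\<integral>\<^sup>+t. ennreal (exp_kernel e t s * (norm (h s))\<^sup>2) \<partial>?M) \<le> ennreal ((norm (h s))\<^sup>2)"
      by simp
  qed
  also have "\<dots> = ennreal ((L2_norm T h)\<^sup>2)"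
    unfolding L2_norm_power2 by (rule nn_integral_eq_integral[OF L2_integrable_norm2[OF h]]) simp
  finally have *: "(\<integral>\<^sup>+t. ennreal ((norm (?r t))\<^sup>2) \<partial>?M) \<le> ennreal ((L2_norm T h)\<^sup>2)" .
  then have int: "integrable ?M (\<lambda>t. (norm (?r t))\<^sup>2)"
    by (intro integrableI_bounded) (auto intro: le_less_trans)
  then show "?r \<in> L2 T" using rm by (simp add: L2_def strongly_measurable_iff_borel)
  have "ennreal ((L2_norm T ?r)\<^sup>2) \<le> ennreal ((L2_norm T h)\<^sup>2)"
    unfolding L2_norm_power2[of T ?r] using * nn_integral_eq_integral[OF int] by simp
  then have "(L2_norm T ?r)\<^sup>2 \<le> (L2_norm T h)\<^sup>2" by simp
  then show "L2_norm T ?r \<le> L2_norm T h" using L2_norm_nonneg by (rule power2_le_imp_le)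
qed

lemma regularize_split: "regularize T e x0 h = (\<lambda>t. exp (- t / e) *\<^sub>R x0 + regularize T e 0 h t)"
  by (simp add: regularize_def fun_eq_iff)

lemma exp_decay_L2:
  fixes x0 :: "'v::{banach, second_countable_topology}"
  assumes e: "0 < e"
  shows "(\<lambda>t. exp (- t / e) *\<^sub>R x0) \<in> L2 T"
    and "L2_norm T (\<lambda>t. exp (- t / e) *\<^sub>R x0) \<le> L2_norm T (\<lambda>t. x0)"
proof -
  have m: "strongly_measurable (time_measure T) (\<lambda>t. exp (- t / e) *\<^sub>R x0)"
    unfolding strongly_measurable_iff_borel by (rule borel_measurable_time) simp
  have le: "norm (exp (- t / e) *\<^sub>R x0) \<le> norm x0" if "t \<in> {0<..<T}" for t
  proof -
    have "exp (- t / e) \<le> 1" using that e by simp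
    then show ?thesis by (simp add: mult_left_le_one_le)
  qed
  show 1: "(\<lambda>t. exp (- t / e) *\<^sub>R x0) \<in> L2 T"
    by (rule L2_bounded_by[OF m L2_const[of x0], of 1]) (rule AE_I2, use le in simp)
  show "L2_norm T (\<lambda>t. exp (- t / e) *\<^sub>R x0) \<le> L2_norm T (\<lambda>t. x0)"
    by (rule L2_norm_mono[OF 1 L2_const]) (rule AE_I2, use le in simp)
qed

lemma regularize_L2:
  assumes e: "0 < e" and h: "h \<in> L2 T"
  shows "regularize T e x0 h \<in> L2 T"
    and "L2_norm T (regularize T e x0 h) \<le> L2_norm T (\<lambda>t. x0) + L2_norm T h"
proof -
  show "regularize T e x0 h \<in> L2 T"
    unfolding regularize_split[of T e x0]
    by (rule L2_add[OF exp_decay_L2(1)[OF e] regularize_zero_L2(1)[OF e h]])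
  show "L2_norm T (regularize T e x0 h) \<le> L2_norm T (\<lambda>t. x0) + L2_norm T h"
    unfolding regularize_split[of T e x0]
    using L2_norm_triangle[OF exp_decay_L2(1)[OF e] regularize_zero_L2(1)[OF e h], of x0]
      exp_decay_L2(2)[OF e, of T x0] regularize_zero_L2(2)[OF e h] by linarith
qed

lemma L2_norm_const:
  "L2_norm T (\<lambda>t. x) = L2_norm T (\<lambda>t. 1::real) * norm x"
  by (simp add: L2_norm_def real_sqrt_mult)

lemma regularize_tendsto:
  assumes e: "0 < e" and h: "\<And>n. hs n \<in> L2 T" "h \<in> L2 T" "L2_tendsto T hs h"
    and x: "xs \<longlonglongrightarrow> x"
  shows "L2_tendsto T (\<lambda>n. regularize T e (xs n) (hs n)) (regularize T e x h)"
proof (rule L2_tendstoI)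
  show "L2_norm T (\<lambda>t. regularize T e (xs n) (hs n) t - regularize T e x h t)
      \<le> L2_norm T (\<lambda>t. 1::real) * norm (xs n - x) + L2_norm T (\<lambda>t. hs n t - h t)" for n
    unfolding regularize_diff[OF e h(1,2)] L2_norm_const[symmetric]
    by (rule regularize_L2(2)[OF e L2_diff[OF h(1,2)]])
  have "(\<lambda>n. L2_norm T (\<lambda>t. 1::real) * norm (xs n - x) + L2_norm T (\<lambda>t. hs n t - h t))
      \<longlonglongrightarrow> L2_norm T (\<lambda>t. 1::real) * norm (x - x) + 0"
    using h(3) unfolding L2_tendsto_def by (intro tendsto_intros x)
  then show "(\<lambda>n. L2_norm T (\<lambda>t. 1::real) * norm (xs n - x) + L2_norm T (\<lambda>t. hs n t - h t)) \<longlonglongrightarrow> 0"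
    by simp
qed

subsection \<open>Convergence of the regularization\<close>

lemma regularize_cong:
  assumes "\<And>t. t \<in> {0<..<T} \<Longrightarrow> h t = k t"
  shows "regularize T e x0 h = regularize T e x0 k"
  unfolding regularize_def fun_eq_iff
  by (intro allI arg_cong2[where f="(+)"] refl Bochner_Integration.integral_cong) (simp_all add: assms)

text \<open>Isolates the functions for which convergence is known. They are closed under sums and
  \<open>L2\<close> limits, and the lemmas below enlarge the class from continuous functions to
  indicators, simple functions and finally all of \<open>L2\<close>. The starting value is 0 because
  the part coming from \<open>x0\<close> decays on its own.\<close>

definition regularizes :: "real \<Rightarrow> (real \<Rightarrow> 'v::{banach, second_countable_topology}) \<Rightarrow> bool" where
  "regularizes T h \<longleftrightarrow> h \<in> L2 T \<and> L2_tendsto T (\<lambda>k. regularize T (1 / Suc k) 0 h) h"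

lemma regularizes_add:
  assumes h: "regularizes T h" and k: "regularizes T k"
  shows "regularizes T (\<lambda>t. h t + k t)"
proof -
  have L: "h \<in> L2 T" "k \<in> L2 T" using h k by (auto simp: regularizes_def)
  let ?E = "\<lambda>h n. L2_norm T (\<lambda>t. regularize T (1 / Suc n) 0 h t - h t)"
  have "L2_tendsto T (\<lambda>n. regularize T (1 / Suc n) 0 (\<lambda>t. h t + k t)) (\<lambda>t. h t + k t)"
  proof (rule L2_tendstoI)
    fix n
    have e: "0 < 1 / real (Suc n)" by simp
    show "?E (\<lambda>t. h t + k t) n \<le> ?E h n + ?E k n"
      using L2_norm_triangle[OF L2_diff[OF regularize_L2(1)[OF e L(1), of 0] L(1)]
          L2_diff[OF regularize_L2(1)[OF e L(2), of 0] L(2)]]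
        regularize_add[OF e L, of 0 _ 0]
      by (simp add: algebra_simps)
  next
    have "(\<lambda>n. ?E h n + ?E k n) \<longlonglongrightarrow> 0 + 0"
      using h k unfolding regularizes_def L2_tendsto_def by (intro tendsto_add) auto
    then show "(\<lambda>n. ?E h n + ?E k n) \<longlonglongrightarrow> 0" by simp
  qed
  with L2_add[OF L] show ?thesis by (simp add: regularizes_def)
qed

lemma regularizes_cong:
  assumes h: "regularizes T h" and eq: "\<And>t. t \<in> {0<..<T} \<Longrightarrow> h t = k t"
  shows "regularizes T k"
proof -
  have "AE t in time_measure T. h t = k t"
    by (rule AE_I2) (simp add: eq)
  then have "k \<in> L2 T" using h L2_cong_AE unfolding regularizes_def by blast
  moreover have "L2_norm T (\<lambda>t. regularize T e 0 k t - k t) = L2_norm T (\<lambda>t. regularize T e 0 h t - h t)" for e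
  proof -
    have "regularize T e 0 h = regularize T e 0 k" by (rule regularize_cong[OF eq])
    then show ?thesis
      unfolding L2_norm_def
      by (intro arg_cong[where f=sqrt] Bochner_Integration.integral_cong) (simp_all add: eq)
  qed
  ultimately show ?thesis using h by (simp add: regularizes_def L2_tendsto_def)
qed

lemma regularizes_0: "regularizes T (\<lambda>t. 0)"
  by (simp add: regularizes_def L2_const L2_tendsto_def regularize_def L2_norm_def)

lemma regularizes_sum:
  assumes "finite F" "\<And>y. y \<in> F \<Longrightarrow> regularizes T (h y)"
  shows "regularizes T (\<lambda>t. \<Sum>y\<in>F. h y t)"
  using assms by (induction F rule: finite_induct) (auto simp: regularizes_0 intro: regularizes_add)

text \<open>Three terms of size \<open>r / 3\<close>: \<open>hs m\<close> is close to
  \<open>h\<close>, its regularization is close to it, and contractivity keeps the regularizations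
  of \<open>h\<close> and \<open>hs m\<close> as close as the functions themselves, uniformly in
  \<open>k\<close>.\<close>

lemma regularizes_limit:
  assumes hs: "\<And>n. regularizes T (hs n)" and h: "h \<in> L2 T" and lim: "L2_tendsto T hs h"
  shows "regularizes T h"
  unfolding regularizes_def L2_tendsto_def
proof (intro conjI h LIMSEQ_I)
  fix r :: real assume "0 < r"
  have L: "hs n \<in> L2 T" for n using hs by (simp add: regularizes_def)
  have "\<forall>\<^sub>F n in sequentially. L2_norm T (\<lambda>t. hs n t - h t) < r / 3"
    using lim unfolding L2_tendsto_def by (rule order_tendstoD(2)) (use \<open>0 < r\<close> in simp)
  then obtain m where m: "L2_norm T (\<lambda>t. hs m t - h t) < r / 3"
    unfolding eventually_sequentially by blast
  have "(\<lambda>k. L2_norm T (\<lambda>t. regularize T (1 / Suc k) 0 (hs m) t - hs m t)) \<longlonglongrightarrow> 0"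
    using hs[of m] by (simp add: regularizes_def L2_tendsto_def)
  then have "\<forall>\<^sub>F k in sequentially. L2_norm T (\<lambda>t. regularize T (1 / Suc k) 0 (hs m) t - hs m t) < r / 3"
    by (rule order_tendstoD(2)) (use \<open>0 < r\<close> in simp)
  then obtain N where N: "\<And>k. k \<ge> N \<Longrightarrow> L2_norm T (\<lambda>t. regularize T (1 / Suc k) 0 (hs m) t - hs m t) < r / 3"
    unfolding eventually_sequentially by blast
  have "norm (L2_norm T (\<lambda>t. regularize T (1 / Suc k) 0 h t - h t) - 0) < r" if "k \<ge> N" for k
  proof -
    have e: "0 < 1 / real (Suc k)" by simp
    let ?R = "regularize T (1 / Suc k) 0"
    note RL = regularize_L2(1)[OF e, of _ _ 0]
    have "L2_norm T (\<lambda>t. ?R h t - ?R (hs m) t) \<le> L2_norm T (\<lambda>t. h t - hs m t)"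
      unfolding regularize_diff[OF e h L] diff_self by (rule regularize_zero_L2(2)[OF e L2_diff[OF h L]])
    moreover have "L2_norm T (\<lambda>t. ?R h t - h t) \<le> L2_norm T (\<lambda>t. ?R h t - ?R (hs m) t) + L2_norm T (\<lambda>t. ?R (hs m) t - h t)"
      by (rule L2_norm_triangle_diff[OF RL[OF h] RL[OF L] h])
    moreover have "L2_norm T (\<lambda>t. ?R (hs m) t - h t) \<le> L2_norm T (\<lambda>t. ?R (hs m) t - hs m t) + L2_norm T (\<lambda>t. hs m t - h t)"
      by (rule L2_norm_triangle_diff[OF RL[OF L] L h])
    ultimately have "L2_norm T (\<lambda>t. ?R h t - h t) < r"
      using N[OF that] m L2_norm_minus_commute[of T h "hs m"] by linarith
    then show ?thesis using L2_norm_nonneg[of T "\<lambda>t. ?R h t - h t"] by simp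
  qed
  then show "\<exists>N. \<forall>k\<ge>N. norm (L2_norm T (\<lambda>t. regularize T (1 / Suc k) 0 h t - h t) - 0) < r" by blast
qed

lemma exp_power_Suc: "exp (- t) ^ Suc k = exp (- t / (1 / real (Suc k)))" for t :: real
  by (simp only: exp_of_nat_mult[symmetric]) (simp add: field_simps)

text \<open>The kernels have mass tending to 1 and concentrate at \<open>t\<close> from the left.
  Near \<open>t\<close> the continuity of \<open>g\<close> is used, away from \<open>t\<close> the
  kernel is uniformly small.\<close>

lemma exp_kernel_approx_identity:
  fixes g :: "real \<Rightarrow> real"
  assumes g: "continuous_on UNIV g" and B: "\<And>s. \<bar>g s\<bar> \<le> B" and t: "t \<in> {0<..<T}"
  shows "(\<lambda>k. \<integral>s. exp_kernel (1 / Suc k) t s * g s \<partial>time_measure T) \<longlonglongrightarrow> g t"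
proof (rule LIMSEQ_I)
  fix r :: real assume "0 < r"
  let ?M = "time_measure T"
  define m where "m = measure ?M (space ?M)"
  have B0: "0 \<le> B" using B[of 0] by linarith
  have gm[measurable]: "g \<in> borel_measurable ?M"
    by (rule borel_measurable_time[OF borel_measurable_continuous_onI[OF g]])
  have "isCont g t" using g by (simp add: continuous_on_eq_continuous_at)
  then obtain d where d: "0 < d" "\<And>s. \<bar>s - t\<bar> < d \<Longrightarrow> \<bar>g s - g t\<bar> < r / 2"
    unfolding continuous_at_eps_delta using \<open>0 < r\<close> by (metis dist_real_def half_gt_zero)
  \<comment> \<open>At distance at least \<open>d\<close> from \<open>t\<close> the kernel is at
    most \<open>real (Suc k) * exp (- d) ^ Suc k\<close>; the first term is this bound times the
    length \<open>m\<close> times the oscillation bound \<open>2 * B\<close>. The second term pays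
    for the mass \<open>exp (- t) ^ Suc k\<close> that the kernel lacks.\<close>
  have lim: "(\<lambda>k. 2 * B * m * (real (Suc k) * exp (- d) ^ Suc k) + B * exp (- t) ^ Suc k) \<longlonglongrightarrow> 2 * B * m * 0 + B * 0"
  proof (intro tendsto_intros)
    have "(\<lambda>k. real k * exp (- d) ^ k) \<longlonglongrightarrow> 0"
      using powser_times_n_limit_0[of "exp (- d)"] d(1) by simp
    then show "(\<lambda>k. real (Suc k) * exp (- d) ^ Suc k) \<longlonglongrightarrow> 0" by (rule LIMSEQ_Suc)
    have "(\<lambda>k. exp (- t) ^ k) \<longlonglongrightarrow> 0"
      using t by (intro LIMSEQ_power_zero) simp
    then show "(\<lambda>k. exp (- t) ^ Suc k) \<longlonglongrightarrow> 0" by (rule LIMSEQ_Suc)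
  qed
  have "\<forall>\<^sub>F k in sequentially. 2 * B * m * (real (Suc k) * exp (- d) ^ Suc k) + B * exp (- t) ^ Suc k < r / 2"
    using order_tendstoD(2)[OF lim, of "r / 2"] \<open>0 < r\<close> by simp
  then obtain N where N: "\<And>k. k \<ge> N \<Longrightarrow> 2 * B * m * (real (Suc k) * exp (- d) ^ Suc k) + B * exp (- t) ^ Suc k < r / 2"
    unfolding eventually_sequentially by blast
  have "norm ((\<integral>s. exp_kernel (1 / Suc k) t s * g s \<partial>?M) - g t) < r" if "k \<ge> N" for k
  proof -
    let ?K = "exp_kernel (1 / Suc k) t"
    define w where "w = real (Suc k) * exp (- d) ^ Suc k"
    have e: "0 < 1 / real (Suc k)" by simp
    note Ki = exp_kernel_integrable_right[OF e, of T t]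
    have K0: "0 \<le> ?K s" for s by (rule exp_kernel_nonneg[OF e])
    have K1: "(\<integral>s. ?K s \<partial>?M) = 1 - exp (- t) ^ Suc k"
      unfolding exp_power_Suc by (rule exp_kernel_integral_right[OF e]) (use t in auto)
    have pt: "\<bar>?K s * (g s - g t)\<bar> \<le> ?K s * (r / 2) + 2 * B * w" for s
    proof (cases "\<bar>s - t\<bar> < d")
      case True
      have "\<bar>?K s * (g s - g t)\<bar> = ?K s * \<bar>g s - g t\<bar>" using K0[of s] by (simp add: abs_mult)
      also have "\<dots> \<le> ?K s * (r / 2)" using d(2)[OF True] K0[of s] by (intro mult_left_mono) auto
      finally show ?thesis using B0 by (simp add: w_def add_increasing2)
    next
      case False
      have "?K s \<le> w"
      proof (cases "s < t")
        case True
        then have "real (Suc k) * (s - t) \<le> real (Suc k) * (- d)"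
          using False by (intro mult_left_mono) auto
        then have "exp (real (Suc k) * (s - t)) \<le> exp (real (Suc k) * (- d))" by simp
        also have "\<dots> = exp (- d) ^ Suc k" by (rule exp_of_nat_mult)
        finally show ?thesis
          using True by (simp add: exp_kernel_def w_def mult.commute mult_left_mono del: power_Suc of_nat_Suc)
      qed (simp add: exp_kernel_def w_def)
      moreover have "\<bar>g s - g t\<bar> \<le> 2 * B" using B[of s] B[of t] by linarith
      ultimately have "?K s * \<bar>g s - g t\<bar> \<le> w * (2 * B)"
        using K0[of s] by (intro mult_mono) (auto simp: w_def)
      then show ?thesis using K0[of s] \<open>0 < r\<close> by (simp add: abs_mult mult.commute add_increasing)
    qed
    have i: "integrable ?M (\<lambda>s. ?K s * (g s - g t))"
    proof (rule Bochner_Integration.integrable_bound)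
      show "integrable ?M (\<lambda>s. ?K s * (r / 2) + 2 * B * w)" using Ki by simp
      show "AE s in ?M. norm (?K s * (g s - g t)) \<le> norm (?K s * (r / 2) + 2 * B * w)"
        unfolding real_norm_def by (intro AE_I2 order_trans[OF pt abs_ge_self])
    qed measurable
    have "(\<integral>s. ?K s * g s \<partial>?M) = (\<integral>s. ?K s * (g s - g t) + ?K s * g t \<partial>?M)"
      by (simp add: algebra_simps)
    also have "\<dots> = (\<integral>s. ?K s * (g s - g t) \<partial>?M) + (1 - exp (- t) ^ Suc k) * g t"
      using i Ki K1 by simp
    finally have "norm ((\<integral>s. ?K s * g s \<partial>?M) - g t) = \<bar>(\<integral>s. ?K s * (g s - g t) \<partial>?M) - exp (- t) ^ Suc k * g t\<bar>"
      by (simp add: algebra_simps)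
    then have split: "norm ((\<integral>s. ?K s * g s \<partial>?M) - g t)
        \<le> \<bar>\<integral>s. ?K s * (g s - g t) \<partial>?M\<bar> + \<bar>exp (- t) ^ Suc k * g t\<bar>"
      using abs_triangle_ineq4 by metis
    have gt: "\<bar>exp (- t) ^ Suc k * g t\<bar> \<le> B * exp (- t) ^ Suc k"
      using mult_right_mono[OF B[of t], of "exp (- t) ^ Suc k"] by (simp add: abs_mult mult.commute)
    have "\<bar>\<integral>s. ?K s * (g s - g t) \<partial>?M\<bar> \<le> (\<integral>s. ?K s * (r / 2) + 2 * B * w \<partial>?M)"
    proof (rule order_trans[OF integral_abs_bound], rule integral_mono)
      show "integrable ?M (\<lambda>s. \<bar>?K s * (g s - g t)\<bar>)" by (rule integrable_abs[OF i])
      show "integrable ?M (\<lambda>s. ?K s * (r / 2) + 2 * B * w)" using Ki by simp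
    qed (rule pt)
    also have "\<dots> = (1 - exp (- t) ^ Suc k) * (r / 2) + 2 * B * m * w"
      using Ki K1 by (simp add: m_def)
    also have "\<dots> \<le> r / 2 + 2 * B * m * w"
      using \<open>0 < r\<close> mult_right_mono[of "1 - exp (- t) ^ Suc k" 1 "r / 2"] by simp
    finally show ?thesis
      using N[OF that] split gt unfolding w_def[symmetric] by linarith
  qed
  then show "\<exists>N. \<forall>k\<ge>N. norm ((\<integral>s. exp_kernel (1 / Suc k) t s * g s \<partial>?M) - g t) < r" by blast
qed

lemma regularizes_continuous:
  fixes g :: "real \<Rightarrow> real" and c :: "'v::{banach, second_countable_topology}"
  assumes g: "continuous_on UNIV g" and B: "\<And>s. \<bar>g s\<bar> \<le> B"
  shows "regularizes T (\<lambda>t. g t *\<^sub>R c)"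
proof -
  let ?M = "time_measure T"
  have B0: "0 \<le> B" using B[of 0] by linarith
  have gm[measurable]: "g \<in> borel_measurable ?M"
    by (rule borel_measurable_time[OF borel_measurable_continuous_onI[OF g]])
  have bd: "norm (g t *\<^sub>R c) \<le> 1 * norm (B *\<^sub>R c)" for t
    using B[of t] B0 by (simp add: mult_right_mono)
  have L: "(\<lambda>t. g t *\<^sub>R c) \<in> L2 T"
    by (rule L2_bounded_by[OF _ L2_const[of "B *\<^sub>R c"], where C=1])
      (use bd in \<open>auto simp: strongly_measurable_iff_borel\<close>)
  have eq: "regularize T (1 / Suc k) 0 (\<lambda>t. g t *\<^sub>R c) t = (\<integral>s. exp_kernel (1 / Suc k) t s * g s \<partial>?M) *\<^sub>R c" for k t
  proof -
    have "integrable ?M (\<lambda>s. exp_kernel (1 / Suc k) t s *\<^sub>R g s)"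
    proof (rule exp_kernel_scaleR_integrable)
      show "g \<in> L2 T"
        by (rule L2_bounded_by[OF _ L2_const[of B], where C=1]) (use B B0 in \<open>auto simp: strongly_measurable_iff_borel\<close>)
    qed simp
    then show ?thesis by (simp add: regularize_def)
  qed
  have "L2_tendsto T (\<lambda>k. regularize T (1 / Suc k) 0 (\<lambda>t. g t *\<^sub>R c)) (\<lambda>t. g t *\<^sub>R c)"
  proof (rule L2_tendsto_dominated[OF regularize_L2(1)[OF _ L] L L2_const[of "(2 * B) *\<^sub>R c"]])
    show "AE t in ?M. (\<lambda>k. regularize T (1 / Suc k) 0 (\<lambda>t. g t *\<^sub>R c) t) \<longlonglongrightarrow> g t *\<^sub>R c"
    proof (rule AE_I2)
      fix t assume "t \<in> space ?M"
      then have t: "t \<in> {0<..<T}" by simp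
      show "(\<lambda>k. regularize T (1 / Suc k) 0 (\<lambda>t. g t *\<^sub>R c) t) \<longlonglongrightarrow> g t *\<^sub>R c"
        unfolding eq by (intro tendsto_scaleR tendsto_const exp_kernel_approx_identity[OF g B t])
    qed
    show "AE t in ?M. norm (regularize T (1 / Suc k) 0 (\<lambda>t. g t *\<^sub>R c) t - g t *\<^sub>R c) \<le> norm ((2 * B) *\<^sub>R c)" for k
    proof (rule AE_I2)
      fix t assume "t \<in> space ?M"
      then have t: "t \<in> {0<..<T}" by simp
      have e: "0 < 1 / real (Suc k)" by simp
      note K0 = exp_kernel_nonneg[OF e, of t]
      have "\<bar>\<integral>s. exp_kernel (1 / Suc k) t s * g s \<partial>?M\<bar> \<le> (\<integral>s. exp_kernel (1 / Suc k) t s * B \<partial>?M)"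
      proof (rule order_trans[OF integral_abs_bound], rule integral_mono')
        show "integrable ?M (\<lambda>s. exp_kernel (1 / Suc k) t s * B)"
          using exp_kernel_integrable_right[OF e] by simp
        show "\<bar>exp_kernel (1 / Suc k) t s * g s\<bar> \<le> exp_kernel (1 / Suc k) t s * B" for s
          unfolding abs_mult abs_of_nonneg[OF K0] by (rule mult_left_mono[OF B K0])
        show "0 \<le> exp_kernel (1 / Suc k) t s * B" for s
          by (rule mult_nonneg_nonneg[OF K0 B0])
      qed
      also have "\<dots> = (1 - exp (- t / (1 / Suc k))) * B"
        using exp_kernel_integral_right[OF e, of t T] t by simp
      also have "\<dots> \<le> 1 * B" by (rule mult_right_mono[OF _ B0]) simp
      finally have "\<bar>(\<integral>s. exp_kernel (1 / Suc k) t s * g s \<partial>?M) - g t\<bar> \<le> \<bar>2 * B\<bar>"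
        using B[of t] by linarith
      then show "norm (regularize T (1 / Suc k) 0 (\<lambda>t. g t *\<^sub>R c) t - g t *\<^sub>R c) \<le> norm ((2 * B) *\<^sub>R c)"
        unfolding eq scaleR_diff_left[symmetric] norm_scaleR by (rule mult_right_mono) simp
    qed
  qed simp
  with L show ?thesis by (simp add: regularizes_def)
qed

lemma regularizes_indicator:
  fixes c :: "'v::{banach, second_countable_topology}"
  assumes A: "A \<in> sets lebesgue"
  shows "regularizes T (\<lambda>t. indicator A t *\<^sub>R c)"
proof -
  let ?M = "time_measure T"
  have iA: "indicat_real A \<in> borel_measurable lebesgue" using A by simp
  have "indicat_real A measurable_on UNIV"
    by (rule lebesgue_measurable_imp_measurable_on[OF iA]) simp
  then obtain N g where N: "negligible N" and g: "\<And>n::nat. continuous_on UNIV (g n)"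
    and lim: "\<And>t. t \<notin> N \<Longrightarrow> (\<lambda>n. g n t) \<longlonglongrightarrow> indicat_real A t"
    unfolding measurable_on_def by auto
  \<comment> \<open>Clipping to \<open>[0, 1]\<close> leaves the limit unchanged, as indicators take
    values there, and makes the convergence dominated.\<close>
  define q where "q n t = max 0 (min 1 (g n t))" for n t
  have q: "continuous_on UNIV (q n)" for n
    unfolding q_def by (intro continuous_intros g)
  have q1: "\<bar>q n t\<bar> \<le> 1" for n t by (simp add: q_def)
  have R: "regularizes T (\<lambda>t. q n t *\<^sub>R c)" for n by (rule regularizes_continuous[OF q q1])
  have "AE t in lebesgue. t \<notin> N"
    using N by (intro AE_not_in) (simp add: negligible_iff_null_sets)
  then have AEN: "AE t in ?M. t \<notin> N" by (subst AE_restrict_space_iff) (auto elim: eventually_mono)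
  have m: "indicat_real A \<in> borel_measurable ?M" by (rule measurable_restrict_space1[OF iA])
  have L: "(\<lambda>t. indicat_real A t *\<^sub>R c) \<in> L2 T"
  proof (rule L2_bounded_by[OF _ L2_const[of c], where C=1])
    show "strongly_measurable (time_measure T) (\<lambda>t. indicat_real A t *\<^sub>R c)"
      unfolding strongly_measurable_iff_borel using m by measurable
  qed (auto simp: indicator_def)
  have "L2_tendsto T (\<lambda>n t. q n t *\<^sub>R c) (\<lambda>t. indicator A t *\<^sub>R c)"
  proof (rule L2_tendsto_dominated[OF _ L L2_const[of c]])
    show "(\<lambda>t. q n t *\<^sub>R c) \<in> L2 T" for n using R by (simp add: regularizes_def)
    show "AE t in ?M. (\<lambda>n. q n t *\<^sub>R c) \<longlonglongrightarrow> indicator A t *\<^sub>R c"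
      using AEN
    proof eventually_elim
      case (elim t)
      have "(\<lambda>n. q n t) \<longlonglongrightarrow> max 0 (min 1 (indicat_real A t))"
        unfolding q_def by (intro tendsto_intros lim[OF elim])
      then have "(\<lambda>n. q n t) \<longlonglongrightarrow> indicat_real A t" by (simp add: indicator_def split: if_splits)
      then show ?case by (intro tendsto_intros)
    qed
    have "\<bar>q n t - indicator A t\<bar> \<le> 1" for n t by (auto simp: q_def indicator_def)
    then have "norm (q n t *\<^sub>R c - indicator A t *\<^sub>R c) \<le> norm c" for n t
      unfolding scaleR_diff_left[symmetric] norm_scaleR by (intro mult_left_le_one_le) auto
    then show "AE t in ?M. norm (q n t *\<^sub>R c - indicator A t *\<^sub>R c) \<le> norm c" for n by simp
  qed
  then show ?thesis by (rule regularizes_limit[OF R L])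
qed

lemma simple_function_time_representation:
  fixes s :: "real \<Rightarrow> 'v::real_vector"
  assumes s: "simple_function (time_measure T) s" and t: "t \<in> {0<..<T}"
  shows "s t = (\<Sum>y\<in>s ` {0<..<T}. indicator (s -` {y} \<inter> {0<..<T}) t *\<^sub>R y)"
proof -
  have fin: "finite (s ` {0<..<T})" using simple_functionD(1)[OF s] by simp
  have "(\<Sum>y\<in>s ` {0<..<T}. indicator (s -` {y} \<inter> {0<..<T}) t *\<^sub>R y)
      = (\<Sum>y\<in>s ` {0<..<T}. if y = s t then y else 0)"
    by (rule sum.cong) (use t in \<open>auto simp: indicator_def\<close>)
  also have "\<dots> = s t" using t fin by simp
  finally show ?thesis by simp
qed

text \<open>Finite sums of scaled indicators cover the simple functions, and these are dense in
  \<open>L2\<close>.\<close>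

lemma L2_regularizes:
  fixes h :: "real \<Rightarrow> 'v::{banach, second_countable_topology}"
  assumes h: "h \<in> L2 T" shows "regularizes T h"
proof -
  have simple: "regularizes T s" if s: "simple_function (time_measure T) s" for s :: "real \<Rightarrow> 'v"
  proof -
    have "regularizes T (\<lambda>t. \<Sum>y\<in>s ` {0<..<T}. indicator (s -` {y} \<inter> {0<..<T}) t *\<^sub>R y)" (is "regularizes T ?s")
    proof (rule regularizes_sum)
      show "finite (s ` {0<..<T})" using simple_functionD(1)[OF s] by simp
      fix y
      have "s -` {y} \<inter> {0<..<T} \<in> sets (time_measure T)"
        using simple_functionD(2)[OF s, of "{y}"] by simp
      then have "s -` {y} \<inter> {0<..<T} \<in> sets lebesgue"
        by (simp add: sets_restrict_space_iff)
      then show "regularizes T (\<lambda>t. indicator (s -` {y} \<inter> {0<..<T}) t *\<^sub>R y)"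
        by (rule regularizes_indicator)
    qed
    then show ?thesis
      by (rule regularizes_cong) (rule simple_function_time_representation[OF s, symmetric])
  qed
  have "h \<in> L2_in T UNIV" using h by (simp add: L2_in_def)
  then obtain s :: "nat \<Rightarrow> real \<Rightarrow> 'v" where s: "\<And>i. simple_function (time_measure T) (s i)" and lim: "L2_tendsto T s h"
    by (rule L2_in_simple_approx) (auto intro: that)
  show ?thesis by (rule regularizes_limit[OF simple[OF s] h lim])
qed

text \<open>The contribution of \<open>x0\<close> tends to 0 at each positive time and is dominated
  by the constant \<open>x0\<close>, so the starting value does not affect the limit.\<close>

lemma regularize_tendsto_self:
  fixes h :: "real \<Rightarrow> 'v::{banach, second_countable_topology}"
  assumes h: "h \<in> L2 T"
  shows "L2_tendsto T (\<lambda>k. regularize T (1 / Suc k) x0 h) h"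
proof -
  have e: "0 < 1 / real (Suc k)" for k by simp
  let ?x = "\<lambda>k t. exp (- t / (1 / real (Suc k))) *\<^sub>R x0"
  have x: "L2_tendsto T ?x (\<lambda>t. 0)"
  proof (rule L2_tendsto_dominated[OF exp_decay_L2(1)[OF e] L2_const L2_const[of x0]])
    show "AE t in time_measure T. (\<lambda>k. ?x k t) \<longlonglongrightarrow> 0"
    proof (rule AE_I2)
      fix t assume "t \<in> space (time_measure T)"
      then have "(\<lambda>k. exp (- t) ^ k) \<longlonglongrightarrow> 0" by (intro LIMSEQ_power_zero) simp
      then have "(\<lambda>k. exp (- t) ^ Suc k) \<longlonglongrightarrow> 0" by (rule LIMSEQ_Suc)
      then have "(\<lambda>k. exp (- t) ^ Suc k *\<^sub>R x0) \<longlonglongrightarrow> 0 *\<^sub>R x0" by (intro tendsto_intros)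
      then show "(\<lambda>k. ?x k t) \<longlonglongrightarrow> 0" unfolding exp_power_Suc by simp
    qed
    show "AE t in time_measure T. norm (?x k t - 0) \<le> norm x0" for k
      by (rule AE_I2) (simp add: mult_left_le_one_le)
  qed
  let ?E = "\<lambda>x0 k. L2_norm T (\<lambda>t. regularize T (1 / Suc k) x0 h t - h t)"
  show ?thesis
  proof (rule L2_tendstoI)
    fix k
    have "L2_norm T (\<lambda>t. ?x k t + (regularize T (1 / Suc k) 0 h t - h t)) \<le> L2_norm T (?x k) + ?E 0 k"
      by (rule L2_norm_triangle[OF exp_decay_L2(1)[OF e] L2_diff[OF regularize_L2(1)[OF e h] h]])
    then show "?E x0 k \<le> L2_norm T (?x k) + ?E 0 k"
      by (subst regularize_split[of T _ x0]) (simp only: add_diff_eq)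
  next
    have "(\<lambda>k. L2_norm T (?x k) + ?E 0 k) \<longlonglongrightarrow> 0 + 0"
      using x L2_regularizes[OF h] unfolding regularizes_def L2_tendsto_def by (intro tendsto_add) simp_all
    then show "(\<lambda>k. L2_norm T (?x k) + ?E 0 k) \<longlonglongrightarrow> 0" by simp
  qed
qed

subsection \<open>The regularization stays in convex sets\<close>

text \<open>For fixed \<open>t\<close> the right side is a constant plus a bounded functional of
  \<open>h\<close>, represented by the dual-valued function
  \<open>\<lambda>s. exp_kernel e t s *\<^sub>R \<phi>\<close>. Weak convergence in
  \<open>L2\<close> thus becomes weak convergence in \<open>V\<close> at every single time.\<close>

lemma regularize_functional:
  fixes h :: "real \<Rightarrow> 'v::{banach, second_countable_topology}" and \<phi> :: "'v \<Rightarrow>\<^sub>L real"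
  assumes e: "0 < e" and h: "h \<in> L2 T"
  shows "\<phi> (regularize T e x0 h t) = exp (- t / e) * \<phi> x0 + dual_integral T (\<lambda>s. exp_kernel e t s *\<^sub>R \<phi>) h"
proof -
  have "\<phi> (\<integral>s. exp_kernel e t s *\<^sub>R h s \<partial>time_measure T) = (\<integral>s. \<phi> (exp_kernel e t s *\<^sub>R h s) \<partial>time_measure T)"
    by (rule integral_bounded_linear[symmetric, OF blinfun.bounded_linear_right exp_kernel_scaleR_integrable[OF e h]])
  then show ?thesis
    by (simp add: regularize_def dual_integral_def blinfun.add_right blinfun.scaleR_right blinfun.scaleR_left)
qed

lemma exp_kernel_dual_L2:
  fixes \<phi> :: "'v::real_normed_vector \<Rightarrow>\<^sub>L real"
  assumes e: "0 < e"
  shows "(\<lambda>s. exp_kernel e t s *\<^sub>R \<phi>) \<in> L2 T"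
proof (rule L2_bounded_by[OF _ L2_const[of \<phi>], where C="1 / e"])
  show "strongly_measurable (time_measure T) (\<lambda>s. exp_kernel e t s *\<^sub>R \<phi>)"
    by (rule strongly_measurable_scaleR[OF _ strongly_measurable_const]) (simp add: strongly_measurable_iff_borel)
  have "norm (exp_kernel e t s *\<^sub>R \<phi>) \<le> 1 / e * norm \<phi>" for s
    using exp_kernel_le[OF e, of t s] exp_kernel_nonneg[OF e, of t s]
    by (simp only: norm_scaleR) (intro mult_right_mono, auto)
  then show "AE s in time_measure T. norm (exp_kernel e t s *\<^sub>R \<phi>) \<le> 1 / e * norm \<phi>" by simp
qed

text \<open>Crude in \<open>e\<close>, but valid at each \<open>t\<close>, so it turns
  \<open>L2\<close> approximation of \<open>h\<close> into convergence of the regularized values in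
  \<open>V\<close>.\<close>

lemma regularize_zero_pointwise:
  fixes h :: "real \<Rightarrow> 'v::{banach, second_countable_topology}"
  assumes e: "0 < e" and h: "h \<in> L2 T"
  shows "norm (regularize T e 0 h t) \<le> 1 / e * (L2_norm T (\<lambda>t. 1::real) * L2_norm T h)"
proof -
  let ?M = "time_measure T"
  have "norm (regularize T e 0 h t) \<le> (\<integral>s. 1 / e * norm (h s) \<partial>?M)"
    unfolding regularize_def scaleR_zero_right add_0_left
  proof (rule order_trans[OF integral_norm_bound], rule integral_mono)
    show "integrable ?M (\<lambda>s. norm (exp_kernel e t s *\<^sub>R h s))"
      by (rule integrable_norm[OF exp_kernel_scaleR_integrable[OF e h]])
    show "integrable ?M (\<lambda>s. 1 / e * norm (h s))" using L2_integrable[OF h] by simp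
    show "norm (exp_kernel e t s *\<^sub>R h s) \<le> 1 / e * norm (h s)" for s
      using exp_kernel_le[OF e, of t s] exp_kernel_nonneg[OF e, of t s]
      by (simp only: norm_scaleR) (intro mult_right_mono, auto)
  qed
  also have "\<dots> = 1 / e * (\<integral>s. 1 * norm (h s) \<partial>?M)" by simp
  also have "\<dots> \<le> 1 / e * (L2_norm T (\<lambda>t. 1::real) * L2_norm T h)"
  proof (rule mult_left_mono)
    show "(\<integral>s. 1 * norm (h s) \<partial>?M) \<le> L2_norm T (\<lambda>t. 1::real) * L2_norm T h"
      using L2_Cauchy_Schwarz[OF L2_const[of "1::real"] L2_realI[OF h]] by (simp add: L2_norm_norm)
  qed (use e in simp)
  finally show ?thesis .
qed

text \<open>For a simple function the integral is a finite sum of its values with weights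
  \<open>w y\<close>, which together with \<open>exp (- t / e)\<close> add up to 1: a convex
  combination of \<open>x0\<close> and values of \<open>s\<close>.\<close>

lemma regularize_simple_in_convex:
  fixes s :: "real \<Rightarrow> 'v::{banach, second_countable_topology}"
  assumes e: "0 < e" and s: "simple_function (time_measure T) s" and sC: "\<And>t. s t \<in> C"
    and C: "convex C" and x0: "x0 \<in> C" and t: "0 \<le> t" "t \<le> T"
  shows "regularize T e x0 s t \<in> C"
proof -
  let ?M = "time_measure T" and ?Y = "s ` {0<..<T}" and ?K = "exp_kernel e t"
  let ?A = "\<lambda>y. s -` {y} \<inter> {0<..<T}"
  define w where "w y = (\<integral>r. ?K r * indicator (?A y) r \<partial>?M)" for y
  have fin: "finite ?Y" using simple_functionD(1)[OF s] by simp
  have Am[measurable]: "?A y \<in> sets ?M" for y using simple_functionD(2)[OF s, of "{y}"] by simp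
  have int: "integrable ?M (\<lambda>r. ?K r * indicator (?A y) r)" for y
    by (rule integrable_real_mult_indicator[OF Am exp_kernel_integrable_right[OF e]])
  have "(\<integral>r. ?K r *\<^sub>R s r \<partial>?M) = (\<integral>r. (\<Sum>y\<in>?Y. (?K r * indicator (?A y) r) *\<^sub>R y) \<partial>?M)"
  proof (rule Bochner_Integration.integral_cong[OF refl])
    fix r assume "r \<in> space ?M"
    then have "r \<in> {0<..<T}" by simp
    then have "?K r *\<^sub>R s r = ?K r *\<^sub>R (\<Sum>y\<in>?Y. indicator (?A y) r *\<^sub>R y)"
      by (rule arg_cong[OF simple_function_time_representation[OF s]])
    also have "\<dots> = (\<Sum>y\<in>?Y. (?K r * indicator (?A y) r) *\<^sub>R y)"
      by (simp only: scaleR_sum_right scaleR_scaleR)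
    finally show "?K r *\<^sub>R s r = (\<Sum>y\<in>?Y. (?K r * indicator (?A y) r) *\<^sub>R y)" .
  qed
  also have "\<dots> = (\<Sum>y\<in>?Y. w y *\<^sub>R y)"
    unfolding w_def using int by (subst Bochner_Integration.integral_sum) (auto intro: integrable_scaleR_left)
  finally have rep: "regularize T e x0 s t = exp (- t / e) *\<^sub>R x0 + (\<Sum>y\<in>?Y. w y *\<^sub>R y)"
    by (simp add: regularize_def)
  have "(\<Sum>y\<in>?Y. w y) = (\<integral>r. (\<Sum>y\<in>?Y. ?K r * indicator (?A y) r) \<partial>?M)"
    unfolding w_def using int by (subst Bochner_Integration.integral_sum) auto
  also have "\<dots> = (\<integral>r. ?K r \<partial>?M)"
  proof (rule Bochner_Integration.integral_cong[OF refl])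
    fix r assume "r \<in> space ?M"
    then have r: "r \<in> {0<..<T}" by simp
    have "(\<Sum>y\<in>?Y. ?K r * indicator (?A y) r) = (\<Sum>y\<in>?Y. if y = s r then ?K r else 0)"
      by (rule sum.cong) (use r in \<open>auto simp: indicator_def\<close>)
    then show "(\<Sum>y\<in>?Y. ?K r * indicator (?A y) r) = ?K r" using r fin by simp
  qed
  also have "\<dots> = 1 - exp (- t / e)" by (rule exp_kernel_integral_right[OF e t])
  finally have total: "(\<Sum>y\<in>?Y. w y) = 1 - exp (- t / e)" .
  have w0: "0 \<le> w y" for y
    unfolding w_def using exp_kernel_nonneg[OF e] by (intro Bochner_Integration.integral_nonneg) auto
  \<comment> \<open>\<open>None\<close> is an extra index for \<open>x0\<close>, which may coincide
    with a value of \<open>s\<close>.\<close>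
  let ?I = "insert None (Some ` ?Y)"
  let ?a = "\<lambda>i. case i of None \<Rightarrow> exp (- t / e) | Some y \<Rightarrow> w y"
  let ?p = "\<lambda>i. case i of None \<Rightarrow> x0 | Some y \<Rightarrow> y"
  have "(\<Sum>i\<in>?I. ?a i *\<^sub>R ?p i) \<in> C"
  proof (rule convex_sum[OF _ C])
    show "(\<Sum>i\<in>?I. ?a i) = 1" using fin total by (simp add: sum.reindex)
    show "0 \<le> ?a i" for i using w0 by (simp split: option.split)
    show "?p i \<in> C" if "i \<in> ?I" for i using that x0 sC by auto
  qed (use fin in simp)
  then show ?thesis using fin by (simp add: rep sum.reindex)
qed

text \<open>Simple functions with values in \<open>C\<close> approximate \<open>h\<close>, and
  \<open>C\<close> is closed. The conclusion holds at every time in \<open>[0, T]\<close>, not only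
  almost everywhere, so Mosco convergence can be applied time by time.\<close>

lemma regularize_in_convex:
  fixes h :: "real \<Rightarrow> 'v::{banach, second_countable_topology}"
  assumes e: "0 < e" and h: "h \<in> L2_in T C" and C: "convex C" "closed C" and x0: "x0 \<in> C"
    and t: "0 \<le> t" "t \<le> T"
  shows "regularize T e x0 h t \<in> C"
proof -
  have hL: "h \<in> L2 T" using h by (simp add: L2_in_def)
  obtain s :: "nat \<Rightarrow> real \<Rightarrow> 'v" where s: "\<And>i. simple_function (time_measure T) (s i)"
    and sC: "\<And>i t. s i t \<in> C" and lim: "L2_tendsto T s h"
    by (rule L2_in_simple_approx[OF h]) (use x0 in \<open>auto intro: that\<close>)
  have "(\<lambda>i. regularize T e x0 (s i) t - regularize T e x0 h t) \<longlonglongrightarrow> 0"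
  proof (rule Lim_null_comparison)
    show "\<forall>\<^sub>F i in sequentially. norm (regularize T e x0 (s i) t - regularize T e x0 h t)
      \<le> 1 / e * (L2_norm T (\<lambda>t. 1::real) * L2_norm T (\<lambda>t. s i t - h t))"
      unfolding regularize_diff[OF e simple_function_L2[OF s] hL] diff_self
      by (intro always_eventually allI regularize_zero_pointwise[OF e L2_diff[OF simple_function_L2[OF s] hL]])
    show "(\<lambda>i. 1 / e * (L2_norm T (\<lambda>t. 1::real) * L2_norm T (\<lambda>t. s i t - h t))) \<longlonglongrightarrow> 0"
      using lim unfolding L2_tendsto_def by (intro tendsto_mult_right_zero)
  qed
  then have "(\<lambda>i. regularize T e x0 (s i) t) \<longlonglongrightarrow> regularize T e x0 h t" by (simp add: LIM_zero_iff)
  then show ?thesis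
    by (rule closed_sequentially[OF C(2) regularize_simple_in_convex[OF e s sC C(1) x0 t]])
qed

subsection \<open>The regularization as a test function\<close>

lemma strongly_measurable_bounded_linear:
  assumes L: "bounded_linear L" and f: "strongly_measurable M f"
  shows "strongly_measurable M (\<lambda>t. L (f t))"
  by (rule strongly_measurable_compose2[OF f f, of "\<lambda>x y. L x"])
    (intro bounded_linear.isCont[OF L] isCont_fst continuous_ident)

text \<open>\<open>L\<close> maps the simple functions that approximate \<open>f\<close> to simple
  functions that approximate its image. In this way integrals computed in \<open>V\<close> become
  integrals in the dual.\<close>

lemma has_vector_bochner_integral_linear:
  fixes f :: "real \<Rightarrow> 'v::{banach, second_countable_topology}"
  assumes L: "bounded_linear L" and f: "integrable (time_measure T) f"
  shows "has_vector_bochner_integral (time_measure T) (\<lambda>t. L (f t)) (L (\<integral>t. f t \<partial>time_measure T))"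
proof -
  let ?M = "time_measure T"
  interpret L: bounded_linear L by fact
  have fm[measurable]: "f \<in> borel_measurable ?M" using f by simp
  have "strongly_measurable ?M f" using fm by (simp add: strongly_measurable_iff_borel)
  then have m: "strongly_measurable ?M (\<lambda>t. L (f t))"
    by (rule strongly_measurable_bounded_linear[OF L])
  have "has_bochner_integral ?M f (\<integral>t. f t \<partial>?M)" using f by (rule has_bochner_integral_integrable)
  then obtain s where s: "\<And>i. Bochner_Integration.simple_bochner_integrable ?M (s i)"
    and lim: "(\<lambda>i. \<integral>\<^sup>+t. norm (f t - s i t) \<partial>?M) \<longlonglongrightarrow> 0"
    and I: "(\<lambda>i. Bochner_Integration.simple_bochner_integral ?M (s i)) \<longlonglongrightarrow> (\<integral>t. f t \<partial>?M)"
    by (rule has_bochner_integral.cases) (rule that)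
  have [measurable]: "s i \<in> borel_measurable ?M" for i
    using s[of i] by (auto intro: borel_measurable_simple_function elim: Bochner_Integration.simple_bochner_integrable.cases)
  obtain B where B: "0 < B" "\<And>x. norm (L x) \<le> norm x * B"
    using L.pos_bounded by blast
  have "Bochner_Integration.simple_bochner_integrable ?M (\<lambda>t. L (s i t))" for i
    by (rule Bochner_Integration.simple_bochner_integrable_compose2[where p="\<lambda>x y. L x", OF _ s s]) (simp add: L.zero)
  moreover have "(\<lambda>i. \<integral>\<^sup>+t. norm (L (f t) - L (s i t)) \<partial>?M) \<longlonglongrightarrow> 0"
  proof (rule tendsto_sandwich[OF always_eventually always_eventually])
    show "\<forall>i. 0 \<le> (\<integral>\<^sup>+t. norm (L (f t) - L (s i t)) \<partial>?M)" by simp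
    show "\<forall>i. (\<integral>\<^sup>+t. norm (L (f t) - L (s i t)) \<partial>?M) \<le> ennreal B * (\<integral>\<^sup>+t. norm (f t - s i t) \<partial>?M)"
    proof
      fix i
      have "(\<integral>\<^sup>+t. norm (L (f t) - L (s i t)) \<partial>?M) \<le> (\<integral>\<^sup>+t. ennreal B * norm (f t - s i t) \<partial>?M)"
        using B by (intro nn_integral_mono) (auto simp: ennreal_mult[symmetric] L.diff[symmetric] mult.commute intro!: ennreal_leI)
      also have "\<dots> = ennreal B * (\<integral>\<^sup>+t. norm (f t - s i t) \<partial>?M)"
        by (rule nn_integral_cmult) measurable
      finally show "(\<integral>\<^sup>+t. norm (L (f t) - L (s i t)) \<partial>?M) \<le> ennreal B * (\<integral>\<^sup>+t. norm (f t - s i t) \<partial>?M)" .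
    qed
    show "(\<lambda>i. ennreal B * (\<integral>\<^sup>+t. norm (f t - s i t) \<partial>?M)) \<longlonglongrightarrow> 0"
      using ennreal_tendsto_cmult[OF _ lim, of "ennreal B"] by simp
  qed simp
  moreover have "(\<lambda>i. Bochner_Integration.simple_bochner_integral ?M (\<lambda>t. L (s i t))) \<longlonglongrightarrow> L (\<integral>t. f t \<partial>?M)"
    unfolding Bochner_Integration.simple_bochner_integral_linear[OF L.linear_axioms s]
    by (rule L.tendsto[OF I])
  ultimately show ?thesis
    unfolding has_vector_bochner_integral_def using m
    by (intro conjI exI[of _ "\<lambda>i t. L (s i t)"]) auto
qed

text \<open>The derivative as read off from \<open>e v' + v = h\<close>. It has values in
  \<open>V\<close>, so its pairing with elements of \<open>V\<close> is an inner product in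
  \<open>H\<close>.\<close>

definition regularize_deriv :: "real \<Rightarrow> real \<Rightarrow> 'v::{banach, second_countable_topology} \<Rightarrow> (real \<Rightarrow> 'v) \<Rightarrow> real \<Rightarrow> 'v" where
  "regularize_deriv T e x0 h t = (1 / e) *\<^sub>R (h t - regularize T e x0 h t)"

lemma regularize_deriv_L2:
  assumes "0 < e" "h \<in> L2 T" shows "regularize_deriv T e x0 h \<in> L2 T"
  unfolding regularize_deriv_def[abs_def]
  by (intro L2_scaleR L2_diff assms regularize_L2(1))

lemma continuous_mult_L2_integrable:
  fixes h :: "real \<Rightarrow> 'v::{banach, second_countable_topology}"
  assumes g: "continuous_on UNIV g" and h: "h \<in> L2 T"
  shows "integrable (time_measure T) (\<lambda>t. g t *\<^sub>R h t)"
proof -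
  have "compact (g ` {0..T})"
    by (rule compact_continuous_image[OF continuous_on_subset[OF g] compact_Icc]) simp
  then obtain B where B: "\<And>t. t \<in> {0..T} \<Longrightarrow> norm (g t) \<le> B"
    using compact_imp_bounded bounded_iff by (metis imageI)
  have gm: "g \<in> borel_measurable (time_measure T)"
    by (rule borel_measurable_time[OF borel_measurable_continuous_onI[OF g]])
  show ?thesis
  proof (rule Bochner_Integration.integrable_bound)
    show "integrable (time_measure T) (\<lambda>t. B *\<^sub>R h t)" using L2_integrable[OF h] by simp
    show "(\<lambda>t. g t *\<^sub>R h t) \<in> borel_measurable (time_measure T)"
      using gm L2_borel_measurable[OF h] by measurable
    have "norm (g t *\<^sub>R h t) \<le> norm (B *\<^sub>R h t)" if "t \<in> space (time_measure T)" for t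
      unfolding norm_scaleR using B[of t] that by (intro mult_right_mono) auto
    then show "AE t in time_measure T. norm (g t *\<^sub>R h t) \<le> norm (B *\<^sub>R h t)" by (rule AE_I2)
  qed
qed

text \<open>After the jump at \<open>s\<close> the integrand is the derivative of
  \<open>\<phi> t * (exp ((s - t) / e) / e)\<close>; the boundary value at \<open>T\<close> drops
  out because \<open>\<phi> T = 0\<close>.\<close>

lemma exp_kernel_integral_by_parts:
  fixes \<phi> \<phi>' :: "real \<Rightarrow> real"
  assumes e: "0 < e" and \<phi>: "\<And>t. (\<phi> has_real_derivative \<phi>' t) (at t)" and c: "continuous_on UNIV \<phi>'"
    and T: "\<phi> T = 0" and s: "0 \<le> s" "s \<le> T"
  shows "(\<integral>t. (\<phi>' t - \<phi> t / e) * exp_kernel e t s \<partial>time_measure T) = - \<phi> s / e"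
proof -
  have c0: "continuous_on UNIV \<phi>"
    using \<phi> by (meson DERIV_continuous continuous_at_imp_continuous_on)
  have [measurable]: "\<phi> \<in> borel_measurable borel" "\<phi>' \<in> borel_measurable borel"
    using c c0 by (auto intro: borel_measurable_continuous_onI)
  let ?g = "\<lambda>t. (\<phi>' t - \<phi> t / e) * (exp ((s - t) / e) / e)"
  let ?F = "\<lambda>t. \<phi> t * (exp ((s - t) / e) / e)"
  define q where "q t = (if T < t then 0 else (\<phi>' t - \<phi> t / e) * exp_kernel e t s)" for t
  have "(\<integral>t. (\<phi>' t - \<phi> t / e) * exp_kernel e t s \<partial>time_measure T) = (\<integral>t. q t \<partial>time_measure T)"
    by (rule Bochner_Integration.integral_cong) (auto simp: q_def)
  also have "\<dots> = ?F T - ?F s"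
  proof (rule time_integral_FTC[where g="?g" and a=s and b=T])
    show "q \<in> borel_measurable (time_measure T)"
      unfolding q_def by (rule borel_measurable_time) measurable
    show "(?F has_real_derivative ?g t) (at t)" for t
      using e by (auto intro!: derivative_eq_intros \<phi> simp: field_simps power2_eq_square)
    show "continuous_on UNIV ?g"
      using e by (intro continuous_intros c c0) auto
  qed (use s in \<open>auto simp: q_def exp_kernel_def\<close>)
  finally show ?thesis using T by simp
qed

text \<open>The counterpart for the weight of \<open>x0\<close>, which solves the homogeneous
  equation \<open>e v' + v = 0\<close>; both boundary values vanish.\<close>

lemma exp_decay_integral_by_parts:
  fixes \<phi> \<phi>' :: "real \<Rightarrow> real"
  assumes e: "0 < e" and \<phi>: "\<And>t. (\<phi> has_real_derivative \<phi>' t) (at t)" and c: "continuous_on UNIV \<phi>'"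
    and T: "0 \<le> T" "\<phi> T = 0" "\<phi> 0 = 0"
  shows "(\<integral>t. (\<phi>' t - \<phi> t / e) * exp (- t / e) \<partial>time_measure T) = 0"
proof -
  have c0: "continuous_on UNIV \<phi>"
    using \<phi> by (meson DERIV_continuous continuous_at_imp_continuous_on)
  have [measurable]: "\<phi> \<in> borel_measurable borel" "\<phi>' \<in> borel_measurable borel"
    using c c0 by (auto intro: borel_measurable_continuous_onI)
  let ?g = "\<lambda>t. (\<phi>' t - \<phi> t / e) * exp (- t / e)"
  let ?F = "\<lambda>t. \<phi> t * exp (- t / e)"
  define q where "q t = (if t < 0 \<or> T < t then 0 else ?g t)" for t
  have "(\<integral>t. ?g t \<partial>time_measure T) = (\<integral>t. q t \<partial>time_measure T)"
    by (rule Bochner_Integration.integral_cong) (auto simp: q_def)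
  also have "\<dots> = ?F T - ?F 0"
  proof (rule time_integral_FTC[where g="?g" and a=0 and b=T])
    show "q \<in> borel_measurable (time_measure T)"
      unfolding q_def by (rule borel_measurable_time) measurable
    show "(?F has_real_derivative ?g t) (at t)" for t
      using e by (auto intro!: derivative_eq_intros \<phi> simp: field_simps)
    show "continuous_on UNIV ?g"
      using e by (intro continuous_intros c c0) auto
  qed (use T in \<open>auto simp: q_def\<close>)
  finally show ?thesis using T by simp
qed

text \<open>By duality: integrated against the kernel, \<open>\<phi>' - \<phi> / e\<close> returns
  \<open>- \<phi> / e\<close>, so Fubini's theorem turns its integral against the regularization
  \<open>v\<close> into \<open>- 1 / e\<close> times the integral of \<open>\<phi> h\<close>. Moving
  the term with \<open>\<phi> / e\<close> to the other side leaves
  \<open>(h - v) / e\<close>.\<close>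

lemma regularize_integral_by_parts:
  fixes \<phi> \<phi>' :: "real \<Rightarrow> real" and h :: "real \<Rightarrow> 'v::{banach, second_countable_topology}"
  assumes e: "0 < e" and \<phi>: "\<And>t. (\<phi> has_real_derivative \<phi>' t) (at t)" and c: "continuous_on UNIV \<phi>'"
    and T: "0 \<le> T" "\<phi> T = 0" "\<phi> 0 = 0" and h: "h \<in> L2 T"
  shows "(\<integral>t. \<phi>' t *\<^sub>R regularize T e x0 h t \<partial>time_measure T)
    = - (\<integral>t. \<phi> t *\<^sub>R regularize_deriv T e x0 h t \<partial>time_measure T)"
proof -
  let ?M = "time_measure T" and ?R = "regularize T e x0 h"
  interpret P: pair_sigma_finite ?M ?M by unfold_locales
  define \<psi> where "\<psi> t = \<phi>' t - \<phi> t / e" for t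
  have c0: "continuous_on UNIV \<phi>"
    using \<phi> by (meson DERIV_continuous continuous_at_imp_continuous_on)
  have cpsi: "continuous_on UNIV \<psi>"
    unfolding \<psi>_def using e by (intro continuous_intros c c0) auto
  have cE: "continuous_on UNIV (\<lambda>t. \<psi> t * exp (- t / e))"
    using e by (intro continuous_intros cpsi) auto
  have [measurable]: "\<psi> \<in> borel_measurable ?M"
    by (rule borel_measurable_time[OF borel_measurable_continuous_onI[OF cpsi]])
  have [measurable]: "h \<in> borel_measurable ?M" by (rule L2_borel_measurable[OF h])
  have RL: "?R \<in> L2 T" by (rule regularize_L2(1)[OF e h])
  let ?f = "\<lambda>t s. (\<psi> t * exp_kernel e t s) *\<^sub>R h s"
  \<comment> \<open>Fubini's theorem needs absolute integrability, which follows from the kernel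
    bound \<open>1 / e\<close> and the continuity of \<open>\<psi>\<close>.\<close>
  have fint: "integrable (?M \<Otimes>\<^sub>M ?M) (case_prod ?f)"
  proof (rule P.Fubini_integrable)
    show "case_prod ?f \<in> borel_measurable (?M \<Otimes>\<^sub>M ?M)"
      unfolding split_beta' by measurable
    have i: "integrable ?M (\<lambda>s. exp_kernel e t s *\<^sub>R h s)" for t
      by (rule exp_kernel_scaleR_integrable[OF e h])
    show "AE t in ?M. integrable ?M (\<lambda>s. case_prod ?f (t, s))"
      using i by (simp flip: scaleR_scaleR)
    show "integrable ?M (\<lambda>t. \<integral>s. norm (case_prod ?f (t, s)) \<partial>?M)"
    proof (rule Bochner_Integration.integrable_bound)
      show "integrable ?M (\<lambda>t. \<psi> t *\<^sub>R (\<integral>s. 1 / e * norm (h s) \<partial>?M))"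
        by (rule continuous_mult_L2_integrable[OF cpsi L2_const])
      show "(\<lambda>t. \<integral>s. norm (case_prod ?f (t, s)) \<partial>?M) \<in> borel_measurable ?M"
        unfolding split_beta' by measurable
      show "AE t in ?M. norm (\<integral>s. norm (case_prod ?f (t, s)) \<partial>?M) \<le> norm (\<psi> t *\<^sub>R (\<integral>s. 1 / e * norm (h s) \<partial>?M))"
      proof (rule AE_I2)
        fix t
        have "(\<integral>s. norm (exp_kernel e t s *\<^sub>R h s) \<partial>?M) \<le> (\<integral>s. 1 / e * norm (h s) \<partial>?M)"
        proof (rule integral_mono)
          show "integrable ?M (\<lambda>s. norm (exp_kernel e t s *\<^sub>R h s))" by (rule integrable_norm[OF i])
          show "integrable ?M (\<lambda>s. 1 / e * norm (h s))" using L2_integrable[OF h] by simp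
          show "norm (exp_kernel e t s *\<^sub>R h s) \<le> 1 / e * norm (h s)" for s
            using exp_kernel_le[OF e, of t s] exp_kernel_nonneg[OF e, of t s]
            by (simp only: norm_scaleR) (intro mult_right_mono, auto)
        qed
        then have "\<bar>\<psi> t\<bar> * (\<integral>s. norm (exp_kernel e t s *\<^sub>R h s) \<partial>?M) \<le> \<bar>\<psi> t\<bar> * (\<integral>s. 1 / e * norm (h s) \<partial>?M)"
          by (rule mult_left_mono) simp
        moreover have J: "(\<integral>s. norm (case_prod ?f (t, s)) \<partial>?M) = \<bar>\<psi> t\<bar> * (\<integral>s. norm (exp_kernel e t s *\<^sub>R h s) \<partial>?M)"
          by (simp add: abs_mult mult.assoc)
        moreover have I0: "0 \<le> (\<integral>s. 1 / e * norm (h s) \<partial>?M)" "0 \<le> (\<integral>s. norm (case_prod ?f (t, s)) \<partial>?M)"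
          using e by (intro Bochner_Integration.integral_nonneg; simp)+
        ultimately show "norm (\<integral>s. norm (case_prod ?f (t, s)) \<partial>?M) \<le> norm (\<psi> t *\<^sub>R (\<integral>s. 1 / e * norm (h s) \<partial>?M))"
          unfolding real_norm_def real_scaleR_def abs_mult abs_of_nonneg[OF I0(1)] abs_of_nonneg[OF I0(2)] by linarith
      qed
    qed
  qed
  have "(\<integral>t. \<psi> t *\<^sub>R ?R t \<partial>?M)
      = (\<integral>t. (\<psi> t * exp (- t / e)) *\<^sub>R x0 + (\<integral>s. ?f t s \<partial>?M) \<partial>?M)"
    by (simp add: regularize_def scaleR_add_right flip: scaleR_scaleR)
  also have "\<dots> = (\<integral>t. (\<psi> t * exp (- t / e)) *\<^sub>R x0 \<partial>?M) + (\<integral>t. (\<integral>s. ?f t s \<partial>?M) \<partial>?M)"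
  proof (rule Bochner_Integration.integral_add)
    show "integrable ?M (\<lambda>t. (\<psi> t * exp (- t / e)) *\<^sub>R x0)"
      by (rule continuous_mult_L2_integrable[OF cE L2_const])
    show "integrable ?M (\<lambda>t. \<integral>s. ?f t s \<partial>?M)"
      using P.integrable_fst'[OF fint] by simp
  qed
  also have "(\<integral>t. (\<psi> t * exp (- t / e)) *\<^sub>R x0 \<partial>?M) = 0"
  proof -
    have "integrable ?M (\<lambda>t. \<psi> t * exp (- t / e))"
      using continuous_mult_L2_integrable[OF cE L2_const[of "1::real" T]] by simp
    then show ?thesis
      using exp_decay_integral_by_parts[OF e \<phi> c T] by (simp add: \<psi>_def)
  qed
  also have "(\<integral>t. (\<integral>s. ?f t s \<partial>?M) \<partial>?M) = (\<integral>s. (\<integral>t. ?f t s \<partial>?M) \<partial>?M)"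
    by (rule P.Fubini_integral[symmetric, OF fint])
  also have "\<dots> = (\<integral>s. - ((1 / e) *\<^sub>R (\<phi> s *\<^sub>R h s)) \<partial>?M)"
  proof (rule Bochner_Integration.integral_cong[OF refl])
    fix s assume "s \<in> space ?M"
    then have s: "0 \<le> s" "s \<le> T" by auto
    have "integrable ?M (\<lambda>t. \<psi> t * exp_kernel e t s)"
    proof (rule Bochner_Integration.integrable_bound)
      show "integrable ?M (\<lambda>t. \<psi> t *\<^sub>R (1 / e))" by (rule continuous_mult_L2_integrable[OF cpsi L2_const])
      show "AE t in ?M. norm (\<psi> t * exp_kernel e t s) \<le> norm (\<psi> t *\<^sub>R (1 / e))"
        using exp_kernel_le[OF e] exp_kernel_nonneg[OF e] e
        by (intro AE_I2) (simp add: abs_mult mult_left_mono abs_of_nonneg divide_inverse)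
    qed measurable
    then have "(\<integral>t. ?f t s \<partial>?M) = (- \<phi> s / e) *\<^sub>R h s"
      using exp_kernel_integral_by_parts[OF e \<phi> c T(2) s] by (simp add: \<psi>_def)
    then show "(\<integral>t. ?f t s \<partial>?M) = - ((1 / e) *\<^sub>R (\<phi> s *\<^sub>R h s))" by simp
  qed
  finally have main: "(\<integral>t. \<psi> t *\<^sub>R ?R t \<partial>?M) = - (\<integral>s. (1 / e) *\<^sub>R (\<phi> s *\<^sub>R h s) \<partial>?M)" by simp
  note iR = continuous_mult_L2_integrable[OF c RL] continuous_mult_L2_integrable[OF c0 RL] continuous_mult_L2_integrable[OF c0 h]
  have "(\<integral>t. \<psi> t *\<^sub>R ?R t \<partial>?M) = (\<integral>t. \<phi>' t *\<^sub>R ?R t - (1 / e) *\<^sub>R (\<phi> t *\<^sub>R ?R t) \<partial>?M)"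
    by (simp add: \<psi>_def scaleR_diff_left)
  also have "\<dots> = (\<integral>t. \<phi>' t *\<^sub>R ?R t \<partial>?M) - (\<integral>t. (1 / e) *\<^sub>R (\<phi> t *\<^sub>R ?R t) \<partial>?M)"
    by (rule Bochner_Integration.integral_diff[OF iR(1) integrable_scaleR_right[OF iR(2)]])
  finally have "(\<integral>t. \<phi>' t *\<^sub>R ?R t \<partial>?M)
      = (\<integral>t. \<psi> t *\<^sub>R ?R t \<partial>?M) + (\<integral>t. (1 / e) *\<^sub>R (\<phi> t *\<^sub>R ?R t) \<partial>?M)"
    by (simp only: diff_add_cancel)
  moreover have "(\<integral>t. \<phi> t *\<^sub>R regularize_deriv T e x0 h t \<partial>?M)
      = (\<integral>t. (1 / e) *\<^sub>R (\<phi> t *\<^sub>R h t) - (1 / e) *\<^sub>R (\<phi> t *\<^sub>R ?R t) \<partial>?M)"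
    unfolding regularize_deriv_def by (intro Bochner_Integration.integral_cong refl) (simp add: scaleR_diff_right mult.commute)
  moreover have "\<dots> = (\<integral>t. (1 / e) *\<^sub>R (\<phi> t *\<^sub>R h t) \<partial>?M) - (\<integral>t. (1 / e) *\<^sub>R (\<phi> t *\<^sub>R ?R t) \<partial>?M)"
    by (rule Bochner_Integration.integral_diff[OF integrable_scaleR_right[OF iR(3)] integrable_scaleR_right[OF iR(2)]])
  ultimately show ?thesis using main by (simp only: minus_diff_eq uminus_add_conv_diff)
qed

lemma bounded_linear_pivot:
  "bounded_linear (\<lambda>x. pivot_to_dual j (blinfun_apply j x))"
proof (rule bounded_linear_intro)
  show "norm (pivot_to_dual j (blinfun_apply j x)) \<le> norm x * (norm j * norm j)" for x
  proof (rule norm_blinfun_bound)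
    fix v
    have "norm (blinfun_apply j x \<bullet> blinfun_apply j v) \<le> norm (blinfun_apply j x) * norm (blinfun_apply j v)"
      unfolding real_norm_def by (rule Cauchy_Schwarz_ineq2)
    also have "\<dots> \<le> (norm j * norm x) * (norm j * norm v)"
      by (intro mult_mono norm_blinfun) auto
    finally show "norm (blinfun_apply (pivot_to_dual j (blinfun_apply j x)) v) \<le> norm x * (norm j * norm j) * norm v"
      by (simp add: pivot_to_dual_apply ac_simps)
  qed simp
qed (auto intro!: blinfun_eqI simp: pivot_to_dual_apply blinfun.add_left blinfun.add_right
    blinfun.scaleR_left blinfun.scaleR_right inner_add_left)

lemma test_function_deriv:
  assumes "test_function T \<phi>"
  shows "\<And>t. (\<phi> has_real_derivative deriv \<phi> t) (at t)" "continuous_on UNIV (deriv \<phi>)" "\<phi> T = 0" "\<phi> 0 = 0"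
proof -
  have d: "(deriv ^^ k) \<phi> differentiable (at t)" for k t
    using assms by (simp add: test_function_def)
  obtain a b where ab: "0 < a" "b < T" "\<And>t. t \<notin> {a..b} \<Longrightarrow> \<phi> t = 0"
    using assms unfolding test_function_def by blast
  show "(\<phi> has_real_derivative deriv \<phi> t) (at t)" for t
    using d[of 0 t] by (simp add: DERIV_deriv_iff_real_differentiable)
  show "continuous_on UNIV (deriv \<phi>)"
    using d[of 1] by (auto intro!: continuous_at_imp_continuous_on differentiable_imp_continuous_within)
  show "\<phi> T = 0" "\<phi> 0 = 0" using ab by auto
qed

text \<open>Both embeddings together form one bounded linear map from \<open>V\<close> to its dual,
  and it carries the integration by parts formula from \<open>V\<close> to the dual.\<close>

lemma regularize_W_graph:
  fixes j :: "'v::{banach, second_countable_topology} \<Rightarrow>\<^sub>L 'h::real_inner"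
  assumes e: "0 < e" and T: "0 \<le> T" and h: "h \<in> L2 T"
  shows "(regularize T e x0 h, \<lambda>t. pivot_to_dual j (j (regularize_deriv T e x0 h t))) \<in> W_graph T j"
proof -
  let ?R = "regularize T e x0 h" and ?D = "regularize_deriv T e x0 h"
  let ?L = "\<lambda>x. pivot_to_dual j (blinfun_apply j x)"
  interpret L: bounded_linear ?L by (rule bounded_linear_pivot)
  have R: "?R \<in> L2 T" by (rule regularize_L2(1)[OF e h])
  have D: "?D \<in> L2 T" by (rule regularize_deriv_L2[OF e h])
  obtain B where B: "\<And>x. norm (?L x) \<le> norm x * B" using L.bounded by blast
  have "(\<lambda>t. ?L (?D t)) \<in> L2 T"
  proof (rule L2_bounded_by[OF _ D])
    show "strongly_measurable (time_measure T) (\<lambda>t. ?L (?D t))"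
      by (rule strongly_measurable_bounded_linear[OF bounded_linear_pivot L2_strongly_measurable[OF D]])
    show "AE t in time_measure T. norm (?L (?D t)) \<le> B * norm (?D t)"
      using B by (simp add: mult.commute)
  qed
  moreover have "distributional_derivative T j ?R (\<lambda>t. ?L (?D t))"
    unfolding distributional_derivative_def
  proof (intro allI impI exI conjI)
    fix \<phi> assume "test_function T \<phi>"
    note \<phi> = test_function_deriv[OF this]
    have c0: "continuous_on UNIV \<phi>"
      using \<phi>(1) by (meson DERIV_continuous continuous_at_imp_continuous_on)
    show "has_vector_bochner_integral (time_measure T) (\<lambda>t. deriv \<phi> t *\<^sub>R ?L (?R t))
        (?L (\<integral>t. deriv \<phi> t *\<^sub>R ?R t \<partial>time_measure T))"
      using has_vector_bochner_integral_linear[OF L.bounded_linear_axioms continuous_mult_L2_integrable[OF \<phi>(2) R]]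
      by (simp only: L.scaleR)
    have "- ?L (\<integral>t. deriv \<phi> t *\<^sub>R ?R t \<partial>time_measure T) = ?L (\<integral>t. \<phi> t *\<^sub>R ?D t \<partial>time_measure T)"
      unfolding regularize_integral_by_parts[OF e \<phi>(1,2) T \<phi>(3,4) h] linear_neg[OF L.linear_axioms] by simp
    then show "has_vector_bochner_integral (time_measure T) (\<lambda>t. \<phi> t *\<^sub>R ?L (?D t))
        (- ?L (\<integral>t. deriv \<phi> t *\<^sub>R ?R t \<partial>time_measure T))"
      using has_vector_bochner_integral_linear[OF L.bounded_linear_axioms continuous_mult_L2_integrable[OF c0 D]]
      by (simp only: L.scaleR)
  qed
  ultimately show ?thesis using R by (simp add: W_graph_def)
qed

text \<open>The representative is an arbitrary choice among the continuous functions that agree with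
  the embedded regularization almost everywhere. Continuous functions that agree almost everywhere
  on \<open>(0, T)\<close> agree on \<open>[0, T]\<close>, which determines the value at 0.\<close>

lemma regularize_continuous_representative:
  fixes j :: "'v::{banach, second_countable_topology} \<Rightarrow>\<^sub>L 'h::real_inner"
  assumes e: "0 < e" and T: "0 < T" and h: "h \<in> L2 T"
  shows "continuous_representative T j (regularize T e x0 h) 0 = j x0"
proof -
  let ?d = "\<lambda>t. blinfun_apply j (regularize T e x0 h t)"
  let ?P = "\<lambda>c. continuous_on {0..T} c \<and> (AE t in time_measure T. c t = ?d t)"
  define c where "c = continuous_representative T j (regularize T e x0 h)"
  have d: "continuous_on {0..T} ?d"
    by (intro continuous_intros continuous_on_subset[OF regularize_continuous[OF e h]]) auto
  then have "?P (Eps ?P)" by (intro someI[of ?P ?d]) simp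
  then have c: "continuous_on {0..T} c" and eq: "AE t in time_measure T. c t = ?d t"
    unfolding c_def continuous_representative_def by blast+
  define S where "S = {t \<in> {0..T}. c t - ?d t = 0}"
  have "closed S"
    unfolding S_def by (rule continuous_closed_preimage_constant[OF continuous_on_diff[OF c d]]) simp
  have "AE t in lebesgue. t \<in> {0<..<T} \<longrightarrow> c t = ?d t"
    using eq by (subst (asm) AE_restrict_space_iff) auto
  then have "AE t \<in> {0<..<T} in lebesgue. t \<in> S"
    by eventually_elim (auto simp: S_def)
  then have "{0<..<T} \<subseteq> S"
    using mem_closed_if_AE_lebesgue_open[OF open_greaterThanLessThan \<open>closed S\<close>] by blast
  then have "closure {0<..<T} \<subseteq> S" using \<open>closed S\<close> by (rule closure_minimal)
  then have "0 \<in> S" using T by (auto simp: closure_greaterThanLessThan)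
  then show ?thesis by (simp add: S_def c_def regularize_at_0)
qed

text \<open>The time argument is a dummy that makes the inner product of \<open>H\<close> an
  instance of \<open>bounded_forms\<close>, so that the derivative term is handled like
  \<open>a\<close>.\<close>

abbreviation pivot_form :: "('v::real_normed_vector \<Rightarrow>\<^sub>L 'h::real_inner) \<Rightarrow> real \<Rightarrow> 'v \<Rightarrow> 'v \<Rightarrow> real" where
  "pivot_form j t u v \<equiv> blinfun_apply j u \<bullet> blinfun_apply j v"

lemma bounded_forms_pivot: "bounded_forms T (norm j * norm j) (pivot_form j)"
  unfolding bounded_forms_def bilinear_def
proof (intro conjI ballI allI)
  fix u v
  have "\<bar>blinfun_apply j u \<bullet> blinfun_apply j v\<bar> \<le> norm (blinfun_apply j u) * norm (blinfun_apply j v)"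
    by (rule Cauchy_Schwarz_ineq2)
  also have "\<dots> \<le> (norm j * norm u) * (norm j * norm v)"
    by (intro mult_mono norm_blinfun) auto
  finally show "\<bar>blinfun_apply j u \<bullet> blinfun_apply j v\<bar> \<le> norm j * norm j * norm u * norm v"
    by (simp add: ac_simps)
qed (auto intro!: linearI simp: blinfun.add_right blinfun.scaleR_right inner_add_left inner_add_right)

text \<open>The pairings with \<open>v - z\<close> are split by linearity, since limits are later
  taken term by term. The continuous representative at 0 has become \<open>j x0\<close>, so the
  initial term involves only \<open>x0\<close> and \<open>z0\<close>.\<close>

lemma weak_solution_regularize_test:
  fixes j :: "'v::{banach, second_countable_topology} \<Rightarrow>\<^sub>L 'h::{real_inner, banach, second_countable_topology}"
    and h z :: "real \<Rightarrow> 'v"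
  assumes T: "0 < T" and M: "0 \<le> M" and a: "coercive_forms T M \<alpha> a"
    and C: "convex C" "closed C" and g: "g \<in> L2 T" and z: "weak_solution T j a C g z0 z"
    and e: "0 < e" and h: "h \<in> L2_in T C" and x0: "x0 \<in> C"
  defines "v \<equiv> regularize T e x0 h" and "D \<equiv> regularize_deriv T e x0 h"
  shows "0 \<le> form_integral T (pivot_form j) D v - form_integral T (pivot_form j) D z
    + form_integral T a z v - form_integral T a z z - (dual_integral T g v - dual_integral T g z)
    + 1/2 * (norm (j x0 - j z0))\<^sup>2"
proof -
  let ?M = "time_measure T"
  note ab = coercive_forms_bounded[OF a] M
  have hL: "h \<in> L2 T" using h by (simp add: L2_in_def)
  have zL: "z \<in> L2 T" using z by (simp add: weak_solution_def L2_in_def)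
  have vL: "v \<in> L2 T" unfolding v_def by (rule regularize_L2(1)[OF e hL])
  have DL: "D \<in> L2 T" unfolding D_def by (rule regularize_deriv_L2[OF e hL])
  have dL: "(\<lambda>t. v t - z t) \<in> L2 T" by (rule L2_diff[OF vL zL])
  have "AE t in ?M. v t \<in> C"
    by (rule AE_I2) (use regularize_in_convex[OF e h C x0] in \<open>simp add: v_def\<close>)
  with vL have vC: "v \<in> L2_in T C" by (simp add: L2_in_def)
  have W: "(v, \<lambda>t. pivot_to_dual j (j (D t))) \<in> W_graph T j"
    unfolding v_def D_def by (rule regularize_W_graph[OF e less_imp_le[OF T] hL])
  have "0 \<le> (\<integral>t. pivot_to_dual j (j (D t)) (v t - z t) + form_operator (a t) (z t) (v t - z t) - g t (v t - z t) \<partial>?M)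
      + 1/2 * (norm (continuous_representative T j v 0 - j z0))\<^sup>2"
    using z W vC unfolding weak_solution_def by blast
  also have "continuous_representative T j v 0 = j x0"
    unfolding v_def by (rule regularize_continuous_representative[OF e T hL])
  also have "(\<integral>t. pivot_to_dual j (j (D t)) (v t - z t) + form_operator (a t) (z t) (v t - z t) - g t (v t - z t) \<partial>?M)
      = (\<integral>t. pivot_form j t (D t) (v t - z t) + a t (z t) (v t - z t) - g t (v t - z t) \<partial>?M)"
  proof (rule Bochner_Integration.integral_cong[OF refl])
    fix t assume "t \<in> space ?M"
    then have t: "t \<in> {0<..<T}" by simp
    have "form_operator (a t) (z t) (v t - z t) = a t (z t) (v t - z t)"
      by (rule form_operator_apply[of _ M]) (use a t in \<open>auto simp: coercive_forms_def\<close>)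
    then show "pivot_to_dual j (j (D t)) (v t - z t) + form_operator (a t) (z t) (v t - z t) - g t (v t - z t)
        = pivot_form j t (D t) (v t - z t) + a t (z t) (v t - z t) - g t (v t - z t)"
      by (simp add: pivot_to_dual_apply)
  qed
  also have "\<dots> = form_integral T (pivot_form j) D (\<lambda>t. v t - z t) + form_integral T a z (\<lambda>t. v t - z t)
      - dual_integral T g (\<lambda>t. v t - z t)"
    using form_integrable_and_bound(1)[OF bounded_forms_pivot[of T j] _ DL dL]
      form_integrable_and_bound(1)[OF ab zL dL] dual_integrable_and_bound(1)[OF g dL]
    by (simp add: form_integral_def dual_integral_def)
  also have "form_integral T (pivot_form j) D (\<lambda>t. v t - z t)
      = form_integral T (pivot_form j) D v - form_integral T (pivot_form j) D z"
    by (rule L2_functional_diff[OF form_integral_functional_right[OF bounded_forms_pivot _ DL] vL zL]) simp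
  also have "form_integral T a z (\<lambda>t. v t - z t) = form_integral T a z v - form_integral T a z z"
    by (rule L2_functional_diff[OF form_integral_functional_right[OF ab zL] vL zL])
  also have "dual_integral T g (\<lambda>t. v t - z t) = dual_integral T g v - dual_integral T g z"
    by (rule L2_functional_diff[OF dual_integral_functional[OF g] vL zL])
  finally show ?thesis by simp
qed

subsection \<open>Mosco convergence in L2\<close>

text \<open>A simple function has finitely many values on the interval, so the errors of the
  sequences \<open>\<sigma> y\<close> have a common bound and the pointwise convergence is
  dominated.\<close>

lemma simple_function_pointwise_tendsto:
  fixes \<sigma> :: "'v::{banach, second_countable_topology} \<Rightarrow> nat \<Rightarrow> 'v"
  assumes s: "simple_function (time_measure T) s" and \<sigma>: "\<And>t. (\<lambda>n. \<sigma> (s t) n) \<longlonglongrightarrow> s t"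
  shows "L2_tendsto T (\<lambda>n t. \<sigma> (s t) n) s"
proof -
  have fin: "finite (s ` {0<..<T})" using simple_functionD(1)[OF s] by simp
  have sn: "(\<lambda>t. \<sigma> (s t) n) \<in> L2 T" for n
    by (rule simple_function_L2[OF simple_function_compose1[OF s]])
  have "\<exists>B. \<forall>n. norm (\<sigma> y n - y) \<le> B" if "y \<in> range s" for y
  proof -
    have "(\<lambda>n. \<sigma> y n - y) \<longlonglongrightarrow> 0" using \<sigma> that by (auto simp: LIM_zero_iff)
    then have "Bseq (\<lambda>n. \<sigma> y n - y)" by (intro convergent_imp_Bseq convergentI)
    then show ?thesis unfolding Bseq_def by blast
  qed
  then obtain B where B: "\<And>y n. y \<in> range s \<Longrightarrow> norm (\<sigma> y n - y) \<le> B y" by metis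
  have B0: "0 \<le> B y" if "y \<in> range s" for y using order_trans[OF norm_ge_zero B[OF that]] .
  define b where "b = (\<Sum>y\<in>s ` {0<..<T}. B y)"
  show ?thesis
  proof (rule L2_tendsto_dominated[OF sn simple_function_L2[OF s] L2_const[of b]])
    show "AE t in time_measure T. (\<lambda>n. \<sigma> (s t) n) \<longlonglongrightarrow> s t" using \<sigma> by simp
    show "AE t in time_measure T. norm (\<sigma> (s t) n - s t) \<le> norm b" for n
    proof (rule AE_I2)
      fix t assume "t \<in> space (time_measure T)"
      then have t: "s t \<in> s ` {0<..<T}" by simp
      have "norm (\<sigma> (s t) n - s t) \<le> B (s t)" by (rule B) simp
      also have "\<dots> \<le> b"
        unfolding b_def by (rule member_le_sum[OF t _ fin]) (use B0 in auto)
      finally show "norm (\<sigma> (s t) n - s t) \<le> norm b" by simp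
    qed
  qed
qed

text \<open>For a simple function with values in \<open>K\<close> the recovery sequences of its
  values are inserted. By density the distance \<open>d n\<close> from a general \<open>h\<close> to
  \<open>L2_in T (Kn n)\<close> then tends to 0, and near-minimizers of the distance form the
  recovery sequence, in place of a diagonal choice.\<close>

lemma mosco_recovery_L2:
  fixes K :: "'v::{banach, second_countable_topology} set"
  assumes mosco: "mosco_converges Kn K" and h: "h \<in> L2_in T K" and K: "x0 \<in> K"
  obtains hs where "\<And>n. hs n \<in> L2_in T (Kn n)" "L2_tendsto T hs h"
proof -
  have hL: "h \<in> L2 T" using h by (simp add: L2_in_def)
  have "\<forall>w\<in>K. \<exists>ws. (\<forall>n. ws n \<in> Kn n) \<and> ws \<longlonglongrightarrow> w"
    using mosco by (simp add: mosco_converges_def)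
  then obtain \<sigma> where \<sigma>: "\<And>w n. w \<in> K \<Longrightarrow> \<sigma> w n \<in> Kn n" "\<And>w. w \<in> K \<Longrightarrow> \<sigma> w \<longlonglongrightarrow> w" by metis
  obtain s :: "nat \<Rightarrow> real \<Rightarrow> 'v" where s: "\<And>i. simple_function (time_measure T) (s i)"
    and sK: "\<And>i t. s i t \<in> K" and lim: "L2_tendsto T s h"
    by (rule L2_in_simple_approx[OF h]) (use K in \<open>auto intro: that\<close>)
  have \<sigma>s: "simple_function (time_measure T) (\<lambda>t. \<sigma> (s i t) n)" for i n
    by (rule simple_function_compose1[OF s])
  have \<sigma>sK: "(\<lambda>t. \<sigma> (s i t) n) \<in> L2_in T (Kn n)" for i n
    using simple_function_L2[OF \<sigma>s] \<sigma>(1) sK by (simp add: L2_in_def)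
  define E where "E n = (\<lambda>k. L2_norm T (\<lambda>t. k t - h t)) ` L2_in T (Kn n)" for n
  define d where "d n = Inf (E n)" for n
  have bdd: "bdd_below (E n)" for n
    unfolding E_def by (intro bdd_belowI2[of _ 0] L2_norm_nonneg)
  have E_ne: "E n \<noteq> {}" for n using \<sigma>sK[of 0 n] unfolding E_def by auto
  have d0: "0 \<le> d n" for n
    unfolding d_def by (rule cInf_greatest[OF E_ne]) (auto simp: E_def L2_norm_nonneg)
  have "d \<longlonglongrightarrow> 0"
  proof (rule LIMSEQ_I)
    fix r :: real assume r: "0 < r"
    have "\<forall>\<^sub>F i in sequentially. L2_norm T (\<lambda>t. s i t - h t) < r / 2"
      using lim unfolding L2_tendsto_def by (rule order_tendstoD(2)) (use r in simp)
    then obtain i where i: "L2_norm T (\<lambda>t. s i t - h t) < r / 2"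
      unfolding eventually_sequentially by blast
    have "L2_tendsto T (\<lambda>n t. \<sigma> (s i t) n) (s i)"
      by (rule simple_function_pointwise_tendsto[OF s \<sigma>(2)[OF sK]])
    then have "\<forall>\<^sub>F n in sequentially. L2_norm T (\<lambda>t. \<sigma> (s i t) n - s i t) < r / 2"
      unfolding L2_tendsto_def by (rule order_tendstoD(2)) (use r in simp)
    then obtain N where N: "\<And>n. n \<ge> N \<Longrightarrow> L2_norm T (\<lambda>t. \<sigma> (s i t) n - s i t) < r / 2"
      unfolding eventually_sequentially by blast
    have "norm (d n - 0) < r" if "n \<ge> N" for n
    proof -
      have "d n \<le> L2_norm T (\<lambda>t. \<sigma> (s i t) n - h t)"
        unfolding d_def by (rule cInf_lower[OF _ bdd]) (use \<sigma>sK in \<open>auto simp: E_def\<close>)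
      also have "\<dots> \<le> L2_norm T (\<lambda>t. \<sigma> (s i t) n - s i t) + L2_norm T (\<lambda>t. s i t - h t)"
        by (rule L2_norm_triangle_diff[OF simple_function_L2[OF \<sigma>s] simple_function_L2[OF s] hL])
      finally show ?thesis using N[OF that] i d0[of n] by simp
    qed
    then show "\<exists>N. \<forall>n\<ge>N. norm (d n - 0) < r" by blast
  qed
  have "\<exists>k\<in>L2_in T (Kn n). L2_norm T (\<lambda>t. k t - h t) < d n + 1 / Suc n" for n
  proof -
    have "Inf (E n) < d n + 1 / Suc n" by (simp add: d_def)
    from cInf_lessD[OF E_ne this] show ?thesis by (auto simp: E_def)
  qed
  then obtain hs where hs: "\<And>n. hs n \<in> L2_in T (Kn n)"
    and le: "\<And>n. L2_norm T (\<lambda>t. hs n t - h t) < d n + 1 / Suc n" by metis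
  have "L2_tendsto T hs h"
  proof (rule L2_tendstoI[OF less_imp_le[OF le]])
    have "(\<lambda>n. d n + 1 / Suc n) \<longlonglongrightarrow> 0 + 0"
      by (intro tendsto_add \<open>d \<longlonglongrightarrow> 0\<close> lim_const_over_n[THEN LIMSEQ_Suc])
    then show "(\<lambda>n. d n + 1 / Suc n) \<longlonglongrightarrow> 0" by simp
  qed
  with hs show ?thesis by (rule that)
qed

text \<open>A subsequence converges almost everywhere, by the corresponding fact for
  \<open>L1\<close> applied to the squared distances.\<close>

lemma L2_tendsto_closed:
  fixes y :: "nat \<Rightarrow> real \<Rightarrow> 'v::{banach, second_countable_topology}"
  assumes y: "\<And>k. y k \<in> L2_in T C" and z: "z \<in> L2 T" and lim: "L2_tendsto T y z" and C: "closed C"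
  shows "z \<in> L2_in T C"
proof -
  let ?M = "time_measure T"
  have yL: "y k \<in> L2 T" and yC: "AE t in ?M. y k t \<in> C" for k using y by (auto simp: L2_in_def)
  have "(\<lambda>k. sqrt (\<integral>t. (norm (y k t - z t))\<^sup>2 \<partial>?M) ^ 2) \<longlonglongrightarrow> 0 ^ 2"
    using lim unfolding L2_tendsto_def L2_norm_def by (rule tendsto_power)
  then have "(\<lambda>k. \<integral>t. norm ((norm (y k t - z t))\<^sup>2) \<partial>?M) \<longlonglongrightarrow> 0" by simp
  then obtain r where r: "strict_mono (r :: nat \<Rightarrow> nat)"
    and ae: "AE t in ?M. (\<lambda>k. (norm (y (r k) t - z t))\<^sup>2) \<longlonglongrightarrow> 0"
    using tendsto_L1_AE_subseq[of ?M "\<lambda>k t. (norm (y k t - z t))\<^sup>2"] L2_integrable_norm2[OF L2_diff[OF yL z]]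
    by blast
  have "AE t in ?M. \<forall>k. y k t \<in> C" using yC by (simp add: AE_all_countable)
  with ae have "AE t in ?M. z t \<in> C"
  proof eventually_elim
    case (elim t)
    from elim(1) have "(\<lambda>k. sqrt ((norm (y (r k) t - z t))\<^sup>2)) \<longlonglongrightarrow> sqrt 0" by (rule tendsto_real_sqrt)
    then have "(\<lambda>k. y (r k) t - z t) \<longlonglongrightarrow> 0" by (simp add: tendsto_norm_zero_iff)
    then have "(\<lambda>k. y (r k) t) \<longlonglongrightarrow> z t" by (simp add: LIM_zero_iff)
    then show ?case by (rule closed_sequentially[OF C, rotated]) (use elim(2) in simp)
  qed
  with z show ?thesis by (simp add: L2_in_def)
qed

lemma L2_tendsto_subseq:
  "L2_tendsto T xs x \<Longrightarrow> strict_mono r \<Longrightarrow> L2_tendsto T (\<lambda>n. xs (r n)) x"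
  unfolding L2_tendsto_def by (drule LIMSEQ_subseq_LIMSEQ) (auto simp: o_def)

lemma L2_weakly_tendstoD:
  "L2_weakly_tendsto T xs x \<Longrightarrow> L2_functional T G \<Longrightarrow> (\<lambda>n. G (xs n)) \<longlonglongrightarrow> G x"
  by (simp add: L2_weakly_tendsto_def)

lemma mosco_convergesD:
  assumes "mosco_converges Kn K" "filterlim ns at_top sequentially" "\<And>k. ws k \<in> Kn (ns k)"
    "weakly_tendsto ws w"
  shows "w \<in> K"
proof -
  have "\<forall>ns ws w. filterlim ns at_top sequentially \<and> (\<forall>k. ws k \<in> Kn (ns k)) \<and> weakly_tendsto ws w \<longrightarrow> w \<in> K"
    using assms(1) by (simp add: mosco_converges_def)
  from this[rule_format, of ns ws w] show ?thesis using assms(2-4) by blast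
qed

text \<open>The second Mosco condition concerns \<open>V\<close>, so it is applied at each time to
  regularizations with fixed \<open>e\<close>: they lie in \<open>Kn (r n)\<close> and converge
  weakly in \<open>V\<close>. The regularizations of \<open>w\<close> thus have values in
  \<open>K\<close>, and \<open>w\<close> is their \<open>L2\<close> limit as \<open>e\<close> tends
  to 0.\<close>

lemma mosco_weak_limit_L2:
  fixes K :: "'v::{banach, second_countable_topology} set"
  assumes T: "0 < T" and mosco: "mosco_converges Kn K"
    and Kn: "\<And>n. closed (Kn n)" "\<And>n. convex (Kn n)" and K: "closed K"
    and x: "\<And>n. x n \<in> Kn n" "x \<longlonglongrightarrow> x0"
    and u: "\<And>n. u n \<in> L2_in T (Kn n)" and r: "strict_mono r"
    and w: "w \<in> L2 T" "L2_weakly_tendsto T (\<lambda>n. u (r n)) w"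
  shows "w \<in> L2_in T K"
proof (rule L2_tendsto_closed[OF _ w(1) regularize_tendsto_self[OF w(1), of x0] K])
  fix k
  define e where "e = 1 / real (Suc k)"
  have e: "0 < e" by (simp add: e_def)
  have uL: "u n \<in> L2 T" for n using u by (simp add: L2_in_def)
  have "regularize T e x0 w t \<in> K" if t: "t \<in> {0<..<T}" for t
  proof -
    have weak: "weakly_tendsto (\<lambda>n. regularize T e (x (r n)) (u (r n)) t) (regularize T e x0 w t)"
      unfolding weakly_tendsto_def regularize_functional[OF e uL] regularize_functional[OF e w(1)]
    proof (intro allI tendsto_add tendsto_mult tendsto_const)
      fix \<phi> :: "'v \<Rightarrow>\<^sub>L real"
      show "(\<lambda>n. \<phi> (x (r n))) \<longlonglongrightarrow> \<phi> x0"
        using LIMSEQ_subseq_LIMSEQ[OF x(2) r] by (intro tendsto_intros) (simp add: o_def)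
      show "(\<lambda>n. dual_integral T (\<lambda>s. exp_kernel e t s *\<^sub>R \<phi>) (u (r n))) \<longlonglongrightarrow> dual_integral T (\<lambda>s. exp_kernel e t s *\<^sub>R \<phi>) w"
        by (rule L2_weakly_tendstoD[OF w(2) dual_integral_functional[OF exp_kernel_dual_L2[OF e]]])
    qed
    have "regularize T e (x (r n)) (u (r n)) t \<in> Kn (r n)" for n
      by (rule regularize_in_convex[OF e u Kn(2,1) x(1)]) (use t in auto)
    from mosco_convergesD[OF mosco filterlim_subseq[OF r] this weak] show ?thesis .
  qed
  then have "AE t in time_measure T. regularize T e x0 w t \<in> K" by (intro AE_I2) simp
  then show "regularize T (1 / real (Suc k)) x0 w \<in> L2_in T K"
    using regularize_L2(1)[OF e w(1), of x0] by (simp add: L2_in_def e_def)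
qed

text \<open>The bound contains the factor \<open>1 / e\<close>, which blows up; hence the limit in
  \<open>n\<close> has to precede the limit in \<open>e\<close>.\<close>

lemma regularize_deriv_tendsto:
  assumes e: "0 < e" and h: "\<And>n. hs n \<in> L2 T" "h \<in> L2 T" "L2_tendsto T hs h" and x: "xs \<longlonglongrightarrow> x"
  shows "L2_tendsto T (\<lambda>n. regularize_deriv T e (xs n) (hs n)) (regularize_deriv T e x h)"
proof (rule L2_tendstoI)
  note RL = regularize_L2(1)[OF e]
  let ?H = "\<lambda>n. L2_norm T (\<lambda>t. hs n t - h t)"
  let ?R = "\<lambda>n. L2_norm T (\<lambda>t. regularize T e (xs n) (hs n) t - regularize T e x h t)"
  show "L2_norm T (\<lambda>t. regularize_deriv T e (xs n) (hs n) t - regularize_deriv T e x h t)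
      \<le> \<bar>1 / e\<bar> * (?H n + ?R n)" for n
  proof -
    have "L2_norm T (\<lambda>t. (hs n t - h t) - (regularize T e (xs n) (hs n) t - regularize T e x h t)) \<le> ?H n + ?R n"
      using L2_norm_triangle[OF L2_diff[OF h(1,2)] L2_diff[OF RL[OF h(2)] RL[OF h(1)]], of n x "xs n" n]
        L2_norm_minus_commute[of T "regularize T e x h" "regularize T e (xs n) (hs n)"]
      by (simp add: algebra_simps)
    moreover have "(\<lambda>t. regularize_deriv T e (xs n) (hs n) t - regularize_deriv T e x h t)
        = (\<lambda>t. (1 / e) *\<^sub>R ((hs n t - h t) - (regularize T e (xs n) (hs n) t - regularize T e x h t)))"
      by (simp add: regularize_deriv_def fun_eq_iff algebra_simps)
    ultimately show ?thesis
      by (simp only: L2_norm_scaleR mult_left_mono abs_ge_zero)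
  qed
  have "(\<lambda>n. \<bar>1 / e\<bar> * (?H n + ?R n)) \<longlonglongrightarrow> \<bar>1 / e\<bar> * (0 + 0)"
    using h(3) regularize_tendsto[OF e h x] unfolding L2_tendsto_def by (intro tendsto_intros)
  then show "(\<lambda>n. \<bar>1 / e\<bar> * (?H n + ?R n)) \<longlonglongrightarrow> 0" by simp
qed

subsection \<open>Weak limits of the solutions\<close>

text \<open>Stated for general sequences, since the final argument applies it to subsequences. The
  sequence \<open>x\<close> is a recovery sequence for \<open>u0\<close>, as provided by the first
  Mosco condition.\<close>

context
  fixes T M \<alpha> :: real
    and j :: "'v::{banach, second_countable_topology} \<Rightarrow>\<^sub>L 'h::{real_inner, banach, second_countable_topology}"
    and a :: "real \<Rightarrow> 'v \<Rightarrow> 'v \<Rightarrow> real"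
    and Kn :: "nat \<Rightarrow> 'v set" and K :: "'v set"
    and u0n x :: "nat \<Rightarrow> 'v" and u0 :: 'v
    and fn :: "nat \<Rightarrow> real \<Rightarrow> 'v \<Rightarrow>\<^sub>L real" and f :: "real \<Rightarrow> 'v \<Rightarrow>\<^sub>L real"
    and un :: "nat \<Rightarrow> real \<Rightarrow> 'v" and u :: "real \<Rightarrow> 'v"
  assumes T: "0 < T" and M: "0 \<le> M" and \<alpha>: "0 < \<alpha>" and a: "coercive_forms T M \<alpha> a"
    and Kn: "\<And>n. closed (Kn n)" "\<And>n. convex (Kn n)" and K: "closed K" "convex K"
    and x: "\<And>n. x n \<in> Kn n" "x \<longlonglongrightarrow> u0" and u0: "u0 \<in> K"
    and f: "\<And>n. fn n \<in> L2 T" "f \<in> L2 T" "L2_tendsto T fn f"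
    and un: "\<And>n. weak_solution T j a (Kn n) (fn n) (u0n n) (un n)"
    and u: "weak_solution T j a K f u0 u"
    and u0n: "(\<lambda>n. j (u0n n)) \<longlonglongrightarrow> j u0"
    and mosco: "mosco_converges Kn K"
begin

private abbreviation (input) "B \<equiv> form_integral T a"
private abbreviation (input) "P \<equiv> form_integral T (pivot_form j)"

private lemmas bounded_a = coercive_forms_bounded[OF a] M

private lemma bounded_P: "bounded_forms T (norm j * norm j) (pivot_form j)" "0 \<le> norm j * norm j"
  by (simp_all add: bounded_forms_pivot)

lemma initial_error_tendsto: "(\<lambda>n. 1/2 * (norm (j (x n) - j (u0n n)))\<^sup>2) \<longlonglongrightarrow> 0"
proof -
  have "(\<lambda>n. 1/2 * (norm (j (x n) - j (u0n n)))\<^sup>2) \<longlonglongrightarrow> 1/2 * (norm (j u0 - j u0))\<^sup>2"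
    by (intro tendsto_intros x(2) u0n)
  then show ?thesis by simp
qed

lemma solution_L2:
  "un n \<in> L2_in T (Kn n)" "un n \<in> L2 T" "u \<in> L2_in T K" "u \<in> L2 T"
  using un[of n] u by (auto simp: weak_solution_def L2_in_def)

lemma solution_energy_le:
  assumes e: "0 < e" and h: "h \<in> L2_in T (Kn n)"
  defines "v \<equiv> regularize T e (x n) h" and "D \<equiv> regularize_deriv T e (x n) h"
  shows "B (un n) (un n) \<le> P D v - P D (un n) + B (un n) v
    - (dual_integral T (fn n) v - dual_integral T (fn n) (un n)) + 1/2 * (norm (j (x n) - j (u0n n)))\<^sup>2"
  using weak_solution_regularize_test[OF T M a Kn(2,1) f(1) un e h x(1)] unfolding v_def D_def by linarith

text \<open>The test functions are the regularizations, with \<open>e = 1\<close>, of a recovery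
  sequence for \<open>u\<close>; they and their derivatives are bounded in \<open>L2\<close>. The
  right side of the energy inequality then grows at most linearly in the norm of
  \<open>un n\<close>, while coercivity makes the left side grow quadratically.\<close>

lemma solutions_bounded: "\<exists>C. \<forall>n. L2_norm T (un n) \<le> C"
proof -
  obtain hs where hs: "\<And>n. hs n \<in> L2_in T (Kn n)" and lim: "L2_tendsto T hs u"
    by (rule mosco_recovery_L2[OF mosco solution_L2(3) u0]) (rule that)
  have hL: "hs n \<in> L2 T" for n using hs by (simp add: L2_in_def)
  have e: "0 < (1::real)" by simp
  define v where "v n = regularize T 1 (x n) (hs n)" for n
  define D where "D n = regularize_deriv T 1 (x n) (hs n)" for n
  have vL: "v n \<in> L2 T" and DL: "D n \<in> L2 T" for n
    unfolding v_def D_def by (rule regularize_L2(1)[OF e hL], rule regularize_deriv_L2[OF e hL])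
  have vlim: "L2_tendsto T v (regularize T 1 u0 u)"
    unfolding v_def by (rule regularize_tendsto[OF e hL solution_L2(4) lim x(2)])
  have Dlim: "L2_tendsto T D (regularize_deriv T 1 u0 u)"
    unfolding D_def by (rule regularize_deriv_tendsto[OF e hL solution_L2(4) lim x(2)])
  obtain Cv where Cv: "\<And>n. L2_norm T (v n) \<le> Cv"
    by (rule L2_tendsto_norm_bounded[OF vL regularize_L2(1)[OF e solution_L2(4)] vlim]) (rule that)
  obtain Cd where Cd: "\<And>n. L2_norm T (D n) \<le> Cd"
    by (rule L2_tendsto_norm_bounded[OF DL regularize_deriv_L2[OF e solution_L2(4)] Dlim]) (rule that)
  obtain Cf where Cf: "\<And>n. L2_norm T (fn n) \<le> Cf"
    by (rule L2_tendsto_norm_bounded[OF f]) (rule that)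
  obtain c0 where c0: "\<And>n. 1/2 * (norm (j (x n) - j (u0n n)))\<^sup>2 \<le> c0"
    using BseqE[OF convergent_imp_Bseq[OF convergentI[OF initial_error_tendsto]]]
    by (metis abs_le_D1 real_norm_def)
  define m where "m = norm j * norm j"
  have m0: "0 \<le> m" by (simp add: m_def)
  note nn = order_trans[OF L2_norm_nonneg Cv] order_trans[OF L2_norm_nonneg Cd] order_trans[OF L2_norm_nonneg Cf]
  have c00: "0 \<le> c0" by (rule order_trans[OF _ c0[of 0]]) simp
  define c1 where "c1 = m * Cd * Cv + Cf * Cv + c0"
  define c2 where "c2 = m * Cd + M * Cv + Cf"
  have c1: "0 \<le> c1" and c2: "0 \<le> c2"
    unfolding c1_def c2_def using nn m0 M c00 by (auto intro!: add_nonneg_nonneg mult_nonneg_nonneg)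
  \<comment> \<open>From \<open>\<alpha> y^2 \<le> c1 + c2 y\<close>: either
    \<open>y \<le> 1\<close>, or \<open>c1 \<le> c1 y\<close> and one factor \<open>y\<close>
    cancels.\<close>
  have "L2_norm T (un n) \<le> 1 + (c1 + c2) / \<alpha>" for n
  proof -
    let ?y = "L2_norm T (un n)"
    have y: "0 \<le> ?y" by (rule L2_norm_nonneg)
    have "\<bar>P (D n) (v n)\<bar> \<le> m * L2_norm T (D n) * L2_norm T (v n)"
      unfolding m_def by (rule form_integrable_and_bound(2)[OF bounded_P DL vL])
    also have "\<dots> \<le> m * Cd * Cv"
      using m0 nn by (intro mult_mono Cd Cv L2_norm_nonneg mult_nonneg_nonneg) auto
    finally have 1: "\<bar>P (D n) (v n)\<bar> \<le> m * Cd * Cv" .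
    have "\<bar>P (D n) (un n)\<bar> \<le> m * L2_norm T (D n) * ?y"
      unfolding m_def by (rule form_integrable_and_bound(2)[OF bounded_P DL solution_L2(2)])
    also have "\<dots> \<le> m * Cd * ?y"
      using m0 nn by (intro mult_mono Cd L2_norm_nonneg mult_nonneg_nonneg) auto
    finally have 2: "\<bar>P (D n) (un n)\<bar> \<le> m * Cd * ?y" .
    have "\<bar>B (un n) (v n)\<bar> \<le> M * ?y * L2_norm T (v n)"
      by (rule form_integrable_and_bound(2)[OF bounded_a solution_L2(2) vL])
    also have "\<dots> \<le> M * ?y * Cv"
      using M y by (intro mult_left_mono Cv mult_nonneg_nonneg)
    finally have 3: "\<bar>B (un n) (v n)\<bar> \<le> M * ?y * Cv" .
    have "\<bar>dual_integral T (fn n) (v n)\<bar> \<le> L2_norm T (fn n) * L2_norm T (v n)"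
      by (rule dual_integrable_and_bound(2)[OF f(1) vL])
    also have "\<dots> \<le> Cf * Cv" using nn by (intro mult_mono Cf Cv L2_norm_nonneg) auto
    finally have 4: "\<bar>dual_integral T (fn n) (v n)\<bar> \<le> Cf * Cv" .
    have "\<bar>dual_integral T (fn n) (un n)\<bar> \<le> L2_norm T (fn n) * ?y"
      by (rule dual_integrable_and_bound(2)[OF f(1) solution_L2(2)])
    also have "\<dots> \<le> Cf * ?y" using y by (intro mult_right_mono Cf)
    finally have 5: "\<bar>dual_integral T (fn n) (un n)\<bar> \<le> Cf * ?y" .
    have "\<alpha> * ?y\<^sup>2 \<le> B (un n) (un n)"
      by (rule coercive_forms_norm_le[OF a M solution_L2(2)])
    also have "\<dots> \<le> c1 + (m * Cd * ?y + M * ?y * Cv + Cf * ?y)"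
      using solution_energy_le[OF e hs, of n, folded v_def D_def] 1 2 3 4 5 c0[of n] unfolding c1_def abs_le_iff
      by linarith
    also have "m * Cd * ?y + M * ?y * Cv + Cf * ?y = c2 * ?y"
      by (simp add: c2_def algebra_simps)
    finally have q: "\<alpha> * ?y\<^sup>2 \<le> c1 + c2 * ?y" .
    show ?thesis
    proof (cases "?y \<le> 1")
      case True
      then show ?thesis using c1 c2 \<alpha> by (simp add: add_increasing2)
    next
      case False
      then have "c1 * 1 \<le> c1 * ?y" using c1 by (intro mult_left_mono) auto
      then have "\<alpha> * ?y * ?y \<le> (c1 + c2) * ?y" using q by (simp add: power2_eq_square algebra_simps)
      then have "\<alpha> * ?y \<le> c1 + c2" using False by (simp add: mult_le_cancel_right)
      then have "?y \<le> (c1 + c2) / \<alpha>" using \<alpha> by (simp add: pos_le_divide_eq mult.commute)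
      then show ?thesis by simp
    qed
  qed
  then show ?thesis by blast
qed

text \<open>Each term on the right side of the energy inequality is free of \<open>un\<close> or
  pairs it with something that converges strongly, so it passes to the weak limit; the quadratic
  term stays on the left. The slack \<open>\<eta>\<close> replaces a limit superior.\<close>

lemma limit_energy_le:
  assumes r: "strict_mono r" and w: "w \<in> L2 T" "L2_weakly_tendsto T (\<lambda>n. un (r n)) w"
    and e: "0 < e" and h: "h \<in> L2_in T K" and \<eta>: "0 < \<eta>"
  defines "v \<equiv> regularize T e u0 h" and "D \<equiv> regularize_deriv T e u0 h"
  shows "\<forall>\<^sub>F n in sequentially. B (un (r n)) (un (r n))
    < P D v - P D w + B w v - (dual_integral T f v - dual_integral T f w) + \<eta>"
proof -
  have hL: "h \<in> L2 T" using h by (simp add: L2_in_def)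
  obtain hs where hs: "\<And>n. hs n \<in> L2_in T (Kn n)" and lim: "L2_tendsto T hs h"
    by (rule mosco_recovery_L2[OF mosco h u0]) (rule that)
  have hsL: "hs n \<in> L2 T" for n using hs by (simp add: L2_in_def)
  define y where "y n = un (r n)" for n
  have yL: "y n \<in> L2 T" for n unfolding y_def by (rule solution_L2(2))
  obtain C where C: "\<And>n. L2_norm T (y n) \<le> C" using solutions_bounded unfolding y_def by blast
  define vn where "vn n = regularize T e (x (r n)) (hs (r n))" for n
  define Dn where "Dn n = regularize_deriv T e (x (r n)) (hs (r n))" for n
  have vnL: "vn n \<in> L2 T" and DnL: "Dn n \<in> L2 T" for n
    unfolding vn_def Dn_def by (rule regularize_L2(1)[OF e hsL], rule regularize_deriv_L2[OF e hsL])
  have vL: "v \<in> L2 T" and DL: "D \<in> L2 T"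
    unfolding v_def D_def by (rule regularize_L2(1)[OF e hL], rule regularize_deriv_L2[OF e hL])
  have vlim: "L2_tendsto T vn v"
    unfolding vn_def v_def by (rule L2_tendsto_subseq[OF regularize_tendsto[OF e hsL hL lim x(2)] r])
  have Dlim: "L2_tendsto T Dn D"
    unfolding Dn_def D_def by (rule L2_tendsto_subseq[OF regularize_deriv_tendsto[OF e hsL hL lim x(2)] r])
  have flim: "L2_tendsto T (\<lambda>n. fn (r n)) f" by (rule L2_tendsto_subseq[OF f(3) r])
  obtain Cv where Cv: "\<And>n. L2_norm T (vn n) \<le> Cv"
    by (rule L2_tendsto_norm_bounded[OF vnL vL vlim]) (rule that)
  have wlim: "(\<lambda>n. G (y n)) \<longlonglongrightarrow> G w" if "L2_functional T G" for G
    unfolding y_def by (rule L2_weakly_tendstoD[OF w(2) that])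
  have "(\<lambda>n. P (Dn n) (vn n) - P (Dn n) (y n) + B (y n) (vn n)
      - (dual_integral T (fn (r n)) (vn n) - dual_integral T (fn (r n)) (y n)) + 1/2 * (norm (j (x (r n)) - j (u0n (r n))))\<^sup>2)
    \<longlonglongrightarrow> P D v - P D w + B w v - (dual_integral T f v - dual_integral T f w) + 0"
  proof (intro tendsto_add tendsto_diff)
    show "(\<lambda>n. P (Dn n) (vn n)) \<longlonglongrightarrow> P D v"
      by (rule form_integral_tendsto[OF bounded_P DnL DL Dlim vnL Cv
            L2_functional_tendsto[OF form_integral_functional_right[OF bounded_P DL] vnL vL vlim]])
    show "(\<lambda>n. P (Dn n) (y n)) \<longlonglongrightarrow> P D w"
      by (rule form_integral_tendsto[OF bounded_P DnL DL Dlim yL C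
            wlim[OF form_integral_functional_right[OF bounded_P DL]]])
    \<comment> \<open>Here the strongly convergent factor is the second argument, so the flipped
      form is used.\<close>
    have "(\<lambda>n. form_integral T (\<lambda>t u v. a t v u) (vn n) (y n)) \<longlonglongrightarrow> form_integral T (\<lambda>t u v. a t v u) v w"
      by (rule form_integral_tendsto[OF bounded_forms_flip[OF bounded_a(1)] M vnL vL vlim yL C
            wlim[OF form_integral_functional_right[OF bounded_forms_flip[OF bounded_a(1)] M vL]]])
    then show "(\<lambda>n. B (y n) (vn n)) \<longlonglongrightarrow> B w v" by (simp add: form_integral_def)
    show "(\<lambda>n. dual_integral T (fn (r n)) (vn n)) \<longlonglongrightarrow> dual_integral T f v"
      by (rule dual_integral_tendsto[OF f(1,2) flim vnL Cv
            L2_functional_tendsto[OF dual_integral_functional[OF f(2)] vnL vL vlim]])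
    show "(\<lambda>n. dual_integral T (fn (r n)) (y n)) \<longlonglongrightarrow> dual_integral T f w"
      by (rule dual_integral_tendsto[OF f(1,2) flim yL C wlim[OF dual_integral_functional[OF f(2)]]])
    show "(\<lambda>n. 1/2 * (norm (j (x (r n)) - j (u0n (r n))))\<^sup>2) \<longlonglongrightarrow> 0"
      using LIMSEQ_subseq_LIMSEQ[OF initial_error_tendsto r] by (simp add: o_def)
  qed
  then have "\<forall>\<^sub>F n in sequentially. P (Dn n) (vn n) - P (Dn n) (y n) + B (y n) (vn n)
      - (dual_integral T (fn (r n)) (vn n) - dual_integral T (fn (r n)) (y n)) + 1/2 * (norm (j (x (r n)) - j (u0n (r n))))\<^sup>2
    < P D v - P D w + B w v - (dual_integral T f v - dual_integral T f w) + \<eta>"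
    by (rule order_tendstoD(2)) (use \<eta> in simp)
  then show ?thesis
  proof eventually_elim
    case (elim n)
    with solution_energy_le[OF e hs, of "r n", folded vn_def Dn_def y_def]
    show ?case unfolding y_def by linarith
  qed
qed

text \<open>
  Testing with the regularization of the midpoint of \<open>u\<close> and \<open>w\<close> in both inequalities makes the
  time derivatives contribute \<open>- 2 e P D D \<le> 0\<close>, as \<open>v - h = - e D\<close>.
\<close>

lemma limit_energy_midpoint:
  assumes r: "strict_mono r" and w: "w \<in> L2_in T K" "L2_weakly_tendsto T (\<lambda>n. un (r n)) w"
    and \<eta>: "0 < \<eta>"
  shows "\<forall>\<^sub>F n in sequentially. B (un (r n)) (un (r n)) < 1/2 * (B w u + B w w + B u w - B u u) + \<eta>"
proof -
  have wL: "w \<in> L2 T" using w(1) by (simp add: L2_in_def)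
  note uL = solution_L2(4)
  define h where "h t = (1/2) *\<^sub>R (u t + w t)" for t
  have hL: "h \<in> L2 T" unfolding h_def[abs_def] by (intro L2_scaleR L2_add uL wL)
  have "AE t in time_measure T. u t \<in> K" "AE t in time_measure T. w t \<in> K"
    using solution_L2(3) w(1) by (auto simp: L2_in_def)
  then have "AE t in time_measure T. h t \<in> K"
  proof eventually_elim
    case (elim t)
    then have "(1/2) *\<^sub>R u t + (1/2) *\<^sub>R w t \<in> K" by (intro convexD[OF K(2)]) auto
    then show ?case by (simp add: h_def scaleR_add_right)
  qed
  with hL have h: "h \<in> L2_in T K" by (simp add: L2_in_def)
  have mid: "G h = 1/2 * (G u + G w)" if G: "L2_functional T G" for G
  proof -
    have "G h = 1/2 * G (\<lambda>t. u t + w t)"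
      unfolding h_def[abs_def] by (rule L2_functional_scaleR[OF G L2_add[OF uL wL]])
    also have "G (\<lambda>t. u t + w t) = G u + G w" by (rule L2_functional_add[OF G uL wL])
    finally show ?thesis .
  qed
  note F = dual_integral_functional[OF f(2)]
  note Bw = form_integral_functional_right[OF bounded_a wL] and Bu = form_integral_functional_right[OF bounded_a uL]
  define v where "v k = regularize T (1 / Suc k) u0 h" for k
  have vL: "v k \<in> L2 T" for k unfolding v_def by (rule regularize_L2(1)[OF _ hL]) simp
  have vlim: "L2_tendsto T v h" unfolding v_def by (rule regularize_tendsto_self[OF hL])
  \<comment> \<open>This is what the sum of the two inequalities contains apart from the derivative
    terms and the slack; with \<open>h\<close> in place of \<open>v k\<close> the terms with
    \<open>f\<close> cancel. The regularization parameter is thereby fixed in terms of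
    \<open>\<eta>\<close> before \<open>n\<close> tends to infinity.\<close>
  have "(\<lambda>k. B w (v k) + B u (v k) - B u u - 2 * dual_integral T f (v k) + 2 * dual_integral T f h)
      \<longlonglongrightarrow> B w h + B u h - B u u - 2 * dual_integral T f h + 2 * dual_integral T f h"
    by (intro tendsto_add tendsto_diff tendsto_mult tendsto_const L2_functional_tendsto[OF F vL hL vlim]
        L2_functional_tendsto[OF Bw vL hL vlim] L2_functional_tendsto[OF Bu vL hL vlim])
  then have "\<forall>\<^sub>F k in sequentially. B w (v k) + B u (v k) - B u u - 2 * dual_integral T f (v k) + 2 * dual_integral T f h
      < B w h + B u h - B u u + \<eta> / 2"
    by (rule order_tendstoD(2)) (use \<eta> in simp)
  then obtain k where k: "B w (v k) + B u (v k) - B u u - 2 * dual_integral T f (v k) + 2 * dual_integral T f h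
      < B w h + B u h - B u u + \<eta> / 2"
    unfolding eventually_sequentially by blast
  define e where "e = 1 / real (Suc k)"
  have e: "0 < e" by (simp add: e_def)
  define D where "D = regularize_deriv T e u0 h"
  have DL: "D \<in> L2 T" unfolding D_def by (rule regularize_deriv_L2[OF e hL])
  have vk: "v k = regularize T e u0 h" by (simp add: v_def e_def)
  note PD = form_integral_functional_right[OF bounded_P DL]
  have "P D (\<lambda>t. v k t - h t) = P D (\<lambda>t. (- e) *\<^sub>R D t)"
    using e by (simp add: D_def regularize_deriv_def vk)
  also have "\<dots> = - e * P D D" by (rule L2_functional_scaleR[OF PD DL])
  also have "\<dots> \<le> 0"
    using e by (auto simp: form_integral_def intro!: mult_nonneg_nonneg Bochner_Integration.integral_nonneg)
  finally have Pneg: "P D (v k) - P D h \<le> 0"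
    by (simp add: L2_functional_diff[OF PD vL hL])
  \<comment> \<open>The initial term is zero, as the regularization starts exactly at
    \<open>u0\<close>.\<close>
  have uineq: "0 \<le> P D (v k) - P D u + B u (v k) - B u u - (dual_integral T f (v k) - dual_integral T f u)"
    using weak_solution_regularize_test[OF T M a K(2,1) f(2) u e h u0] by (simp add: vk D_def)
  have "\<forall>\<^sub>F n in sequentially. B (un (r n)) (un (r n))
      < P D (v k) - P D w + B w (v k) - (dual_integral T f (v k) - dual_integral T f w) + \<eta> / 2"
    unfolding vk D_def by (rule limit_energy_le[OF r wL w(2) e h]) (use \<eta> in simp)
  then show ?thesis
  proof eventually_elim
    case (elim n)
    have "2 * P D h = P D u + P D w" "2 * dual_integral T f h = dual_integral T f u + dual_integral T f w"
      "2 * B w h = B w u + B w w" "2 * B u h = B u u + B u w"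
      using mid[OF PD] mid[OF F] mid[OF Bw] mid[OF Bu] by simp_all
    with elim k uineq Pneg show ?case by (simp add: algebra_simps)
  qed
qed

text \<open>Weak convergence of the mixed terms turns the energy bound into one for the form at
  \<open>un (r n) - w\<close>, whose limit superior is at most minus one half of the form at
  \<open>u - w\<close>. Coercivity then gives both that \<open>u\<close> and \<open>w\<close> have
  distance 0 and that the convergence is strong.\<close>

lemma solutions_subseq_tendsto: "\<exists>r. strict_mono (r :: nat \<Rightarrow> nat) \<and> L2_tendsto T (\<lambda>n. un (r n)) u"
proof -
  obtain C where C: "\<And>n. L2_norm T (un n) \<le> C" using solutions_bounded by blast
  obtain r w where r: "strict_mono (r :: nat \<Rightarrow> nat)" and wL: "w \<in> L2 T"
    and weak: "L2_weakly_tendsto T (\<lambda>n. un (r n)) w"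
    by (rule L2_bounded_weakly_convergent_subseq[OF a M \<alpha> solution_L2(2) C]) (rule that)
  note uL = solution_L2(4)
  have w: "w \<in> L2_in T K"
    by (rule mosco_weak_limit_L2[OF T mosco Kn K(1) x solution_L2(1) r wL weak])
  \<comment> \<open>The mixed terms tend to \<open>2 * B w w\<close>, and
    \<open>1/2 * (B w u + B w w + B u w - B u u) - B w w\<close> is \<open>- 1/2\<close> times the
    form at \<open>u - w\<close>; hence the factor \<open>\<alpha> / 2\<close>.\<close>
  have key: "\<forall>\<^sub>F n in sequentially. \<alpha> * (L2_norm T (\<lambda>t. un (r n) t - w t))\<^sup>2 + \<alpha> / 2 * (L2_norm T (\<lambda>t. u t - w t))\<^sup>2 < \<eta>"
    if \<eta>: "0 < \<eta>" for \<eta>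
  proof -
    have "(\<lambda>n. B (un (r n)) w + B w (un (r n))) \<longlonglongrightarrow> B w w + B w w"
      by (intro tendsto_add L2_weakly_tendstoD[OF weak] form_integral_functional_left[OF bounded_a wL]
          form_integral_functional_right[OF bounded_a wL])
    then have "\<forall>\<^sub>F n in sequentially. B w w + B w w - \<eta> / 2 < B (un (r n)) w + B w (un (r n))"
      by (rule order_tendstoD(1)) (use \<eta> in simp)
    moreover have "\<forall>\<^sub>F n in sequentially. B (un (r n)) (un (r n)) < 1/2 * (B w u + B w w + B u w - B u u) + \<eta> / 2"
      by (rule limit_energy_midpoint[OF r w weak]) (use \<eta> in simp)
    ultimately show ?thesis
    proof eventually_elim
      case (elim n)
      have expand: "B (\<lambda>t. y t - w t) (\<lambda>t. y t - w t) = B y y - B y w - B w y + B w w" if y: "y \<in> L2 T" for y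
        unfolding L2_functional_diff[OF form_integral_functional_right[OF bounded_a L2_diff[OF y wL]] y wL]
          L2_functional_diff[OF form_integral_functional_left[OF bounded_a y] y wL]
          L2_functional_diff[OF form_integral_functional_left[OF bounded_a wL] y wL] by simp
      have "\<alpha> * (L2_norm T (\<lambda>t. un (r n) t - w t))\<^sup>2 \<le> B (\<lambda>t. un (r n) t - w t) (\<lambda>t. un (r n) t - w t)"
        by (rule coercive_forms_norm_le[OF a M L2_diff[OF solution_L2(2) wL]])
      moreover have "\<alpha> * (L2_norm T (\<lambda>t. u t - w t))\<^sup>2 \<le> B (\<lambda>t. u t - w t) (\<lambda>t. u t - w t)"
        by (rule coercive_forms_norm_le[OF a M L2_diff[OF uL wL]])
      ultimately show ?case
        using elim unfolding expand[OF solution_L2(2)] expand[OF uL] by argo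
    qed
  qed
  have lim: "(\<lambda>n. \<alpha> * (L2_norm T (\<lambda>t. un (r n) t - w t))\<^sup>2 + \<alpha> / 2 * (L2_norm T (\<lambda>t. u t - w t))\<^sup>2) \<longlonglongrightarrow> 0"
  proof (rule order_tendstoI)
    fix c :: real assume "c < 0"
    then show "\<forall>\<^sub>F n in sequentially. c < \<alpha> * (L2_norm T (\<lambda>t. un (r n) t - w t))\<^sup>2 + \<alpha> / 2 * (L2_norm T (\<lambda>t. u t - w t))\<^sup>2"
      using \<alpha> by (intro always_eventually allI) (rule less_le_trans, assumption, simp)
  qed (rule key)
  have "\<alpha> / 2 * (L2_norm T (\<lambda>t. u t - w t))\<^sup>2 \<le> 0"
    by (rule LIMSEQ_le_const[OF lim]) (use \<alpha> in auto)
  then have uw: "L2_norm T (\<lambda>t. u t - w t) = 0" using \<alpha> by (simp add: mult_le_0_iff)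
  have "(\<lambda>n. (\<alpha> * (L2_norm T (\<lambda>t. un (r n) t - w t))\<^sup>2) / \<alpha>) \<longlonglongrightarrow> 0 / \<alpha>"
    using lim \<alpha> unfolding uw by (intro tendsto_divide tendsto_const) auto
  then have "(\<lambda>n. sqrt ((L2_norm T (\<lambda>t. un (r n) t - w t))\<^sup>2)) \<longlonglongrightarrow> sqrt 0"
    using \<alpha> by (intro tendsto_real_sqrt) simp
  then have wlim: "(\<lambda>n. L2_norm T (\<lambda>t. un (r n) t - w t)) \<longlonglongrightarrow> 0"
    by (simp add: L2_norm_nonneg)
  have "L2_tendsto T (\<lambda>n. un (r n)) u"
  proof (rule L2_tendstoI[OF _ wlim])
    show "L2_norm T (\<lambda>t. un (r n) t - u t) \<le> L2_norm T (\<lambda>t. un (r n) t - w t)" for n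
      using L2_norm_triangle_diff[OF solution_L2(2) wL uL] L2_norm_minus_commute[of T w u] uw by simp
  qed
  with r show ?thesis by blast
qed

end

section \<open>Passage from subsequences to the whole sequence\<close>

text \<open>Subsequence principle: if convergence failed, the distance to \<open>u\<close> would
  stay at least \<open>e\<close> along some \<open>s\<close>, but all hypotheses pass to the
  subsequence and a further subsequence converges to \<open>u\<close>.\<close>

theorem theorem5p3:
  fixes T M \<alpha> :: real
    and j :: "'v::{banach, second_countable_topology} \<Rightarrow>\<^sub>L 'h::{real_inner, banach, second_countable_topology}"
    and a :: "real \<Rightarrow> 'v \<Rightarrow> 'v \<Rightarrow> real"
    and Kn :: "nat \<Rightarrow> 'v set" and K :: "'v set"
    and u0n :: "nat \<Rightarrow> 'v" and u0 :: 'v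
    and fn :: "nat \<Rightarrow> real \<Rightarrow> 'v \<Rightarrow>\<^sub>L real" and f :: "real \<Rightarrow> 'v \<Rightarrow>\<^sub>L real"
    and un :: "nat \<Rightarrow> real \<Rightarrow> 'v" and u :: "real \<Rightarrow> 'v"
  assumes "0 < T"
    and "evolution_triple j"
    and "0 < M" and "0 < \<alpha>" and "coercive_forms T M \<alpha> a"
    and "\<And>n. closed (Kn n)" and "\<And>n. convex (Kn n)"
    and "closed K" and "convex K"
    and "\<And>n. u0n n \<in> Kn n" and "u0 \<in> K"
    and "\<And>n. fn n \<in> L2 T" and "f \<in> L2 T"
    and "\<And>n. weak_solution T j a (Kn n) (fn n) (u0n n) (un n)"
    and "weak_solution T j a K f u0 u"
    and "L2_tendsto T fn f"
    and "weakly_tendsto u0n u0"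
    and "(\<lambda>n. j (u0n n)) \<longlonglongrightarrow> j u0"
    and "mosco_converges Kn K"
  shows "L2_tendsto T un u"
proof (rule ccontr)
  assume "\<not> L2_tendsto T un u"
  then obtain e s where e: "0 < e" and s: "strict_mono (s :: nat \<Rightarrow> nat)"
    and far: "\<And>n. e \<le> \<bar>L2_norm T (\<lambda>t. un (s n) t - u t) - 0\<bar>"
    unfolding L2_tendsto_def by (rule not_LIMSEQ_subseq) (rule that)
  obtain x where x: "\<And>n. x n \<in> Kn n" "x \<longlonglongrightarrow> u0"
    using \<open>mosco_converges Kn K\<close> \<open>u0 \<in> K\<close> unfolding mosco_converges_def by meson
  have lims: "(\<lambda>n. x (s n)) \<longlonglongrightarrow> u0" "(\<lambda>n. j (u0n (s n))) \<longlonglongrightarrow> j u0"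
    using LIMSEQ_subseq_LIMSEQ[OF x(2) s] LIMSEQ_subseq_LIMSEQ[OF assms(18) s] by (simp_all add: o_def)
  \<comment> \<open>Recovery sequences are restricted to the indices \<open>s n\<close>, and indices
    that tend to infinity still do so after composition with \<open>s\<close>.\<close>
  have mosco: "mosco_converges (\<lambda>n. Kn (s n)) K"
    unfolding mosco_converges_def
  proof (intro conjI ballI allI impI)
    fix w assume "w \<in> K"
    then obtain ws where "\<And>n. ws n \<in> Kn n" "ws \<longlonglongrightarrow> w"
      using \<open>mosco_converges Kn K\<close> unfolding mosco_converges_def by meson
    then show "\<exists>ws. (\<forall>n. ws n \<in> Kn (s n)) \<and> ws \<longlonglongrightarrow> w"
      using LIMSEQ_subseq_LIMSEQ[OF _ s, of ws w] by (intro exI[of _ "ws \<circ> s"]) simp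
  next
    fix ns ws w
    assume *: "filterlim ns at_top sequentially \<and> (\<forall>k. ws k \<in> Kn (s (ns k))) \<and> weakly_tendsto ws w"
    have "filterlim (\<lambda>k. s (ns k)) at_top sequentially"
      by (rule filterlim_compose[OF filterlim_subseq[OF s]]) (use * in simp)
    then show "w \<in> K"
      by (rule mosco_convergesD[OF assms(19)]) (use * in auto)
  qed
  have "\<exists>r. strict_mono (r :: nat \<Rightarrow> nat) \<and> L2_tendsto T (\<lambda>n. un (s (r n))) u"
    by (rule solutions_subseq_tendsto[where Kn="\<lambda>n. Kn (s n)" and fn="\<lambda>n. fn (s n)"
          and un="\<lambda>n. un (s n)" and u0n="\<lambda>n. u0n (s n)" and x="\<lambda>n. x (s n)",
          OF \<open>0 < T\<close> less_imp_le[OF \<open>0 < M\<close>] \<open>0 < \<alpha>\<close> assms(5,6,7) \<open>closed K\<close> \<open>convex K\<close>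
            x(1) lims(1) \<open>u0 \<in> K\<close> assms(12,13) L2_tendsto_subseq[OF assms(16) s] assms(14,15)
            lims(2) mosco])
  then obtain r where r: "L2_tendsto T (\<lambda>n. un (s (r n))) u" by blast
  have "e \<le> L2_norm T (\<lambda>t. un (s (r n)) t - u t)" for n
    using far[of "r n"] L2_norm_nonneg[of T "\<lambda>t. un (s (r n)) t - u t"] by simp
  then have "e \<le> 0"
    by (intro LIMSEQ_le_const[OF r[unfolded L2_tendsto_def]]) blast
  with e show False by simp
qed

end
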